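(* Let $0<a<b<1$ and let $H:\mathbb{R}\to[a,b]$ be a (deterministic) function such that for every $t\in\mathbb{R}$ there exist $R_t\in(0,1)$ and $c_t>0$ such that $$|H(s)-H(t)|\le\frac{c_t}{\log|s-t|^{-1}}\qquad\text{for all } s\in\mathbb{R} \text{ with } 0<|s-t|\le R_t .$$ Let $(\varepsilon_{j,k})_{(j,k)\in\mathbb{Z}^2}$ be i.i.d. $\mathcal N(0,1)$ random variables and let $$Z(t)=\sum_{j\in\mathbb{Z}}\sum_{k\in\mathbb{Z}}2^{-jH(k2^{-j})}\varepsilon_{j,k}\Big(\Psi\big(2^jt-k,H(k2^{-j})\big)-\Psi\big(-k,H(k2^{-j})\big)\Big),\qquad t\in\mathbb{R}.$$ Then almost surely, for every non-empty open interval $I$ of $\mathbb{R}$: (1) there exists $t\in I$ such that $$\limsup_{s\to t}\frac{|Z(s)-Z(t)|}{|s-t|^{H(t)}\sqrt{\log|s-t|^{-1}}}<\infty;$$ (2) (Lebesgue-)almost every $t\in I$ is such that $$\limsup_{s\to t}\frac{|Z(s)-Z(t)|}{|s-t|^{H(t)}\sqrt{\log\log|s-t|^{-1}}}<\infty;$$ (3) there exists $t\in I$ such that $$\limsup_{s\to t}\frac{|Z(s)-Z(t)|}{|s-t|^{H(t)}}<\infty.$$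
   Context: $\psi$ is the Lemarié–Meyer mother wavelet: $\{2^{j/2}\psi(2^j\cdot-k):(j,k)\in\mathbb{Z}^2\}$ is an orthonormal basis of $L^2(\mathbb{R})$, $\psi$ is in the Schwartz class, and $\widehat\psi$ is compactly supported and vanishes in a neighbourhood of $0$. The function $\Psi:\mathbb{R}^2\to\mathbb{R}$ is $$\Psi(t,\theta)=\int_{\mathbb{R}}\frac{e^{it\xi}\widehat\psi(\xi)}{|\xi|^{\theta+\frac12}}\,d\xi ;$$ it is $C^\infty$ and satisfies $\sup_{\theta\in[a,b]}\sup_{t\in\mathbb{R}}(3+|t|)^L|D_t^mD_\theta^n\Psi(t,\theta)|<\infty$ for all $L,m,n\in\{0,1,2,\dots\}$. The series defining $Z$ converges almost surely, uniformly on compact sets, and $Z$ denotes its sum. *)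

theory Defs
  imports "HOL-Probability.Probability"
begin

subsection \<open>Orthonormal bases of L2\<close>

definition L2_fun :: "'a measure \<Rightarrow> ('a \<Rightarrow> complex) \<Rightarrow> bool" where
  "L2_fun M f \<longleftrightarrow> f \<in> borel_measurable M \<and> integrable M (\<lambda>x. (cmod (f x))\<^sup>2)"

definition L2_inner :: "'a measure \<Rightarrow> ('a \<Rightarrow> complex) \<Rightarrow> ('a \<Rightarrow> complex) \<Rightarrow> complex" where
  "L2_inner M f g = (LINT x|M. f x * cnj (g x))"

definition L2_norm :: "'a measure \<Rightarrow> ('a \<Rightarrow> complex) \<Rightarrow> real" where
  "L2_norm M f = sqrt (LINT x|M. (cmod (f x))\<^sup>2)"

text \<open>
  Elements of L2 are represented by functions rather than classes modulo null sets;
  the last conjunct is density of the linear span in the L2 norm.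
\<close>
definition L2_orthonormal_basis :: "'a measure \<Rightarrow> ('i \<Rightarrow> 'a \<Rightarrow> complex) \<Rightarrow> bool" where
  "L2_orthonormal_basis M e \<longleftrightarrow>
     (\<forall>i. L2_fun M (e i)) \<and>
     (\<forall>i i'. L2_inner M (e i) (e i') = (if i = i' then 1 else 0)) \<and>
     (\<forall>f. L2_fun M f \<longrightarrow>
        (\<forall>\<epsilon>>0. \<exists>F c. finite F \<and> L2_norm M (\<lambda>x. f x - (\<Sum>i\<in>F. c i * e i x)) < \<epsilon>))"

subsection \<open>The Lemarie--Meyer wavelet\<close>

definition schwartz :: "(real \<Rightarrow> real) \<Rightarrow> bool" where
  "schwartz f \<longleftrightarrow>
     (\<forall>n t. (deriv ^^ n) f differentiable (at t)) \<and>
     (\<forall>m n. bounded (range (\<lambda>t. t ^ m * (deriv ^^ n) f t)))"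

text \<open>
  Angular-frequency convention without normalising constant; another constant in front
  only rescales the process defined below by a nonzero factor.
\<close>
definition fourier :: "(real \<Rightarrow> real) \<Rightarrow> real \<Rightarrow> complex" where
  "fourier f \<xi> = (LINT t|lborel. cis (- (t * \<xi>)) * complex_of_real (f t))"

definition lemarie_meyer_wavelet :: "(real \<Rightarrow> real) \<Rightarrow> bool" where
  "lemarie_meyer_wavelet \<psi> \<longleftrightarrow>
     L2_orthonormal_basis lborel
       (\<lambda>(j::int, k::int) t. complex_of_real (2 powr (real_of_int j / 2) * \<psi> (2 powi j * t - real_of_int k))) \<and>
     schwartz \<psi> \<and>
     compact (closure {\<xi>. fourier \<psi> \<xi> \<noteq> 0}) \<and>
     (\<forall>\<^sub>F \<xi> in nhds 0. fourier \<psi> \<xi> = 0)"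

text \<open>
  The integral is real because \<^term>\<open>\<psi>\<close> is; taking the real part only fixes the type
  (see \<open>of_real_Psi\<close>).
\<close>
definition Psi :: "(real \<Rightarrow> real) \<Rightarrow> real \<Rightarrow> real \<Rightarrow> real" where
  "Psi \<psi> t \<theta> =
     Re (LINT \<xi>|lborel. cis (t * \<xi>) * fourier \<psi> \<xi> / complex_of_real (\<bar>\<xi>\<bar> powr (\<theta> + 1/2)))"

lemma cnj_fourier: "cnj (fourier f \<xi>) = fourier f (- \<xi>)"
  by (simp add: fourier_def cis_cnj flip: Bochner_Integration.integral_cnj)

lemma of_real_Psi:
  "complex_of_real (Psi \<psi> t \<theta>) =
     (LINT \<xi>|lborel. cis (t * \<xi>) * fourier \<psi> \<xi> / complex_of_real (\<bar>\<xi>\<bar> powr (\<theta> + 1/2)))"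
  (is "_ = integral\<^sup>L lborel ?f")
proof -
  have "cnj (integral\<^sup>L lborel ?f) = (LINT \<xi>|lborel. ?f (0 + (-1) * \<xi>))"
    by (simp add: cnj_fourier cis_cnj flip: Bochner_Integration.integral_cnj)
  also have "\<dots> = integral\<^sup>L lborel ?f"
    using lborel_integral_real_affine[of "-1" ?f 0] by simp
  finally have "Im (integral\<^sup>L lborel ?f) = 0"
    by (simp add: complex_eq_iff)
  then show ?thesis
    by (simp add: Psi_def complex_eq_iff)
qed

subsection \<open>The random wavelet series\<close>

text \<open>
  \<^const>\<open>infsum\<close> is the sum of an absolutely convergent series and \<open>0\<close> otherwise.
  For i.i.d. standard Gaussian \<open>\<epsilon>\<close> and \<open>H\<close> with values in \<open>[a,b] \<subseteq> (0,1)\<close> the double series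
  converges absolutely for all \<open>t\<close>, almost surely, so the default value is only
  ever used on a null event.
\<close>
definition Zproc ::
  "(real \<Rightarrow> real) \<Rightarrow> (real \<Rightarrow> real) \<Rightarrow> (int \<times> int \<Rightarrow> 'w \<Rightarrow> real) \<Rightarrow> real \<Rightarrow> 'w \<Rightarrow> real" where
  "Zproc \<psi> H \<epsilon> t \<omega> =
     (\<Sum>\<^sub>\<infinity>j::int. \<Sum>\<^sub>\<infinity>k::int.
        2 powr (- real_of_int j * H (real_of_int k * 2 powi (- j))) * \<epsilon> (j, k) \<omega> *
        (Psi \<psi> (2 powi j * t - real_of_int k) (H (real_of_int k * 2 powi (- j)))
         - Psi \<psi> (- real_of_int k) (H (real_of_int k * 2 powi (- j)))))"

end

theory Submission
  imports Defs
begin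

text \<open>
  Fix \<open>t\<close> and measure distances at level \<open>j\<close> in units of \<open>2\<^sup>-\<^sup>j\<close>: put \<open>u = |2\<^sup>j t - k|\<close>. Two facts make every term of the
  series depend mainly on the coefficients with moderate \<open>u\<close>. The kernel \<open>\<Psi>\<close> and its derivative in the first
  variable decay like \<open>(1 + |x|)\<^sup>-\<^sup>4\<close>, uniformly for \<open>\<theta> \<in> [a,b]\<close>, because \<open>\<Psi>(_,\<theta>)\<close> is the Fourier transform of a smooth
  function supported in an annulus (\<open>Psi_increment_bound\<close>). And the logarithmic modulus of \<open>H\<close> at \<open>t\<close> is exactly
  what makes \<open>2 powr (-j H(k 2\<^sup>-\<^sup>j))\<close> comparable with \<open>2 powr (-j H(t))\<close> for nodes near \<open>t\<close>, up to a factor that grows very slowly with \<open>u\<close>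
  (\<open>dyadic_exponent_local_bound\<close>).
  
  So suppose \<open>|\<epsilon>\<^sub>j\<^sub>k| \<le> C g(j) (1 + u) powr \<delta>\<close> for all \<open>j \<ge> 0\<close> and all \<open>k\<close>, with a small \<open>\<delta>\<close> and a slowly varying \<open>g\<close>.
  If \<open>|s - t|\<close> is about \<open>2\<^sup>-\<^sup>N\<close>, the levels \<open>j \<le> N\<close> contribute to \<open>Z(s) - Z(t)\<close> through the Lipschitz bound for \<open>\<Psi>\<close> and
  the levels \<open>j > N\<close> through its size. Both contributions decay geometrically in \<open>|j - N|\<close>, as \<open>0 < H(t) < 1\<close>, and the
  sum is at most a constant times \<open>g(N) |s - t| powr H(t)\<close> (\<open>Z_local_modulus\<close>). The regularity of \<open>Z\<close> at \<open>t\<close> is thus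
  read off from the size of the Gaussian coefficients seen from \<open>t\<close>: a bounded \<open>g\<close> gives assertion (3), and with it
  (1), while \<open>g(j) = sqrt (ln (3 + j))\<close> gives (2).
  
  Coefficient bounds come from the exponential moment of \<open>\<epsilon>\<^sup>2/8\<close>. For a fixed \<open>t\<close>, a weighted sum of the
  \<open>exp (\<epsilon>\<^sub>j\<^sub>k\<^sup>2/8)\<close> with weights \<open>(1 + |j|)\<^sup>-\<^sup>2 (1 + u)\<^sup>-\<^sup>2\<close> has a finite mean, hence is almost surely finite; Fubini's
  theorem turns this into a statement about almost every \<open>t\<close> (\<open>AE_ordinary\<close>).
  
  For a fixed \<open>t\<close> the coefficients near \<open>t\<close>, being independent over infinitely many levels, almost surely admit no bound
  with a constant \<open>g\<close>, so points of that kind need a construction. Starting from a dyadic interval, keep from each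
  generation of dyadic subintervals those around which a weighted mean of \<open>exp (\<epsilon>\<^sub>j\<^sub>k\<^sup>2/8)\<close>, over the coefficients of that
  level, is at most \<open>A\<close>. The coefficients of a new level are independent of the intervals kept so far, so
  Chebyshev's inequality shows that the probability of losing more than a quarter of the children of \<open>n\<close> intervals
  is \<open>O(A\<^sup>-\<^sup>2 / n)\<close> (\<open>energy_large_prob\<close>). As long as that does not happen the population grows by the factor
  \<open>3/2\<close>, so these probabilities have a sum of order \<open>A\<^sup>-\<^sup>2\<close>, and almost surely some \<open>A\<close> lets the tree survive for ever
  (\<open>AE_slow_tree_infinite\<close>). By compactness the surviving intervals accumulate at a point where the coefficients are
  bounded as required (\<open>slow_point_of_tree\<close>).
\<close>

section \<open>Decay of the kernel\<close>

lemma has_vector_derivative_cis_mult: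
  "((\<lambda>x. cis (c * x)) has_vector_derivative \<i> * complex_of_real c * cis (c * x)) (at x)"
proof -
  have "((\<lambda>x. exp (\<i> * complex_of_real (c * x))) has_vector_derivative
      \<i> * complex_of_real c * exp (\<i> * complex_of_real (c * x))) (at x)"
    using has_vector_derivative_real_field[of "\<lambda>x. exp (\<i> * (complex_of_real c * x))"
        "\<i> * complex_of_real c * exp (\<i> * (complex_of_real c * complex_of_real x))" x UNIV]
    by (force intro!: derivative_eq_intros)
  then show ?thesis by (simp add: cis_conv_exp)
qed

lemma norm_cis_diff_le: "cmod (cis x - cis y) \<le> \<bar>x - y\<bar>"
proof -
  have "cis x - cis y = cis y * (cis (x - y) - 1)"
    by (simp add: right_diff_distrib cis_mult)
  then have "cmod (cis x - cis y) = cmod (cis (x - y) - 1)"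
    by (simp add: norm_mult)
  also have "\<dots> \<le> \<bar>x - y\<bar>"
    using iexp_approx1[of "x - y" 0] by (simp add: cis_conv_exp)
  finally show ?thesis .
qed

lemma measurable_cis [measurable]: "cis \<in> borel_measurable borel"
  by (intro borel_measurable_continuous_onI continuous_intros)

text \<open>
  Differentiation under the integral sign. The difference quotients of \<open>cis (t x)\<close> in \<open>t\<close> are dominated by \<open>2 |x|\<close>, so an
  integrable first moment suffices. The lemma serves in both directions: for the derivatives of \<open>fourier \<psi>\<close> and
  for the derivative of \<open>\<Psi>\<close> in its first variable.
\<close>
lemma has_vector_derivative_fourier_integral:
  fixes g :: "real \<Rightarrow> complex"
  assumes g: "integrable lborel g" and xg: "integrable lborel (\<lambda>x. complex_of_real x * g x)"
  shows "((\<lambda>t. LINT x|lborel. cis (t * x) * g x) has_vector_derivative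
           (LINT x|lborel. cis (t * x) * (\<i> * (complex_of_real x * g x)))) (at t)"
proof -
  have [measurable]: "g \<in> borel_measurable borel"
    using borel_measurable_integrable[OF g] by simp
  let ?D = "LINT x|lborel. cis (t * x) * (\<i> * (complex_of_real x * g x))"
  let ?s = "\<lambda>y x. (cis (y * x) - cis (t * x) - complex_of_real (y - t) * (\<i> * complex_of_real x * cis (t * x))) * g x / complex_of_real \<bar>y - t\<bar>"
  have i1: "integrable lborel (\<lambda>x. cis (y * x) * g x)" for y
    by (rule Bochner_Integration.integrable_bound[OF g]) (auto simp: norm_mult)
  have i2: "integrable lborel (\<lambda>x. cis (t * x) * (\<i> * (complex_of_real x * g x)))"
    by (rule Bochner_Integration.integrable_bound[OF xg]) (auto simp: norm_mult)
  have "((\<lambda>y. ((LINT x|lborel. cis (y * x) * g x) - (LINT x|lborel. cis (t * x) * g x) - (y - t) *\<^sub>R ?D) /\<^sub>R \<bar>y - t\<bar>) \<longlongrightarrow> 0) (at t)"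
    unfolding tendsto_at_iff_sequentially
  proof (intro allI impI)
    fix Y assume Y: "\<forall>i. Y i \<in> UNIV - {t}" "Y \<longlonglongrightarrow> t"
    have eq: "((LINT x|lborel. cis (Y n * x) * g x) - (LINT x|lborel. cis (t * x) * g x) - (Y n - t) *\<^sub>R ?D) /\<^sub>R \<bar>Y n - t\<bar>
       = (LINT x|lborel. ?s (Y n) x)" for n
    proof -
      have "(LINT x|lborel. ?s (Y n) x) =
        (LINT x|lborel. (cis (Y n * x) * g x - cis (t * x) * g x - (Y n - t) *\<^sub>R (cis (t * x) * (\<i> * (complex_of_real x * g x)))) /\<^sub>R \<bar>Y n - t\<bar>)"
        by (intro Bochner_Integration.integral_cong)
           (auto simp: scaleR_conv_of_real field_simps)
      also have "\<dots> = ((LINT x|lborel. cis (Y n * x) * g x) - (LINT x|lborel. cis (t * x) * g x) - (Y n - t) *\<^sub>R ?D) /\<^sub>R \<bar>Y n - t\<bar>"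
        using i1 i2 by simp
      finally show ?thesis by simp
    qed
    have "(\<lambda>n. LINT x|lborel. ?s (Y n) x) \<longlonglongrightarrow> (LINT x::real|lborel. 0)"
    proof (rule integral_dominated_convergence[where s="\<lambda>n. ?s (Y n)" and f="\<lambda>_. 0"
          and w="\<lambda>x. 2 * cmod (complex_of_real x * g x)"])
      show "integrable lborel (\<lambda>x. 2 * cmod (complex_of_real x * g x))"
        using xg by auto
      show "AE x in lborel. (\<lambda>n. ?s (Y n) x) \<longlonglongrightarrow> 0"
      proof (rule AE_I2)
        fix x :: real
        have "((\<lambda>y. cis (x * y)) has_vector_derivative \<i> * complex_of_real x * cis (x * t)) (at t)"
          by (rule has_vector_derivative_cis_mult)
        then have "((\<lambda>y. (cis (x * y) - cis (x * t) - (y - t) *\<^sub>R (\<i> * complex_of_real x * cis (x * t))) /\<^sub>R norm (y - t)) \<longlongrightarrow> 0) (at t)"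
          unfolding has_vector_derivative_def has_derivative_at_within by auto
        then have "(\<lambda>n. (cis (x * Y n) - cis (x * t) - (Y n - t) *\<^sub>R (\<i> * complex_of_real x * cis (x * t))) /\<^sub>R norm (Y n - t)) \<longlonglongrightarrow> 0"
          unfolding tendsto_at_iff_sequentially using Y by (auto simp: o_def)
        from tendsto_mult_right[OF this, of "g x"]
        show "(\<lambda>n. ?s (Y n) x) \<longlonglongrightarrow> 0"
          by (simp add: scaleR_conv_of_real field_simps)
      qed
      show "AE x in lborel. norm (?s (Y n) x) \<le> 2 * cmod (complex_of_real x * g x)" for n
      proof (rule AE_I2)
        fix x :: real
        have ne: "Y n \<noteq> t" using Y by auto
        have "cmod (cis (Y n * x) - cis (t * x) - complex_of_real (Y n - t) * (\<i> * complex_of_real x * cis (t * x)))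
          \<le> cmod (cis (Y n * x) - cis (t * x)) + cmod (complex_of_real (Y n - t) * (\<i> * complex_of_real x * cis (t * x)))"
          by (rule norm_triangle_ineq4)
        also have "\<dots> \<le> 2 * (\<bar>Y n - t\<bar> * \<bar>x\<bar>)"
          using norm_cis_diff_le[of "Y n * x" "t * x"]
          by (simp add: norm_mult abs_mult flip: left_diff_distrib of_real_diff) (simp only: mult.commute)
        finally have "cmod (cis (Y n * x) - cis (t * x) - complex_of_real (Y n - t) * (\<i> * complex_of_real x * cis (t * x))) * cmod (g x) / \<bar>Y n - t\<bar>
          \<le> 2 * (\<bar>Y n - t\<bar> * \<bar>x\<bar>) * cmod (g x) / \<bar>Y n - t\<bar>"
          by (intro divide_right_mono mult_right_mono) auto
        also have "\<dots> = 2 * (\<bar>x\<bar> * cmod (g x))" using ne by simp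
        finally show "norm (?s (Y n) x) \<le> 2 * cmod (complex_of_real x * g x)"
          by (simp add: norm_mult norm_divide)
      qed
    qed measurable
    then show "((\<lambda>y. ((LINT x|lborel. cis (y * x) * g x) - (LINT x|lborel. cis (t * x) * g x) - (y - t) *\<^sub>R ?D) /\<^sub>R \<bar>y - t\<bar>) \<circ> Y) \<longlonglongrightarrow> 0"
      unfolding o_def eq by simp
  qed
  then show ?thesis
    unfolding has_vector_derivative_def has_derivative_at_within
    by (auto intro: bounded_linear_intros)
qed

text \<open>
  The integrands of \<open>\<Psi>\<close> form a family indexed by \<open>\<theta>\<close>, and the decay of \<open>\<Psi>\<close> has to be uniform in \<open>\<theta>\<close>. Therefore
  support and bounds are required uniformly over an index set \<open>Q\<close>.
\<close>
definition annular :: "real \<Rightarrow> real \<Rightarrow> 'p set \<Rightarrow> ('p \<Rightarrow> real \<Rightarrow> complex) \<Rightarrow> bool" where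
  "annular r R Q f \<longleftrightarrow>
     (\<forall>q\<in>Q. continuous_on UNIV (f q) \<and> (\<forall>\<xi>. f q \<xi> \<noteq> 0 \<longrightarrow> r \<le> \<bar>\<xi>\<bar> \<and> \<bar>\<xi>\<bar> \<le> R)) \<and>
     (\<exists>B. \<forall>q\<in>Q. \<forall>\<xi>. cmod (f q \<xi>) \<le> B)"

primrec annular_smooth :: "nat \<Rightarrow> real \<Rightarrow> real \<Rightarrow> 'p set \<Rightarrow> ('p \<Rightarrow> real \<Rightarrow> complex) \<Rightarrow> bool" where
  "annular_smooth 0 r R Q f \<longleftrightarrow> annular r R Q f"
| "annular_smooth (Suc n) r R Q f \<longleftrightarrow> annular r R Q f \<and>
     (\<exists>f'. (\<forall>q\<in>Q. \<forall>\<xi>. (f q has_vector_derivative f' q \<xi>) (at \<xi>)) \<and> annular_smooth n r R Q f')"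

lemma annular_smooth_imp_annular: "annular_smooth n r R Q f \<Longrightarrow> annular r R Q f"
  by (cases n) auto

lemma annular_smooth_Suc_imp: "annular_smooth (Suc n) r R Q f \<Longrightarrow> annular_smooth n r R Q f"
proof (induction n arbitrary: f)
  case (Suc n)
  then show ?case by (metis annular_smooth.simps(2))
qed auto

lemma annular_add:
  assumes "annular r R Q f" "annular r R Q g"
  shows "annular r R Q (\<lambda>q \<xi>. f q \<xi> + g q \<xi>)"
proof -
  obtain B C where "\<forall>q\<in>Q. \<forall>\<xi>. cmod (f q \<xi>) \<le> B" "\<forall>q\<in>Q. \<forall>\<xi>. cmod (g q \<xi>) \<le> C"
    using assms unfolding annular_def by blast
  then have "\<forall>q\<in>Q. \<forall>\<xi>. cmod (f q \<xi> + g q \<xi>) \<le> B + C"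
    by (meson add_mono norm_triangle_le)
  then show ?thesis
    using assms unfolding annular_def
    by (auto intro!: continuous_on_add) (metis add.right_neutral add.left_neutral)+
qed

lemma annular_smooth_add:
  "annular_smooth n r R Q f \<Longrightarrow> annular_smooth n r R Q g \<Longrightarrow>
     annular_smooth n r R Q (\<lambda>q \<xi>. f q \<xi> + g q \<xi>)"
proof (induction n arbitrary: f g)
  case (Suc n)
  obtain f' g' where "\<forall>q\<in>Q. \<forall>\<xi>. (f q has_vector_derivative f' q \<xi>) (at \<xi>)"
    "annular_smooth n r R Q f'"
    "\<forall>q\<in>Q. \<forall>\<xi>. (g q has_vector_derivative g' q \<xi>) (at \<xi>)" "annular_smooth n r R Q g'"
    using Suc.prems by auto
  then show ?case
    using Suc.prems Suc.IH[of f' g'] annular_add[of r R Q f g]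
    by (auto intro!: exI[of _ "\<lambda>q \<xi>. f' q \<xi> + g' q \<xi>"] has_vector_derivative_add)
qed (simp add: annular_add)

text \<open>
  A homogeneous function of degree \<open>s\<close> on the punctured line, even or odd according to \<open>k\<close>. With the sign as a separate
  factor the class is closed under differentiation, so that one induction handles \<open>|\<xi>| powr (-\<theta>-1/2)\<close> together with
  all its derivatives.
\<close>
definition homog :: "real \<Rightarrow> nat \<Rightarrow> real \<Rightarrow> real \<Rightarrow> complex" where
  "homog p k s \<xi> = complex_of_real (p * sgn \<xi> ^ k * \<bar>\<xi>\<bar> powr s)"

lemma has_vector_derivative_homog:
  assumes "\<xi> \<noteq> 0"
  shows "(homog p k s has_vector_derivative homog (p * s) (Suc k) (s - 1) \<xi>) (at \<xi>)"
proof (cases "\<xi> > 0")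
  case True
  have "((\<lambda>x. complex_of_real (p * x powr s)) has_vector_derivative complex_of_real (p * (s * \<xi> powr (s - 1)))) (at \<xi>)"
    using True by (intro has_vector_derivative_of_real) (auto intro!: derivative_eq_intros)
  then have "(homog p k s has_vector_derivative complex_of_real (p * (s * \<xi> powr (s - 1)))) (at \<xi>)"
    by (rule has_vector_derivative_transform_within_open[where S="{0<..}"])
       (use True in \<open>auto simp: homog_def\<close>)
  then show ?thesis using True by (simp add: homog_def mult.assoc)
next
  case False
  then have n: "\<xi> < 0" using assms by simp
  have "((\<lambda>x. complex_of_real (p * (-1)^k * (-x) powr s)) has_vector_derivative complex_of_real (p * (-1)^k * (s * (-\<xi>) powr (s - 1) * (-1)))) (at \<xi>)"
    using n by (intro has_vector_derivative_of_real) (auto intro!: derivative_eq_intros)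
  then have "(homog p k s has_vector_derivative complex_of_real (p * (-1)^k * (s * (-\<xi>) powr (s - 1) * (-1)))) (at \<xi>)"
    by (rule has_vector_derivative_transform_within_open[where S="{..<0}"])
       (use n in \<open>auto simp: homog_def\<close>)
  then show ?thesis using n by (simp add: homog_def algebra_simps)
qed

lemma continuous_on_homog: "continuous_on (-{0}) (homog p k s)"
  by (intro continuous_at_imp_continuous_on ballI has_vector_derivative_continuous[OF has_vector_derivative_homog]) auto

lemma norm_homog_le:
  assumes "0 < r" "r \<le> \<bar>\<xi>\<bar>" "\<bar>\<xi>\<bar> \<le> R" "\<bar>p\<bar> \<le> P" "\<bar>s\<bar> \<le> S"
  shows "cmod (homog p k s \<xi>) \<le> P * exp (S * (\<bar>ln r\<bar> + \<bar>ln R\<bar>))"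
proof -
  have l: "\<bar>ln \<bar>\<xi>\<bar>\<bar> \<le> \<bar>ln r\<bar> + \<bar>ln R\<bar>"
    using assms ln_mono[of r "\<bar>\<xi>\<bar>"] ln_mono[of "\<bar>\<xi>\<bar>" R] by linarith
  have x: "\<xi> \<noteq> 0" using assms by auto
  have "s * ln \<bar>\<xi>\<bar> \<le> \<bar>s\<bar> * \<bar>ln \<bar>\<xi>\<bar>\<bar>" by (metis abs_ge_self abs_mult)
  also have "\<dots> \<le> S * (\<bar>ln r\<bar> + \<bar>ln R\<bar>)"
    using assms l by (intro mult_mono) auto
  finally have "\<bar>\<xi>\<bar> powr s \<le> exp (S * (\<bar>ln r\<bar> + \<bar>ln R\<bar>))"
    using x by (simp add: powr_def)
  moreover have "\<bar>sgn \<xi> ^ k\<bar> = 1" using x by (simp add: power_abs sgn_if)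
  ultimately show ?thesis
    using assms unfolding homog_def norm_of_real abs_mult
    by (intro mult_mono) auto
qed

text \<open>
  The singularity of the homogeneous factor at \<open>0\<close> is harmless because the annular factor vanishes near \<open>0\<close>.
\<close>
lemma annular_mult_homog:
  assumes r: "0 < r" and f: "annular r R Q f"
    and P: "\<And>q. q \<in> Q \<Longrightarrow> \<bar>p q\<bar> \<le> P" and S: "\<And>q. q \<in> Q \<Longrightarrow> \<bar>s q\<bar> \<le> S"
  shows "annular r R Q (\<lambda>q \<xi>. f q \<xi> * homog (p q) k (s q) \<xi>)"
  unfolding annular_def
proof (intro conjI ballI)
  obtain B where B: "\<And>q \<xi>. q \<in> Q \<Longrightarrow> cmod (f q \<xi>) \<le> B"
    using f unfolding annular_def by blast
  have sup: "r \<le> \<bar>\<xi>\<bar> \<and> \<bar>\<xi>\<bar> \<le> R" if "q \<in> Q" "f q \<xi> \<noteq> 0" for q \<xi>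
    using f that unfolding annular_def by blast
  show "\<forall>\<xi>. f q \<xi> * homog (p q) k (s q) \<xi> \<noteq> 0 \<longrightarrow> r \<le> \<bar>\<xi>\<bar> \<and> \<bar>\<xi>\<bar> \<le> R" if "q \<in> Q" for q
    using sup that by auto
  show "continuous_on UNIV (\<lambda>\<xi>. f q \<xi> * homog (p q) k (s q) \<xi>)" if q: "q \<in> Q" for q
  proof -
    have "continuous_on (-{0}) (\<lambda>\<xi>. f q \<xi> * homog (p q) k (s q) \<xi>)"
      using f q unfolding annular_def
      by (intro continuous_intros continuous_on_homog) (auto intro: continuous_on_subset)
    moreover have "continuous_on {-r<..<r} (\<lambda>\<xi>. f q \<xi> * homog (p q) k (s q) \<xi>)"
    proof (rule continuous_on_eq[OF continuous_on_const[of _ 0]])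
      fix x assume "x \<in> {-r<..<r}"
      then have "f q x = 0" using sup[OF q, of x] by (cases "f q x = 0") auto
      then show "0 = f q x * homog (p q) k (s q) x" by simp
    qed
    ultimately have "continuous_on (-{0} \<union> {-r<..<r}) (\<lambda>\<xi>. f q \<xi> * homog (p q) k (s q) \<xi>)"
      by (intro continuous_on_open_Un) auto
    moreover have "-{0} \<union> {-r<..<r} = UNIV" using r by auto
    ultimately show ?thesis by simp
  qed
  show "\<exists>B. \<forall>q\<in>Q. \<forall>\<xi>. cmod (f q \<xi> * homog (p q) k (s q) \<xi>) \<le> B"
  proof (intro exI ballI allI)
    fix q \<xi> assume q: "q \<in> Q"
    show "cmod (f q \<xi> * homog (p q) k (s q) \<xi>) \<le> B * (P * exp (S * (\<bar>ln r\<bar> + \<bar>ln R\<bar>)))"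
    proof (cases "f q \<xi> = 0")
      case True
      have "0 \<le> B" "0 \<le> P" using B[OF q, of 0] P[OF q] by (meson norm_ge_zero abs_ge_zero order_trans)+
      then show ?thesis using True by simp
    next
      case False
      show ?thesis unfolding norm_mult
        using sup[OF q False] r B[OF q] P[OF q] S[OF q]
        by (intro mult_mono norm_homog_le) (auto intro: order_trans[OF norm_ge_zero])
    qed
  qed
qed

text \<open>
  By the product rule the derivative is a sum of two terms of the same form, one with \<open>f'\<close> and one with \<open>s\<close> lowered by
  \<open>1\<close>; hence the generalization over all families \<open>p\<close>, \<open>s\<close>.
\<close>
lemma annular_smooth_mult_homog:
  assumes r: "0 < r" 
  shows "annular_smooth n r R Q f \<Longrightarrow> (\<And>q. q \<in> Q \<Longrightarrow> \<bar>p q\<bar> \<le> P) \<Longrightarrow> (\<And>q. q \<in> Q \<Longrightarrow> \<bar>s q\<bar> \<le> S) \<Longrightarrow>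
    annular_smooth n r R Q (\<lambda>q \<xi>. f q \<xi> * homog (p q) k (s q) \<xi>)"
proof (induction n arbitrary: f p P s S k)
  case 0
  have "annular r R Q f" using "0.prems" by simp
  from annular_mult_homog[OF r this "0.prems"(2,3)] show ?case by simp
next
  case (Suc n)
  obtain f' where f': "\<And>q \<xi>. q \<in> Q \<Longrightarrow> (f q has_vector_derivative f' q \<xi>) (at \<xi>)" and a': "annular_smooth n r R Q f'"
    using Suc.prems(1) unfolding annular_smooth.simps by blast
  have sup: "r \<le> \<bar>\<xi>\<bar> \<and> \<bar>\<xi>\<bar> \<le> R" if "q \<in> Q" "f q \<xi> \<noteq> 0" for q \<xi>
    using annular_smooth_imp_annular[OF Suc.prems(1)] that unfolding annular_def by blast
  have sup': "r \<le> \<bar>\<xi>\<bar> \<and> \<bar>\<xi>\<bar> \<le> R" if "q \<in> Q" "f' q \<xi> \<noteq> 0" for q \<xi>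
    using annular_smooth_imp_annular[OF a'] that unfolding annular_def by blast
  let ?D = "\<lambda>q \<xi>. f' q \<xi> * homog (p q) k (s q) \<xi> + f q \<xi> * homog (p q * s q) (Suc k) (s q - 1) \<xi>"
  have "annular_smooth n r R Q ?D"
  proof (intro annular_smooth_add)
    show "annular_smooth n r R Q (\<lambda>q \<xi>. f' q \<xi> * homog (p q) k (s q) \<xi>)"
      by (rule Suc.IH[OF a' Suc.prems(2,3)])
    show "annular_smooth n r R Q (\<lambda>q \<xi>. f q \<xi> * homog (p q * s q) (Suc k) (s q - 1) \<xi>)"
    proof (rule Suc.IH[OF annular_smooth_Suc_imp[OF Suc.prems(1)]])
      show "\<bar>p q * s q\<bar> \<le> P * S" if "q \<in> Q" for q
        using Suc.prems(2,3)[OF that] by (simp add: abs_mult mult_mono')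
      show "\<bar>s q - 1\<bar> \<le> S + 1" if "q \<in> Q" for q
        using Suc.prems(3)[OF that] by linarith
    qed
  qed
  moreover have "((\<lambda>\<xi>. f q \<xi> * homog (p q) k (s q) \<xi>) has_vector_derivative ?D q \<xi>) (at \<xi>)" if q: "q \<in> Q" for q \<xi>
  proof (cases "\<xi> = 0")
    case False
    have "((\<lambda>\<xi>. f q \<xi> * homog (p q) k (s q) \<xi>) has_vector_derivative
       f q \<xi> * homog (p q * s q) (Suc k) (s q - 1) \<xi> + f' q \<xi> * homog (p q) k (s q) \<xi>) (at \<xi>)"
      by (rule has_vector_derivative_mult[OF f'[OF q] has_vector_derivative_homog[OF False]])
    then show ?thesis by (simp add: add.commute)
  next
    case True
    then have "?D q \<xi> = 0"
      using sup[OF q, of 0] sup'[OF q, of 0] r by (cases "f q 0 = 0"; cases "f' q 0 = 0"; simp)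
    moreover have "((\<lambda>\<xi>. f q \<xi> * homog (p q) k (s q) \<xi>) has_vector_derivative 0) (at \<xi>)"
    proof (rule has_vector_derivative_transform_within_open[where f="\<lambda>_. 0" and S="{-r<..<r}"])
      fix x assume "x \<in> {-r<..<r}"
      then have "f q x = 0" using sup[OF q, of x] by (cases "f q x = 0") auto
      then show "0 = f q x * homog (p q) k (s q) x" by simp
    qed (use r True in auto)
    ultimately show ?thesis by simp
  qed
  ultimately show ?case
    using annular_mult_homog[OF r annular_smooth_imp_annular[OF Suc.prems(1)] Suc.prems(2,3)]
    by (auto intro!: exI[of _ ?D])
qed

lemma annular_integrable:
  assumes "annular r R Q f" "q \<in> Q"
  shows "integrable lborel (f q)"
proof -
  have "continuous_on UNIV (f q)" and sup: "\<And>\<xi>. f q \<xi> \<noteq> 0 \<Longrightarrow> \<bar>\<xi>\<bar> \<le> R"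
    using assms unfolding annular_def by auto
  then have "integrable lborel (\<lambda>x. indicator {-R..R} x *\<^sub>R f q x)"
    using borel_integrable_atLeastAtMost'[of "-R" R "f q"] continuous_on_subset
    unfolding set_integrable_def by blast
  also have "(\<lambda>x. indicator {-R..R} x *\<^sub>R f q x) = f q"
    using sup by (force simp: indicator_def)
  finally show ?thesis .
qed

text \<open>
  The boundary terms vanish since \<open>f\<close> is zero at \<open>\<plusminus> (|R| + 1)\<close>.
\<close>
lemma fourier_integral_by_parts:
  fixes f f' :: "real \<Rightarrow> complex"
  assumes f: "annular r R {()} (\<lambda>_. f)" and f': "annular r R {()} (\<lambda>_. f')"
    and d: "\<And>\<xi>. (f has_vector_derivative f' \<xi>) (at \<xi>)"
  shows "(LINT \<xi>|lborel. cis (t * \<xi>) * f' \<xi>) = - (\<i> * complex_of_real t * (LINT \<xi>|lborel. cis (t * \<xi>) * f \<xi>))"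
proof -
  define T where "T = \<bar>R\<bar> + 1"
  have z: "f \<xi> = 0 \<and> f' \<xi> = 0" if "\<bar>\<xi>\<bar> \<ge> T" for \<xi>
    using f f' that unfolding annular_def T_def by force
  have [simp, intro]: "continuous_on UNIV f" "continuous_on UNIV f'"
    using f f' unfolding annular_def by auto
  have [measurable]: "f \<in> borel_measurable borel" "f' \<in> borel_measurable borel"
    by (auto intro: borel_measurable_continuous_onI)
  have i0: "integrable lborel f" "integrable lborel f'"
    using annular_integrable[OF f] annular_integrable[OF f'] by auto
  have i: "integrable lborel (\<lambda>\<xi>. cis (t * \<xi>) * f \<xi>)" "integrable lborel (\<lambda>\<xi>. cis (t * \<xi>) * f' \<xi>)"
    using i0 by (auto intro: Bochner_Integration.integrable_bound simp: norm_mult)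
  let ?d = "\<lambda>\<xi>. cis (t * \<xi>) * f' \<xi> + \<i> * complex_of_real t * cis (t * \<xi>) * f \<xi>"
  have c: "continuous_on S f" "continuous_on S f'" for S
    by (auto intro: continuous_on_subset)
  have "has_bochner_integral lborel (\<lambda>x. indicator {-T..T} x *\<^sub>R ?d x) (cis (t * T) * f T - cis (t * (-T)) * f (-T))"
  proof (rule has_bochner_integral_FTC_Icc[where F="\<lambda>\<xi>. cis (t * \<xi>) * f \<xi>"])
    show "((\<lambda>\<xi>. cis (t * \<xi>) * f \<xi>) has_vector_derivative ?d x) (at x within {-T..T})" for x
      by (rule has_vector_derivative_at_within[OF has_vector_derivative_mult[OF has_vector_derivative_cis_mult d]])
    show "continuous_on {-T..T} ?d"
      by (intro continuous_intros c)
  qed (simp add: T_def)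
  then have "has_bochner_integral lborel ?d 0"
  proof (rule has_bochner_integral_cong[THEN iffD1, rotated -1])
    fix x
    show "indicator {-T..T} x *\<^sub>R ?d x = ?d x"
      using z[of x] by (auto simp: indicator_def)
    show "(cis (t * T) * f T - cis (t * (-T)) * f (-T)) = 0"
      using z[of T] z[of "-T"] by (simp add: T_def)
  qed auto
  then have "(LINT \<xi>|lborel. cis (t * \<xi>) * f' \<xi> + \<i> * complex_of_real t * (cis (t * \<xi>) * f \<xi>)) = 0"
    by (simp add: has_bochner_integral_integral_eq mult.assoc)
  then show ?thesis
    using i by (subst (asm) Bochner_Integration.integral_add) (auto simp: eq_neg_iff_add_eq_0)
qed

lemma annular_single: "annular r R Q f \<Longrightarrow> q \<in> Q \<Longrightarrow> annular r R {()} (\<lambda>_. f q)"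
  unfolding annular_def by blast

text \<open>
  Each integration by parts trades one derivative of \<open>f\<close> for one power of \<open>t\<close>.
\<close>
lemma fourier_integral_decay:
  "annular_smooth n r R Q f \<Longrightarrow> \<exists>K. \<forall>q\<in>Q. \<forall>t. \<bar>t\<bar> ^ n * cmod (LINT \<xi>|lborel. cis (t * \<xi>) * f q \<xi>) \<le> K"
proof (induction n arbitrary: f)
  case 0
  then have f: "annular r R Q f" by simp
  then obtain B where B: "\<And>q \<xi>. q \<in> Q \<Longrightarrow> cmod (f q \<xi>) \<le> B"
    unfolding annular_def by blast
  show ?case
  proof (intro exI[of _ "B * (2 * \<bar>R\<bar>)"] ballI allI)
    fix q t assume q: "q \<in> Q"
    have cf: "continuous_on UNIV (f q)" and sup: "\<And>\<xi>. f q \<xi> \<noteq> 0 \<Longrightarrow> \<bar>\<xi>\<bar> \<le> R"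
      using f q unfolding annular_def by auto
    have B0: "B \<ge> 0" using B[OF q, of 0] by (meson norm_ge_zero order_trans)
    have "cmod (LINT \<xi>|lborel. cis (t * \<xi>) * f q \<xi>) \<le> (LINT \<xi>|lborel. cmod (cis (t * \<xi>) * f q \<xi>))"
      by (rule integral_norm_bound)
    also have "\<dots> \<le> (LINT \<xi>|lborel. B * indicator {-\<bar>R\<bar>..\<bar>R\<bar>} \<xi>)"
    proof (rule integral_mono)
      show "integrable lborel (\<lambda>\<xi>. cmod (cis (t * \<xi>) * f q \<xi>))"
        using annular_integrable[OF f q] by (simp add: norm_mult)
      show "cmod (cis (t * \<xi>) * f q \<xi>) \<le> B * indicator {-\<bar>R\<bar>..\<bar>R\<bar>} \<xi>" for \<xi>
        using sup[of \<xi>] B[OF q, of \<xi>] B0 by (cases "f q \<xi> = 0") (auto simp: norm_mult indicator_def)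
    qed simp
    also have "\<dots> = B * (2 * \<bar>R\<bar>)" by simp
    finally show "\<bar>t\<bar> ^ 0 * cmod (LINT \<xi>|lborel. cis (t * \<xi>) * f q \<xi>) \<le> B * (2 * \<bar>R\<bar>)" by simp
  qed
next
  case (Suc n)
  obtain f' where f': "\<And>q \<xi>. q \<in> Q \<Longrightarrow> (f q has_vector_derivative f' q \<xi>) (at \<xi>)" and a': "annular_smooth n r R Q f'"
    using Suc.prems by auto
  from Suc.IH[OF a'] obtain K where
    K: "\<And>q t. q \<in> Q \<Longrightarrow> \<bar>t\<bar> ^ n * cmod (LINT \<xi>|lborel. cis (t * \<xi>) * f' q \<xi>) \<le> K" by blast
  show ?case
  proof (intro exI[of _ K] ballI allI)
    fix q t assume q: "q \<in> Q"
    show "\<bar>t\<bar> ^ Suc n * cmod (LINT \<xi>|lborel. cis (t * \<xi>) * f q \<xi>) \<le> K"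
      using K[OF q, of t] fourier_integral_by_parts[of r R "f q" "f' q" t] f'[OF q]
        annular_single[OF annular_smooth_imp_annular[OF Suc.prems] q]
        annular_single[OF annular_smooth_imp_annular[OF a'] q]
      by (simp add: norm_mult mult_ac)
  qed
qed

text \<open>
  Four powers are enough later on: in the estimates two of them absorb growth factors of the coefficients, and
  the remaining two make the sum over \<open>k\<close> converge.
\<close>
lemma fourier_integral_decay4:
  assumes "annular_smooth 4 r R Q f"
  shows "\<exists>K>0. \<forall>q\<in>Q. \<forall>t. cmod (LINT \<xi>|lborel. cis (t * \<xi>) * f q \<xi>) \<le> K / (1 + \<bar>t\<bar>) ^ 4"
proof -
  have "annular_smooth 0 r R Q f" using annular_smooth_imp_annular[OF assms] by simp
  from fourier_integral_decay[OF this] obtain K0 where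
    K0: "\<And>q t. q \<in> Q \<Longrightarrow> cmod (LINT \<xi>|lborel. cis (t * \<xi>) * f q \<xi>) \<le> K0" by auto
  from fourier_integral_decay[OF assms] obtain K4 where
    K4: "\<And>q t. q \<in> Q \<Longrightarrow> \<bar>t\<bar> ^ 4 * cmod (LINT \<xi>|lborel. cis (t * \<xi>) * f q \<xi>) \<le> K4" by blast
  have p: "(1 + x) ^ 4 \<le> 8 * (1 + x ^ 4)" for x :: real
  proof -
    have "(1 + x) ^ 2 \<le> 2 * (1 + x ^ 2)" by (simp add: power2_eq_square algebra_simps) (use sum_squares_bound[of 1 x] in \<open>simp add: power2_eq_square\<close>)
    then have "((1 + x) ^ 2) ^ 2 \<le> (2 * (1 + x ^ 2)) ^ 2" by (intro power_mono) auto
    also have "\<dots> \<le> 4 * (2 * (1 + x ^ 4))"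
      using sum_squares_bound[of 1 "x\<^sup>2"] by (simp add: power_mult_distrib power2_sum)
    finally show ?thesis by simp
  qed
  show ?thesis
  proof (intro exI[of _ "max 1 (8 * (K0 + K4))"] conjI ballI allI)
    fix q t assume q: "q \<in> Q"
    let ?c = "cmod (LINT \<xi>|lborel. cis (t * \<xi>) * f q \<xi>)"
    have "?c * (1 + \<bar>t\<bar>) ^ 4 \<le> ?c * (8 * (1 + \<bar>t\<bar> ^ 4))"
      by (intro mult_left_mono p) auto
    also have "\<dots> \<le> 8 * (K0 + K4)"
      using K0[OF q, of t] K4[OF q, of t] by (simp add: algebra_simps)
    finally show "?c \<le> max 1 (8 * (K0 + K4)) / (1 + \<bar>t\<bar>) ^ 4"
      by (simp add: pos_le_divide_eq add_pos_nonneg)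
  qed simp
qed


lemma integrable_schwartz_moment:
  assumes "schwartz \<psi>"
  shows "integrable lborel (\<lambda>x. x ^ m * \<psi> x)"
proof -
  have d: "(\<lambda>t. \<psi> t) differentiable (at t)" for t
    using assms unfolding schwartz_def by (metis funpow_0)
  then have c: "continuous_on UNIV \<psi>"
    by (intro continuous_at_imp_continuous_on ballI differentiable_imp_continuous_within) auto
  then have [measurable]: "\<psi> \<in> borel_measurable borel"
    by (rule borel_measurable_continuous_onI)
  have "\<forall>m n. bounded (range (\<lambda>t. t ^ m * (deriv ^^ n) \<psi> t))"
    using assms unfolding schwartz_def by blast
  then have "bounded (range (\<lambda>t. t ^ k * (deriv ^^ 0) \<psi> t))" for k
    by blast
  then have "\<exists>B. \<forall>t. \<bar>t ^ k * \<psi> t\<bar> \<le> B" for k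
    unfolding bounded_iff by auto
  then obtain B where B: "\<And>k t. \<bar>t ^ k * \<psi> t\<bar> \<le> B k" by metis
  have i: "integrable lborel (\<lambda>x. (B m + B (m + 2)) * inverse (1 + x\<^sup>2))"
    using integrable_inverse_1_plus_square
    by (simp add: set_integrable_def einterval_def)
  show ?thesis
  proof (rule Bochner_Integration.integrable_bound[OF i])
    show "AE x in lborel. norm (x ^ m * \<psi> x) \<le> norm ((B m + B (m + 2)) * inverse (1 + x\<^sup>2))"
    proof (rule AE_I2)
      fix x :: real
      have "\<bar>x ^ m * \<psi> x\<bar> * (1 + x\<^sup>2) = \<bar>x ^ m * \<psi> x\<bar> + \<bar>x ^ (m + 2) * \<psi> x\<bar>"
        by (simp add: abs_mult power_add algebra_simps power2_eq_square)
      also have "\<dots> \<le> B m + B (m + 2)" using B by (intro add_mono)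
      finally have "\<bar>x ^ m * \<psi> x\<bar> * (1 + x\<^sup>2) \<le> B m + B (m + 2)" .
      then have "\<bar>x ^ m * \<psi> x\<bar> \<le> (B m + B (m + 2)) * inverse (1 + x\<^sup>2)"
        by (simp add: pos_le_divide_eq add_pos_nonneg flip: divide_inverse)
      then show "norm (x ^ m * \<psi> x) \<le> norm ((B m + B (m + 2)) * inverse (1 + x\<^sup>2))"
        unfolding real_norm_def by (rule order_trans[OF _ abs_ge_self])
    qed
  qed measurable
qed

text \<open>
  All derivatives of \<open>fourier \<psi>\<close> are again Fourier integrals of integrable moments of \<open>\<psi>\<close>, and a derivative inherits
  the support because a function that vanishes on an open set has derivative zero there.
\<close>
lemma fourier_annular_smooth:
  assumes "schwartz \<psi>" and sup: "\<And>\<xi>. fourier \<psi> \<xi> \<noteq> 0 \<Longrightarrow> r \<le> \<bar>\<xi>\<bar> \<and> \<bar>\<xi>\<bar> \<le> R"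
  shows "annular_smooth n r R Q (\<lambda>_. fourier \<psi>)"
proof -
  define g where "g m x = (\<i> * complex_of_real x) ^ m * complex_of_real (\<psi> (- x))" for m x
  define F where "F m \<xi> = (LINT x|lborel. cis (\<xi> * x) * g m x)" for m \<xi>
  have F0: "fourier \<psi> = F 0"
  proof
    fix \<xi>
    show "fourier \<psi> \<xi> = F 0 \<xi>"
      using lborel_integral_real_affine[of "-1" "\<lambda>t. cis (- (t * \<xi>)) * complex_of_real (\<psi> t)" 0]
      by (simp add: fourier_def F_def g_def mult.commute)
  qed
  have ig: "integrable lborel (g m)" for m
  proof -
    have "integrable lborel (\<lambda>x. (-x) ^ m * \<psi> (- x))"
      using lborel_integrable_real_affine[OF integrable_schwartz_moment[OF assms(1), of m], of "-1" 0] by simp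
    then have "integrable lborel (\<lambda>x. (-\<i>) ^ m * complex_of_real ((-x) ^ m * \<psi> (- x)))"
      by (intro integrable_mult_right integrable_of_real)
    also have "(\<lambda>x. (-\<i>) ^ m * complex_of_real ((-x) ^ m * \<psi> (- x))) = g m"
      by (auto simp: g_def fun_eq_iff simp flip: power_mult_distrib)
    finally show ?thesis .
  qed
  have dF: "(F m has_vector_derivative F (Suc m) \<xi>) (at \<xi>)" for m \<xi>
  proof -
    have "g (Suc m) = (\<lambda>x. \<i> * (complex_of_real x * g m x))"
      by (auto simp: g_def)
    moreover from this have "(\<lambda>x. complex_of_real x * g m x) = (\<lambda>x. (-\<i>) * g (Suc m) x)"
      by (auto simp: fun_eq_iff)
    then have "integrable lborel (\<lambda>x. complex_of_real x * g m x)"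
      using ig[of "Suc m"] by simp
    ultimately show ?thesis
      using has_vector_derivative_fourier_integral[OF ig[of m], of \<xi>] unfolding F_def by simp
  qed
  have supF: "r \<le> \<bar>\<xi>\<bar> \<and> \<bar>\<xi>\<bar> \<le> R" if "F m \<xi> \<noteq> 0" for m \<xi>
    using that
  proof (induction m arbitrary: \<xi>)
    case 0
    then show ?case using sup F0 by simp
  next
    case (Suc m)
    show ?case
    proof (rule ccontr)
      assume n: "\<not> (r \<le> \<bar>\<xi>\<bar> \<and> \<bar>\<xi>\<bar> \<le> R)"
      let ?S = "{\<xi>. \<bar>\<xi>\<bar> < r} \<union> {\<xi>::real. R < \<bar>\<xi>\<bar>}"
      have S: "open ?S" by (intro open_Un open_Collect_less continuous_intros)
      have "(F m has_vector_derivative 0) (at \<xi>)"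
      proof (rule has_vector_derivative_transform_within_open[where f="\<lambda>_. 0", OF _ S])
        show "\<xi> \<in> ?S" using n by auto
        show "0 = F m y" if "y \<in> ?S" for y using that Suc.IH[of y] by (cases "F m y = 0") auto
      qed simp
      from vector_derivative_unique_at[OF dF this] have "F (Suc m) \<xi> = 0" .
      then show False using Suc.prems by simp
    qed
  qed
  have an: "annular r R Q (\<lambda>_. F m)" for m
    unfolding annular_def
  proof (intro conjI ballI allI impI exI)
    show "continuous_on UNIV (F m)"
      by (intro continuous_at_imp_continuous_on ballI has_vector_derivative_continuous[OF dF])
    show "cmod (F m \<xi>) \<le> (LINT x|lborel. cmod (g m x))" for \<xi>
      using integral_norm_bound[of lborel "\<lambda>x. cis (\<xi> * x) * g m x"]
      by (simp add: F_def norm_mult)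
    fix \<xi> :: real assume "F m \<xi> \<noteq> 0"
    from supF[OF this] show "r \<le> \<bar>\<xi>\<bar>" "\<bar>\<xi>\<bar> \<le> R" by auto
  qed
  have "annular_smooth n r R Q (\<lambda>_. F m)" for m
  proof (induction n arbitrary: m)
    case (Suc n)
    show ?case
      unfolding annular_smooth.simps
      by (intro conjI an exI[of _ "\<lambda>_. F (Suc m)"] ballI allI dF Suc.IH)
  qed (simp add: an)
  then show ?thesis unfolding F0 .
qed

text \<open>
  For \<open>|x - y| \<le> 1\<close> this is the mean value theorem, as \<open>1 + |x| \<le> 2 (1 + |z|)\<close> for \<open>z\<close> between \<open>x\<close> and \<open>y\<close>, whence the
  constant \<open>16 = 2\<^sup>4\<close>; for larger distances it is the triangle inequality.
\<close>
lemma lipschitz_decay: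
  fixes f :: "real \<Rightarrow> real"
  assumes d: "\<And>x. (f has_real_derivative f' x) (at x)"
    and f: "\<And>x. \<bar>f x\<bar> \<le> K / (1 + \<bar>x\<bar>) ^ 4" and f': "\<And>x. \<bar>f' x\<bar> \<le> K / (1 + \<bar>x\<bar>) ^ 4"
  shows "\<bar>f x - f y\<bar> \<le> 16 * K * min 1 \<bar>x - y\<bar> * (1 / (1 + \<bar>x\<bar>) ^ 4 + 1 / (1 + \<bar>y\<bar>) ^ 4)"
proof -
  have K: "K \<ge> 0" using f[of 0] by simp
  let ?q = "\<lambda>x::real. 1 / (1 + \<bar>x\<bar>) ^ 4"
  have q: "?q x \<ge> 0" for x by simp
  show ?thesis
  proof (cases "\<bar>x - y\<bar> \<le> 1")
    case True
    have "norm (f x - f y) \<le> (16 * K * ?q x) * norm (x - y)"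
    proof (rule field_differentiable_bound[where S="closed_segment y x" and f'=f'])
      fix z assume z: "z \<in> closed_segment y x"
      then have "\<bar>x - z\<bar> \<le> 1"
        using True by (auto simp: closed_segment_eq_real_ivl split: if_splits)
      then have "\<bar>x\<bar> \<le> 1 + \<bar>z\<bar>" by linarith
      then have "1 + \<bar>x\<bar> \<le> 2 * (1 + \<bar>z\<bar>)" by simp
      then have "(1 + \<bar>x\<bar>) ^ 4 \<le> (2 * (1 + \<bar>z\<bar>)) ^ 4" by (intro power_mono) auto
      then have "(1 + \<bar>x\<bar>) ^ 4 \<le> 16 * (1 + \<bar>z\<bar>) ^ 4" by (simp only: power_mult_distrib) simp
      then have "K / (1 + \<bar>z\<bar>) ^ 4 \<le> 16 * K * ?q x"
        using mult_left_mono[of "(1 + \<bar>x\<bar>) ^ 4" "16 * (1 + \<bar>z\<bar>) ^ 4", OF _ K]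
        by (simp add: field_simps add_pos_nonneg)
      then show "norm (f' z) \<le> 16 * K * ?q x" using f'[of z] by simp
    qed (auto intro: has_field_derivative_at_within d)
    also have "\<dots> \<le> 16 * K * min 1 \<bar>x - y\<bar> * (?q x + ?q y)"
      using True K mult_left_mono[of "?q x" "?q x + ?q y" "16 * K * \<bar>x - y\<bar>"]
      by (simp add: min_def mult_ac)
    finally show ?thesis by simp
  next
    case False
    have "\<bar>f x - f y\<bar> \<le> K * ?q x + K * ?q y"
      using f[of x] f[of y] by simp
    also have "\<dots> \<le> 16 * (K * ?q x + K * ?q y)"
    proof -
      have "0 \<le> K * ?q x + K * ?q y" using K by simp
      moreover have "z \<le> 16 * z" if "0 \<le> z" for z :: real using that by simp
      ultimately show ?thesis by blast
    qed
    also have "\<dots> = 16 * K * min 1 \<bar>x - y\<bar> * (?q x + ?q y)"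
      using False by (simp add: min_def algebra_simps)
    finally show ?thesis .
  qed
qed

text \<open>
  This is the form in which the wavelet enters the rest of the proof. The Fourier transform of \<open>\<psi>\<close> is a smooth
  function supported in an annulus, so multiplication by \<open>|\<xi>| powr (-\<theta>-1/2)\<close>, or by \<open>\<xi>\<close> times that power for
  the derivative, keeps it smooth with bounds uniform in \<open>\<theta> \<in> [a,b]\<close>.
\<close>
lemma Psi_increment_bound:
  assumes w: "lemarie_meyer_wavelet \<psi>"
  shows "\<exists>C>0. \<forall>x y. \<forall>\<theta>\<in>{a..b}. \<bar>Psi \<psi> x \<theta> - Psi \<psi> y \<theta>\<bar> \<le>
     C * min 1 \<bar>x - y\<bar> * (1 / (1 + \<bar>x\<bar>) ^ 4 + 1 / (1 + \<bar>y\<bar>) ^ 4)"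
proof -
  have s: "schwartz \<psi>" and c: "compact (closure {\<xi>. fourier \<psi> \<xi> \<noteq> 0})"
    and z: "\<forall>\<^sub>F \<xi> in nhds 0. fourier \<psi> \<xi> = 0"
    using w unfolding lemarie_meyer_wavelet_def by auto
  have "bounded {\<xi>. fourier \<psi> \<xi> \<noteq> 0}"
    by (rule bounded_subset[OF compact_imp_bounded[OF c] closure_subset])
  then obtain R where R: "\<And>\<xi>. fourier \<psi> \<xi> \<noteq> 0 \<Longrightarrow> \<bar>\<xi>\<bar> \<le> R"
    unfolding bounded_iff by auto
  obtain r where r: "r > 0" "\<And>\<xi>. \<bar>\<xi>\<bar> < r \<Longrightarrow> fourier \<psi> \<xi> = 0"
    using z unfolding eventually_nhds_metric by (auto simp: dist_real_def)
  have sup: "r \<le> \<bar>\<xi>\<bar> \<and> \<bar>\<xi>\<bar> \<le> R" if "fourier \<psi> \<xi> \<noteq> 0" for \<xi>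
    using that R r(2) not_less by blast
  define f where "f \<theta> \<xi> = fourier \<psi> \<xi> * homog 1 0 (- (\<theta> + 1/2)) \<xi>" for \<theta> \<xi>
  define f1 where "f1 \<theta> \<xi> = fourier \<psi> \<xi> * homog 1 1 (1/2 - \<theta>) \<xi>" for \<theta> \<xi>
  have sm: "annular_smooth 4 r R {a..b} f" "annular_smooth 4 r R {a..b} f1"
    unfolding f_def f1_def
    by (rule annular_smooth_mult_homog[OF r(1) fourier_annular_smooth[OF s sup], where P=1 and S="\<bar>a\<bar> + \<bar>b\<bar> + 1"]; auto)+
  define G where "G \<theta> t = (LINT \<xi>|lborel. cis (t * \<xi>) * f \<theta> \<xi>)" for \<theta> t
  define G1 where "G1 \<theta> t = (LINT \<xi>|lborel. cis (t * \<xi>) * (\<i> * f1 \<theta> \<xi>))" for \<theta> t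
  have f1: "complex_of_real \<xi> * f \<theta> \<xi> = f1 \<theta> \<xi>" for \<theta> \<xi>
  proof -
    have "\<xi> * \<bar>\<xi>\<bar> powr (- (\<theta> + 1/2)) = sgn \<xi> * \<bar>\<xi>\<bar> powr (1/2 - \<theta>)"
    proof (cases "\<xi> = 0")
      case False
      have "\<bar>\<xi>\<bar> powr (1/2 - \<theta>) = \<bar>\<xi>\<bar> powr (1 + - (\<theta> + 1/2))" by simp
      also have "\<dots> = \<bar>\<xi>\<bar> * \<bar>\<xi>\<bar> powr (- (\<theta> + 1/2))"
        using False by (subst powr_add) simp
      finally have "sgn \<xi> * \<bar>\<xi>\<bar> powr (1/2 - \<theta>) = (sgn \<xi> * \<bar>\<xi>\<bar>) * \<bar>\<xi>\<bar> powr (- (\<theta> + 1/2))"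
        by (simp only: mult.assoc)
      then show ?thesis by (simp only: mult_sgn_abs)
    qed simp
    then have "complex_of_real \<xi> * homog 1 0 (- (\<theta> + 1/2)) \<xi> = homog 1 1 (1/2 - \<theta>) \<xi>"
      unfolding homog_def by (simp flip: of_real_mult)
    then show ?thesis unfolding f_def f1_def by (simp only: mult.left_commute[of "complex_of_real \<xi>"])
  qed
  have dG: "(G \<theta> has_vector_derivative G1 \<theta> t) (at t)" if "\<theta> \<in> {a..b}" for \<theta> t
    using has_vector_derivative_fourier_integral[of "f \<theta>" t]
      annular_integrable[OF annular_smooth_imp_annular[OF sm(1)] that]
      annular_integrable[OF annular_smooth_imp_annular[OF sm(2)] that]
    unfolding f1 G_def G1_def by simp
  have Psi: "Psi \<psi> t \<theta> = Re (G \<theta> t)" for t \<theta>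
    unfolding Psi_def G_def f_def homog_def
    by (simp only: powr_minus of_real_inverse divide_inverse mult.assoc power_0 mult_1_left mult_1_right)
  have dP: "((\<lambda>t. Psi \<psi> t \<theta>) has_real_derivative Re (G1 \<theta> t)) (at t)" if "\<theta> \<in> {a..b}" for \<theta> t
    unfolding Psi has_real_derivative_iff_has_vector_derivative
    by (rule bounded_linear.has_vector_derivative[OF bounded_linear_Re dG[OF that]])
  from fourier_integral_decay4[OF sm(1)] obtain K where K: "K > 0"
    "\<And>\<theta> t. \<theta> \<in> {a..b} \<Longrightarrow> cmod (G \<theta> t) \<le> K / (1 + \<bar>t\<bar>) ^ 4"
    unfolding G_def by blast
  from fourier_integral_decay4[OF sm(2)] obtain K' where K': "K' > 0"
    "\<And>\<theta> t. \<theta> \<in> {a..b} \<Longrightarrow> cmod (LINT \<xi>|lborel. cis (t * \<xi>) * f1 \<theta> \<xi>) \<le> K' / (1 + \<bar>t\<bar>) ^ 4"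
    by blast
  have "G1 \<theta> t = \<i> * (LINT \<xi>|lborel. cis (t * \<xi>) * f1 \<theta> \<xi>)" for \<theta> t
    unfolding G1_def by (simp add: mult.left_commute)
  then have K1: "cmod (G1 \<theta> t) \<le> K' / (1 + \<bar>t\<bar>) ^ 4" if "\<theta> \<in> {a..b}" for \<theta> t
    using K'(2)[OF that] by (simp add: norm_mult)
  define L where "L = max K K'"
  have mono: "x / (1 + \<bar>t\<bar>) ^ 4 \<le> L / (1 + \<bar>t\<bar>) ^ 4" if "x \<le> L" for x t :: real
    using that by (intro divide_right_mono) auto
  show ?thesis
  proof (intro exI[of _ "16 * L"] conjI allI ballI)
    show "16 * L > 0" using K(1) by (simp add: L_def)
    fix x y \<theta> assume t: "\<theta> \<in> {a..b}"
    show "\<bar>Psi \<psi> x \<theta> - Psi \<psi> y \<theta>\<bar> \<le> 16 * L * min 1 \<bar>x - y\<bar> * (1 / (1 + \<bar>x\<bar>) ^ 4 + 1 / (1 + \<bar>y\<bar>) ^ 4)"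
    proof (rule lipschitz_decay[OF dP[OF t]])
      fix x
      show "\<bar>Psi \<psi> x \<theta>\<bar> \<le> L / (1 + \<bar>x\<bar>) ^ 4"
        unfolding Psi using K(2)[OF t, of x] mono[of K x] abs_Re_le_cmod[of "G \<theta> x"] by (simp add: L_def)
      show "\<bar>Re (G1 \<theta> x)\<bar> \<le> L / (1 + \<bar>x\<bar>) ^ 4"
        using K1[OF t, of x] mono[of K' x] abs_Re_le_cmod[of "G1 \<theta> x"] by (simp add: L_def)
    qed
  qed
qed

section \<open>Sums over dyadic nodes\<close>

lemma summable_on_int_nat_abs:
  fixes f :: "nat \<Rightarrow> real"
  assumes "summable f" "\<And>n. 0 \<le> f n"
  shows "(\<lambda>j::int. f (nat \<bar>j\<bar>)) summable_on UNIV"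
proof -
  have s: "f summable_on UNIV"
    using assms by (subst summable_on_UNIV_nonneg_real_iff) auto
  have b1: "bij_betw int UNIV {0..}"
    by (rule bij_betw_byWitness[where f'=nat]) auto
  have b2: "bij_betw (\<lambda>n. - int n) UNIV {..0}"
    by (rule bij_betw_byWitness[where f'="\<lambda>j. nat (-j)"]) auto
  have "(\<lambda>j::int. f (nat \<bar>j\<bar>)) summable_on {0..}"
    using s summable_on_reindex_bij_betw[OF b1, of "\<lambda>j::int. f (nat \<bar>j\<bar>)"] by simp
  moreover have "(\<lambda>j::int. f (nat \<bar>j\<bar>)) summable_on {..0}"
    using s summable_on_reindex_bij_betw[OF b2, of "\<lambda>j::int. f (nat \<bar>j\<bar>)"] by simp
  ultimately have "(\<lambda>j::int. f (nat \<bar>j\<bar>)) summable_on ({0..} \<union> {..0})"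
    by (rule summable_on_union)
  moreover have "{0..} \<union> {..0::int} = UNIV" by auto
  ultimately show ?thesis by simp
qed

text \<open>
  The summable weight with which nodes of one level are counted; \<open>rho (2\<^sup>j t - k)\<close> weighs the node \<open>k 2\<^sup>-\<^sup>j\<close> as seen
  from \<open>t\<close>.
\<close>
definition rho :: "real \<Rightarrow> real" where
  "rho y = 1 / (1 + \<bar>y\<bar>)\<^sup>2"

lemma rho_nonneg [simp]: "0 \<le> rho y"
  by (simp add: rho_def)

lemma rho_measurable [measurable]: "rho \<in> borel_measurable borel"
  unfolding rho_def by measurable

text \<open>
  The bound is uniform in \<open>x\<close>: after a shift of \<open>k\<close> by \<open>\<lfloor>x\<rfloor>\<close> one may assume \<open>0 \<le> x < 1\<close>, which changes \<open>1 + |k|\<close> at most by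
  the factor \<open>2\<close>.
\<close>
lemma rho_shift_summable:
  "(\<lambda>k::int. rho (x - real_of_int k)) summable_on UNIV" (is ?S)
  and rho_shift_infsum_le:
  "(\<Sum>\<^sub>\<infinity>k::int. rho (x - real_of_int k)) \<le> (\<Sum>\<^sub>\<infinity>k::int. 4 * rho (real_of_int k))" (is ?I)
  and rho_summable: "(\<lambda>k::int. rho (real_of_int k)) summable_on UNIV"
proof -
  have "summable (\<lambda>n. inverse (real (n + 1) ^ 2))"
    using inverse_power_summable[of 2, where 'a=real] by (subst summable_iff_shift) auto
  then have "summable (\<lambda>n. rho (real n))"
    by (simp add: rho_def divide_inverse add.commute)
  from summable_on_int_nat_abs[OF this] show s: "(\<lambda>k::int. rho (real_of_int k)) summable_on UNIV"
    by (simp add: rho_def)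
  then have s4: "(\<lambda>k::int. 4 * rho (real_of_int k)) summable_on UNIV"
    by (rule summable_on_cmult_right)
  have le: "rho (x - real_of_int (k + \<lfloor>x\<rfloor>)) \<le> 4 * rho (real_of_int k)" for k
  proof -
    have "1 + \<bar>real_of_int k\<bar> \<le> 2 * (1 + \<bar>x - real_of_int (k + \<lfloor>x\<rfloor>)\<bar>)"
    proof -
      define w where "w = x - real_of_int (k + \<lfloor>x\<rfloor>)"
      have "real_of_int k = (x - of_int \<lfloor>x\<rfloor>) - w" by (simp add: w_def)
      moreover have "\<bar>x - of_int \<lfloor>x\<rfloor>\<bar> \<le> 1"
        using of_int_floor_le[of x] real_of_int_floor_add_one_gt[of x] by linarith
      ultimately have "\<bar>real_of_int k\<bar> \<le> 1 + \<bar>w\<bar>" by linarith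
      then show ?thesis unfolding w_def[symmetric] by simp
    qed
    then have "(1 + \<bar>real_of_int k\<bar>)\<^sup>2 \<le> (2 * (1 + \<bar>x - real_of_int (k + \<lfloor>x\<rfloor>)\<bar>))\<^sup>2"
      by (intro power_mono) auto
    then have "4 / (2 * (1 + \<bar>x - real_of_int (k + \<lfloor>x\<rfloor>)\<bar>))\<^sup>2 \<le> 4 / (1 + \<bar>real_of_int k\<bar>)\<^sup>2"
      by (intro divide_left_mono mult_pos_pos zero_less_power) auto
    then show ?thesis
      unfolding rho_def power_mult_distrib by simp
  qed
  have b: "bij_betw (\<lambda>k. k + \<lfloor>x\<rfloor>) UNIV (UNIV :: int set)"
    by (rule bij_betw_byWitness[where f'="\<lambda>k. k - \<lfloor>x\<rfloor>"]) auto
  have s': "(\<lambda>k. rho (x - real_of_int (k + \<lfloor>x\<rfloor>))) summable_on UNIV"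
    by (rule summable_on_comparison_test[OF s4]) (use le in auto)
  then show ?S
    using summable_on_reindex_bij_betw[OF b, of "\<lambda>k. rho (x - real_of_int k)"] by simp
  have "(\<Sum>\<^sub>\<infinity>k::int. rho (x - real_of_int k)) = (\<Sum>\<^sub>\<infinity>k::int. rho (x - real_of_int (k + \<lfloor>x\<rfloor>)))"
    using infsum_reindex_bij_betw[OF b, of "\<lambda>k. rho (x - real_of_int k)"] by simp
  also have "\<dots> \<le> (\<Sum>\<^sub>\<infinity>k::int. 4 * rho (real_of_int k))"
    by (rule infsum_mono[OF s' s4]) (use le in auto)
  finally show ?I .
qed

definition rho_total :: real where
  "rho_total = (\<Sum>\<^sub>\<infinity>k::int. 4 * rho (real_of_int k))"

lemma rho_total_nonneg: "0 \<le> rho_total"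
  unfolding rho_total_def by (rule infsum_nonneg) simp

lemma summable_on_int_arith_geometric:
  fixes r :: real
  assumes "0 \<le> r" "r < 1"
  shows "(\<lambda>m::int. (1 + \<bar>real_of_int m\<bar>) * r ^ nat \<bar>m\<bar>) summable_on UNIV"
proof -
  have "summable (\<lambda>n. diffs (\<lambda>_. 1) n * r ^ n)"
    by (rule termdiff_converges[where K=1]) (use assms in auto)
  then have "summable (\<lambda>n. (1 + real n) * r ^ n)"
    by (simp add: diffs_def)
  from summable_on_int_nat_abs[OF this] show ?thesis
    using assms by simp
qed

lemma abs_infsum_le:
  fixes f g :: "'i \<Rightarrow> real"
  assumes g: "g summable_on A" and le: "\<And>x. x \<in> A \<Longrightarrow> \<bar>f x\<bar> \<le> g x"
  shows "f summable_on A" and "\<bar>infsum f A\<bar> \<le> infsum g A"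
proof -
  have "(\<lambda>x. \<bar>f x\<bar>) summable_on A"
    by (rule summable_on_comparison_test[OF g]) (use le in auto)
  then show f: "f summable_on A"
    using summable_on_iff_abs_summable_on_real by fastforce
  show "\<bar>infsum f A\<bar> \<le> infsum g A"
    using norm_infsum_le[OF has_sum_infsum[OF f] has_sum_infsum[OF g]] le by simp
qed

lemma one_plus_abs_le_mult: "1 + \<bar>y\<bar> \<le> (1 + \<bar>x\<bar>) * (1 + \<bar>x - y\<bar>)" for x y :: real
proof -
  have "\<bar>y\<bar> \<le> \<bar>x\<bar> + \<bar>x - y\<bar>" by linarith
  moreover have "0 \<le> \<bar>x\<bar> * \<bar>x - y\<bar>" by simp
  moreover have "(1 + \<bar>x\<bar>) * (1 + \<bar>x - y\<bar>) = 1 + \<bar>x\<bar> + \<bar>x - y\<bar> + \<bar>x\<bar> * \<bar>x - y\<bar>"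
    by (simp add: algebra_simps)
  ultimately show ?thesis by linarith
qed

text \<open>
  Translates bounds for \<open>exp (\<epsilon>\<^sup>2/8)\<close>, which come out of moment computations, into bounds for \<open>|\<epsilon>|\<close>: a polynomial in \<open>y\<close>
  turns into an arbitrarily small power, through \<open>ln y \<le> y powr (2\<delta>) / (2\<delta>)\<close>.
\<close>
lemma abs_le_of_exp_square_le:
  fixes x g y C \<delta> :: real
  assumes e: "exp (x\<^sup>2 / 8) \<le> C * exp (2 * g\<^sup>2) * y ^ 4"
    and "1 \<le> C" "1 \<le> g" "1 \<le> y" "0 < \<delta>"
  shows "\<bar>x\<bar> \<le> sqrt (8 * ln C + 16 + 16 / \<delta>) * g * y powr \<delta>"
proof -
  let ?A = "8 * ln C + 16 + 16 / \<delta>"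
  have A: "?A \<ge> 0" using assms by simp
  have "x\<^sup>2 / 8 \<le> ln (C * exp (2 * g\<^sup>2) * y ^ 4)"
    using e assms by (subst ln_ge_iff) auto
  also have "\<dots> = ln C + 2 * g\<^sup>2 + 4 * ln y"
    using assms by (simp add: ln_mult ln_realpow)
  also have "ln y \<le> y powr (2 * \<delta>) / (2 * \<delta>)"
    using assms by (intro ln_powr_bound) auto
  finally have x: "x\<^sup>2 \<le> 8 * ln C + 16 * g\<^sup>2 + 16 / \<delta> * y powr (2 * \<delta>)"
    by (simp add: field_simps)
  have g1: "1 \<le> g\<^sup>2" using assms by simp
  have y1: "1 \<le> y powr (2 * \<delta>)" using assms by (simp add: ge_one_powr_ge_zero)
  have p: "1 \<le> g\<^sup>2 * y powr (2 * \<delta>)" "g\<^sup>2 \<le> g\<^sup>2 * y powr (2 * \<delta>)" "y powr (2 * \<delta>) \<le> g\<^sup>2 * y powr (2 * \<delta>)"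
    using g1 y1 mult_mono[OF g1 y1] mult_left_mono[OF y1, of "g\<^sup>2"] mult_right_mono[OF g1, of "y powr (2 * \<delta>)"]
    by auto
  have "x\<^sup>2 \<le> 8 * ln C * (g\<^sup>2 * y powr (2 * \<delta>)) + 16 * (g\<^sup>2 * y powr (2 * \<delta>)) + 16 / \<delta> * (g\<^sup>2 * y powr (2 * \<delta>))"
  proof -
    have "8 * ln C * 1 \<le> 8 * ln C * (g\<^sup>2 * y powr (2 * \<delta>))"
      "16 / \<delta> * y powr (2 * \<delta>) \<le> 16 / \<delta> * (g\<^sup>2 * y powr (2 * \<delta>))"
      using assms p by (intro mult_left_mono; simp)+
    then show ?thesis using x p(2) unfolding mult_1_right by (smt (verit))
  qed
  also have "\<dots> = ?A * (g\<^sup>2 * y powr (2 * \<delta>))" by (simp add: algebra_simps)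
  also have "\<dots> = (sqrt ?A * g * y powr \<delta>)\<^sup>2"
    using A assms by (simp add: power_mult_distrib powr_power mult_ac)
  finally have "\<bar>x\<bar> \<le> \<bar>sqrt ?A * g * y powr \<delta>\<bar>"
    by (simp only: abs_le_square_iff)
  also have "\<dots> = sqrt ?A * g * y powr \<delta>" using A assms by simp
  finally show ?thesis .
qed

text \<open>
  Let \<open>x = k 2\<^sup>-\<^sup>j\<close> be the node and \<open>y = |x - t|\<close>, so that \<open>u = 2\<^sup>j y\<close>. If \<open>y \<le> 2 powr (-j/2)\<close>, the logarithmic modulus gives
  \<open>j |H x - H t| \<le> 2 c / ln 2\<close>, a constant. If \<open>y\<close> is larger but still small, \<open>|H x - H t| \<le> \<delta>\<close> and
  \<open>2 powr (j \<delta>) \<le> u powr (2 \<delta>)\<close>. If \<open>y > d0\<close>, the node is also far from each \<open>s\<close> near \<open>t\<close>, and the crude bound \<open>2\<^sup>j\<close> is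
  absorbed by \<open>2\<^sup>j |x - s|\<close>. In the far regime a small power of \<open>u\<close> would not do in general, hence the extra factor, which is linear in
  the distance to \<open>s\<close> and is compensated by the decay of the kernel.
\<close>
lemma dyadic_exponent_local_bound:
  fixes H :: "real \<Rightarrow> real"
  assumes H: "\<And>x. 0 \<le> H x \<and> H x \<le> 1"
    and R: "0 < R" "R < 1" "0 < c"
      "\<And>s. 0 < \<bar>s - t\<bar> \<Longrightarrow> \<bar>s - t\<bar> \<le> R \<Longrightarrow> \<bar>H s - H t\<bar> \<le> c / ln (inverse \<bar>s - t\<bar>)"
    and \<delta>: "0 < \<delta>"
  shows "\<exists>C>0. \<exists>d>0. \<forall>s. \<bar>s - t\<bar> < d \<longrightarrow> (\<forall>j k. 0 \<le> j \<longrightarrow>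
     2 powr (- real_of_int j * H (real_of_int k * 2 powi (- j))) \<le>
       C * 2 powr (- real_of_int j * H t) * (1 + \<bar>2 powi j * t - real_of_int k\<bar>) powr (2 * \<delta>)
         * (1 + \<bar>2 powi j * s - real_of_int k\<bar>))"
proof -
  define d0 where "d0 = min R (exp (- (c / \<delta>)))"
  have d0: "0 < d0" "d0 \<le> R" "d0 \<le> exp (- (c / \<delta>))" "d0 < 1"
    using R by (auto simp: d0_def)
  define C where "C = max (exp (2 * c)) (2 / d0)"
  have C: "C \<ge> 1" "C \<ge> exp (2 * c)" "C \<ge> 2 / d0"
    using R unfolding C_def by (auto simp: le_max_iff_disj)
  show ?thesis
  proof (rule exI[of _ C], intro conjI exI[of _ "d0 / 2"] allI impI)
    fix s j k assume s: "\<bar>s - t\<bar> < d0 / 2" and j: "(0::int) \<le> j"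
    define x where "x = real_of_int k * 2 powi (- j)"
    define y where "y = \<bar>x - t\<bar>"
    define J where "J = real_of_int j"
    have J: "J \<ge> 0" using j by (simp add: J_def)
    have p2: "2 powi j = (2::real) powr J"
      by (simp add: J_def powr_real_of_int')
    have p2': "(2::real) powi (-j) = 2 powr (-J)"
      using powr_real_of_int'[of "2::real" "-j"] by (simp add: J_def)
    have kx: "real_of_int k = 2 powr J * x"
      unfolding x_def p2' by (simp flip: powr_add add: mult.left_commute)
    have u: "\<bar>2 powi j * z - real_of_int k\<bar> = 2 powr J * \<bar>x - z\<bar>" for z
      unfolding p2 kx by (simp flip: right_diff_distrib add: abs_mult abs_minus_commute)
    let ?u = "2 powr J * y" and ?v = "2 powr J * \<bar>x - s\<bar>"
    have uv: "?u \<ge> 0" "?v \<ge> 0" by (auto simp: y_def)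
    have key: "2 powr (J * (H t - H x)) \<le> C * (1 + ?u) powr (2 * \<delta>) * (1 + ?v)"
    proof -
      have one: "1 \<le> (1 + ?u) powr (2 * \<delta>)" using uv \<delta> by (intro ge_one_powr_ge_zero) auto
      \<comment> \<open>At \<open>y = 0\<close> the modulus of \<open>H\<close> says nothing, but there \<open>x = t\<close>.\<close>
      consider "y = 0" | "y > d0" | "0 < y" "y \<le> d0" by (force simp: y_def)
      then show ?thesis
      proof cases
        case 1
        then have "H x = H t" by (simp add: y_def)
        then show ?thesis using mult_mono[OF mult_mono[OF C(1) one] , of 1 "1 + ?v"] uv C by simp
      next
        case 2
        have "\<bar>x - s\<bar> \<ge> d0 / 2" using 2 s unfolding y_def by linarith
        then have v: "2 powr J * (d0 / 2) \<le> ?v" by (intro mult_left_mono) auto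
        have "H t - H x \<le> 1" using H[of t] H[of x] by linarith
        then have "J * (H t - H x) \<le> J" using J by (simp add: mult_left_le)
        then have "2 powr (J * (H t - H x)) \<le> 2 powr J" by (intro powr_mono) auto
        also have "\<dots> = (2 / d0) * (2 powr J * (d0 / 2))" using d0 by simp
        also have "\<dots> \<le> C * (1 + ?v)"
          using order_trans[OF v, of "1 + ?v"] C uv d0 by (intro mult_mono) auto
        also have "\<dots> \<le> C * (1 + ?u) powr (2 * \<delta>) * (1 + ?v)"
          using one C uv mult_left_mono[OF one, of C] by (intro mult_right_mono) auto
        finally show ?thesis .
      next
        case 3
        have y1: "y < 1" using 3 d0 by linarith
        have L: "ln (inverse y) > 0" using 3 y1 by (simp add: ln_inverse)
        have dH: "\<bar>H x - H t\<bar> \<le> c / ln (inverse y)"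
          using R(4)[of x] 3 d0 unfolding y_def by auto
        have "ln y \<le> - (c / \<delta>)"
          using 3 d0(3) ln_mono[of y "exp (- (c / \<delta>))"] by simp
        then have "\<delta> * (c / \<delta>) \<le> \<delta> * - ln y" using \<delta> by (intro mult_left_mono) auto
        then have "c \<le> \<delta> * ln (inverse y)" using 3 \<delta> by (simp add: ln_inverse)
        then have "c / ln (inverse y) \<le> \<delta>" using L by (simp add: pos_divide_le_eq)
        then have dH2: "\<bar>H x - H t\<bar> \<le> \<delta>" using dH by linarith
        have "2 powr (J * (H t - H x)) \<le> C * (1 + ?u) powr (2 * \<delta>)"
        proof (cases "y \<le> 2 powr (- J / 2)")
          case True
          then have "ln y \<le> ln (2 powr (- J / 2))" using 3 by (intro ln_mono) auto
          then have "J * ln 2 / 2 \<le> ln (inverse y)" using 3 by (simp add: ln_inverse ln_powr)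
          then have l: "J * ln 2 \<le> 2 * ln (inverse y)" by simp
          have "J * (H t - H x) * ln 2 \<le> (J * ln 2) * \<bar>H x - H t\<bar>"
            using J by (simp add: mult_ac mult_left_mono)
          also have "\<dots> \<le> (2 * ln (inverse y)) * (c / ln (inverse y))"
            by (rule mult_mono[OF l dH]) (use L in auto)
          also have "\<dots> = 2 * c" using L by simp
          finally have "2 powr (J * (H t - H x)) \<le> exp (2 * c)" by (simp add: powr_def)
          also have "\<dots> \<le> C * 1" using C by simp
          also have "\<dots> \<le> C * (1 + ?u) powr (2 * \<delta>)" using one C by (intro mult_left_mono) auto
          finally show ?thesis .
        next
          case False
          have "2 powr (J / 2) = 2 powr J * 2 powr (- J / 2)" by (simp flip: powr_add)
          also have "\<dots> \<le> ?u" using False by (intro mult_left_mono) auto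
          finally have h: "2 powr (J / 2) \<le> 1 + ?u" by simp
          have "H t - H x \<le> \<delta>" using dH2 by linarith
          then have "J * (H t - H x) \<le> J * \<delta>" using J by (intro mult_left_mono) auto
          then have "2 powr (J * (H t - H x)) \<le> 2 powr (J * \<delta>)" by (intro powr_mono) auto
          also have "\<dots> = (2 powr (J / 2)) powr (2 * \<delta>)" by (simp add: powr_powr)
          also have "\<dots> \<le> (1 + ?u) powr (2 * \<delta>)" using h \<delta> by (intro powr_mono2) auto
          also have "\<dots> \<le> C * (1 + ?u) powr (2 * \<delta>)"
            using mult_right_mono[OF C(1), of "(1 + ?u) powr (2 * \<delta>)"] by simp
          finally show ?thesis .
        qed
        also have "\<dots> \<le> C * (1 + ?u) powr (2 * \<delta>) * (1 + ?v)"
          using mult_left_mono[of 1 "1 + ?v" "C * (1 + ?u) powr (2 * \<delta>)"] C uv by simp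
        finally show ?thesis .
      qed
    qed
    have "2 powr (- J * H x) = 2 powr (- J * H t) * 2 powr (J * (H t - H x))"
      by (simp flip: powr_add add: algebra_simps)
    also have "\<dots> \<le> 2 powr (- J * H t) * (C * (1 + ?u) powr (2 * \<delta>) * (1 + ?v))"
      using key by (intro mult_left_mono) auto
    finally show "2 powr (- real_of_int j * H (real_of_int k * 2 powi (- j))) \<le>
       C * 2 powr (- real_of_int j * H t) * (1 + \<bar>2 powi j * t - real_of_int k\<bar>) powr (2 * \<delta>)
         * (1 + \<bar>2 powi j * s - real_of_int k\<bar>)"
      unfolding u x_def[symmetric] J_def[symmetric] y_def[symmetric] by (simp add: mult_ac)
  qed (use C d0 in auto)
qed

section \<open>Convergence of the wavelet series\<close>

text \<open>
  A deterministic setting: \<open>P\<close> stands for \<open>\<Psi>\<close> and \<open>e\<close> for one realization of the coefficients. All that is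
  known globally about the realization is the growth condition, which holds almost surely; finer information about
  \<open>e\<close> is local and enters at the point \<open>t\<close> under consideration.
\<close>
locale wavelet_series =
  fixes P :: "real \<Rightarrow> real \<Rightarrow> real" and H :: "real \<Rightarrow> real" and a b CP :: real and e :: "int \<times> int \<Rightarrow> real"
  assumes ab: "0 < a" "a < b" "b < 1" and H_range: "H x \<in> {a..b}"
    and CP_pos: "0 < CP"
    and P_increment: "\<theta> \<in> {a..b} \<Longrightarrow> \<bar>P x \<theta> - P y \<theta>\<bar> \<le> CP * min 1 \<bar>x - y\<bar> * (1 / (1 + \<bar>x\<bar>) ^ 4 + 1 / (1 + \<bar>y\<bar>) ^ 4)"
    and coeff_growth: "\<exists>C. \<forall>j k. exp ((e (j, k))\<^sup>2 / 8) \<le> C * ((1 + \<bar>real_of_int j\<bar>) * (1 + \<bar>real_of_int k\<bar>))\<^sup>2"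
begin

definition node :: "int \<Rightarrow> int \<Rightarrow> real" where
  "node j k = real_of_int k * 2 powi (- j)"

text \<open>
  Increments are the basic objects, not the values at \<open>s\<close> and \<open>t\<close>: at negative \<open>j\<close> only differences are summable.
\<close>
definition incr :: "real \<Rightarrow> real \<Rightarrow> int \<Rightarrow> int \<Rightarrow> real" where
  "incr s t j k = 2 powr (- real_of_int j * H (node j k)) * e (j, k) *
     (P (2 powi j * s - real_of_int k) (H (node j k)) - P (2 powi j * t - real_of_int k) (H (node j k)))"

definition Z :: "real \<Rightarrow> real" where
  "Z t = (\<Sum>\<^sub>\<infinity>j. \<Sum>\<^sub>\<infinity>k. incr t 0 j k)"

lemma incr_abs_le:
  "\<bar>incr s t j k\<bar> \<le> 2 powr (- real_of_int j * H (node j k)) * \<bar>e (j, k)\<bar> * (CP * min 1 (2 powi j * \<bar>s - t\<bar>)) *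
     (1 / (1 + \<bar>2 powi j * s - real_of_int k\<bar>) ^ 4 + 1 / (1 + \<bar>2 powi j * t - real_of_int k\<bar>) ^ 4)"
proof -
  have "(2 powi j * s - real_of_int k) - (2 powi j * t - real_of_int k) = 2 powi j * (s - t)"
    by (simp add: right_diff_distrib)
  then have m: "\<bar>(2 powi j * s - real_of_int k) - (2 powi j * t - real_of_int k)\<bar> = 2 powi j * \<bar>s - t\<bar>"
    by (simp add: abs_mult)
  show ?thesis
    unfolding incr_def abs_mult
    using mult_left_mono[OF P_increment[OF H_range[of "node j k"], of "2 powi j * s - real_of_int k" "2 powi j * t - real_of_int k"],
       of "\<bar>2 powr (- real_of_int j * H (node j k))\<bar> * \<bar>e (j, k)\<bar>"]
    unfolding m by (simp add: mult.assoc)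
qed

lemma decay_step: "(1 + \<bar>u\<bar>) ^ 2 * (1 / (1 + \<bar>u\<bar>) ^ 4) = rho u" for u :: real
proof -
  have "1 + \<bar>u\<bar> \<noteq> 0" by linarith
  then show ?thesis by (simp add: rho_def field_simps flip: power_add)
qed

text \<open>
  Global bound, which gives convergence everywhere and controls the negative levels. For \<open>j \<ge> 0\<close> the factor
  \<open>2 powr (-j a)\<close> beats the growth \<open>2 powr (j \<delta>)\<close> of the coefficients, as \<open>\<delta> < a\<close>; for \<open>j < 0\<close> the Lipschitz bound
  provides \<open>2\<^sup>j |s - t|\<close>, which beats \<open>2 powr (-j b)\<close> as \<open>b < 1\<close>.
\<close>
lemma incr_majorant:
  "\<exists>K>0. \<exists>r>0. r < 1 \<and> (\<forall>s t j k. \<bar>incr s t j k\<bar> \<le>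
     K * ((1 + \<bar>real_of_int j\<bar>) * r ^ nat \<bar>j\<bar>) * (if j < 0 then \<bar>s - t\<bar> else 1) *
       ((1 + \<bar>s\<bar>) * rho (2 powi j * s - real_of_int k) + (1 + \<bar>t\<bar>) * rho (2 powi j * t - real_of_int k)))"
proof -
  define \<delta> where "\<delta> = a / 2"
  have \<delta>: "0 < \<delta>" "\<delta> < a" "\<delta> < 1" using ab by (auto simp: \<delta>_def)
  obtain C0 where C0: "\<And>j k. exp ((e (j, k))\<^sup>2 / 8) \<le> C0 * ((1 + \<bar>real_of_int j\<bar>) * (1 + \<bar>real_of_int k\<bar>))\<^sup>2"
    using coeff_growth by blast
  define C where "C = max 1 C0"
  define A where "A = sqrt (8 * ln C + 16 + 16 / \<delta>) * 1"
  have A: "0 < A" using \<delta> by (simp add: A_def C_def add_nonneg_pos)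
  have e1: "\<bar>e (j, k)\<bar> \<le> A * ((1 + \<bar>real_of_int j\<bar>) * (1 + \<bar>real_of_int k\<bar>) powr \<delta>)" for j k
  proof -
    let ?y = "(1 + \<bar>real_of_int j\<bar>) * (1 + \<bar>real_of_int k\<bar>)"
    have y: "1 \<le> ?y" using mult_mono[of 1 "1 + \<bar>real_of_int j\<bar>" 1 "1 + \<bar>real_of_int k\<bar>"] by simp
    have "exp ((e (j, k))\<^sup>2 / 8) \<le> C0 * ?y ^ 2" by (rule C0)
    also have "\<dots> \<le> C * (exp (2 * 1\<^sup>2) * ?y ^ 4)"
    proof (rule mult_mono)
      have "1 * ?y ^ 2 \<le> exp (2 * 1\<^sup>2) * ?y ^ 4"
        using y by (intro mult_mono power_increasing) auto
      then show "?y ^ 2 \<le> exp (2 * 1\<^sup>2) * ?y ^ 4" by simp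
    qed (auto simp: C_def)
    finally have "\<bar>e (j, k)\<bar> \<le> A * ?y powr \<delta>"
      unfolding A_def using y \<delta> by (intro abs_le_of_exp_square_le[where C=C]) (auto simp: C_def mult.assoc)
    also have "?y powr \<delta> = (1 + \<bar>real_of_int j\<bar>) powr \<delta> * (1 + \<bar>real_of_int k\<bar>) powr \<delta>"
      by (simp add: powr_mult)
    also have "\<dots> \<le> (1 + \<bar>real_of_int j\<bar>) powr 1 * (1 + \<bar>real_of_int k\<bar>) powr \<delta>"
      using \<delta> by (intro mult_right_mono powr_mono) auto
    finally show ?thesis using A by (simp add: mult_left_mono)
  qed
  \<comment> \<open>The two entries are the geometric ratios for nonnegative and for negative levels.\<close>
  define r where "r = max (2 powr (- (a - \<delta>))) (2 powr (- (1 - b)))"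
  have r: "0 < r" "r < 1"
    using \<delta> ab by (auto simp: r_def powr_less_one less_max_iff_disj)
  have rpow: "2 powr (- (c * n)) \<le> r ^ n" if "2 powr (- c) \<le> r" for c and n :: nat
  proof -
    have "2 powr (- (c * n)) = (2 powr (- c)) ^ n"
      by (simp add: powr_realpow[symmetric] powr_powr)
    also have "\<dots> \<le> r ^ n" using that by (intro power_mono) auto
    finally show ?thesis .
  qed
  show ?thesis
  proof (rule exI[of _ "A * CP"], intro conjI exI[of _ r] allI)
    fix s t :: real and j k :: int
    define J where "J = real_of_int j"
    define L where "L = (1 + \<bar>J\<bar>) * r ^ nat \<bar>j\<bar> * (if j < 0 then \<bar>s - t\<bar> else 1)"
    have p2: "2 powi j = (2::real) powr J" by (simp add: J_def powr_real_of_int')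
    have hab: "a \<le> H (node j k)" "H (node j k) \<le> b" using H_range[of "node j k"] by auto
    have main: "2 powr (- J * H (node j k)) * (1 + \<bar>real_of_int k\<bar>) powr \<delta> * min 1 (2 powi j * \<bar>s - t\<bar>)
        \<le> r ^ nat \<bar>j\<bar> * (if j < 0 then \<bar>s - t\<bar> else 1) * ((1 + \<bar>x\<bar>) * (1 + \<bar>2 powi j * x - real_of_int k\<bar>))"
      for x
    proof -
      let ?u = "\<bar>2 powi j * x - real_of_int k\<bar>"
      have k: "1 + \<bar>real_of_int k\<bar> \<le> (1 + \<bar>2 powi j * x\<bar>) * (1 + ?u)"
        using one_plus_abs_le_mult[of "real_of_int k" "2 powi j * x"] by simp
      show ?thesis
      proof (cases "j < 0")
        case False
        then have J: "0 \<le> J" "real (nat \<bar>j\<bar>) = J" by (auto simp: J_def)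
        have "1 \<le> 2 powr J" using J by (simp add: ge_one_powr_ge_zero)
        then have "1 + \<bar>2 powi j * x\<bar> \<le> 2 powr J * (1 + \<bar>x\<bar>)"
          unfolding p2 by (simp add: abs_mult algebra_simps)
        then have "(1 + \<bar>2 powi j * x\<bar>) * (1 + ?u) \<le> 2 powr J * (1 + \<bar>x\<bar>) * (1 + ?u)"
          by (intro mult_right_mono) auto
        then have "1 + \<bar>real_of_int k\<bar> \<le> 2 powr J * ((1 + \<bar>x\<bar>) * (1 + ?u))"
          using k by (simp add: mult.assoc)
        then have "(1 + \<bar>real_of_int k\<bar>) powr \<delta> \<le> (2 powr J * ((1 + \<bar>x\<bar>) * (1 + ?u))) powr \<delta>"
          using \<delta> by (intro powr_mono2) auto
        also have "\<dots> = 2 powr (J * \<delta>) * ((1 + \<bar>x\<bar>) * (1 + ?u)) powr \<delta>"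
          by (subst powr_mult) (auto simp: powr_powr)
        also have "((1 + \<bar>x\<bar>) * (1 + ?u)) powr \<delta> \<le> ((1 + \<bar>x\<bar>) * (1 + ?u)) powr 1"
          using \<delta> mult_mono[of 1 "1 + \<bar>x\<bar>" 1 "1 + ?u"] by (intro powr_mono) auto
        finally have kd: "(1 + \<bar>real_of_int k\<bar>) powr \<delta> \<le> 2 powr (J * \<delta>) * ((1 + \<bar>x\<bar>) * (1 + ?u))"
          by (simp add: mult_left_mono)
        have "2 powr (- J * H (node j k)) \<le> 2 powr (- J * a)"
          using hab J by (intro powr_mono) (auto simp: mult_left_mono)
        then have "2 powr (- J * H (node j k)) * (1 + \<bar>real_of_int k\<bar>) powr \<delta> * min 1 (2 powi j * \<bar>s - t\<bar>)
          \<le> 2 powr (- J * a) * (2 powr (J * \<delta>) * ((1 + \<bar>x\<bar>) * (1 + ?u))) * 1"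
          using kd by (intro mult_mono) auto
        also have "\<dots> = 2 powr (- ((a - \<delta>) * real (nat \<bar>j\<bar>))) * ((1 + \<bar>x\<bar>) * (1 + ?u))"
        proof -
          have "2 powr (- J * a) * 2 powr (J * \<delta>) = 2 powr (- ((a - \<delta>) * real (nat \<bar>j\<bar>)))"
            unfolding J(2) by (simp flip: powr_add add: algebra_simps)
          then show ?thesis by (simp only: mult.assoc[symmetric] mult_1_right)
        qed
        also have "\<dots> \<le> r ^ nat \<bar>j\<bar> * ((1 + \<bar>x\<bar>) * (1 + ?u))"
          by (intro mult_right_mono rpow) (auto simp: r_def)
        finally show ?thesis using False by simp
      next
        case True
        then have J: "J < 0" "real (nat \<bar>j\<bar>) = - J" by (auto simp: J_def)
        have "2 powr J \<le> 2 powr 0" using J by (intro powr_mono) auto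
        then have "1 + \<bar>2 powi j * x\<bar> \<le> 1 + \<bar>x\<bar>"
          unfolding p2 by (simp add: abs_mult mult_left_le_one_le)
        then have "(1 + \<bar>2 powi j * x\<bar>) * (1 + ?u) \<le> (1 + \<bar>x\<bar>) * (1 + ?u)"
          by (intro mult_right_mono) auto
        then have k1: "1 + \<bar>real_of_int k\<bar> \<le> (1 + \<bar>x\<bar>) * (1 + ?u)" using k by linarith
        have "(1 + \<bar>real_of_int k\<bar>) powr \<delta> \<le> (1 + \<bar>real_of_int k\<bar>) powr 1"
          using \<delta> by (intro powr_mono) auto
        then have kd: "(1 + \<bar>real_of_int k\<bar>) powr \<delta> \<le> (1 + \<bar>x\<bar>) * (1 + ?u)" using k1 by simp
        have "2 powr (- J * H (node j k)) \<le> 2 powr (- J * b)"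
          using hab J by (intro powr_mono) (auto simp: mult_left_mono_neg)
        then have "2 powr (- J * H (node j k)) * (1 + \<bar>real_of_int k\<bar>) powr \<delta> * min 1 (2 powi j * \<bar>s - t\<bar>)
          \<le> 2 powr (- J * b) * ((1 + \<bar>x\<bar>) * (1 + ?u)) * (2 powi j * \<bar>s - t\<bar>)"
          using kd by (intro mult_mono) auto
        also have "\<dots> = 2 powr (- ((1 - b) * real (nat \<bar>j\<bar>))) * (\<bar>s - t\<bar> * ((1 + \<bar>x\<bar>) * (1 + ?u)))"
        proof -
          have "2 powr (- J * b) * 2 powi j = 2 powr (- ((1 - b) * real (nat \<bar>j\<bar>)))"
            unfolding p2 J(2) by (simp flip: powr_add add: algebra_simps)
          from this[symmetric] show ?thesis by (simp only: mult_ac)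
        qed
        also have "\<dots> \<le> r ^ nat \<bar>j\<bar> * (\<bar>s - t\<bar> * ((1 + \<bar>x\<bar>) * (1 + ?u)))"
          by (intro mult_right_mono rpow) (auto simp: r_def)
        finally show ?thesis using True by (simp add: mult.assoc)
      qed
    qed
    let ?q = "\<lambda>x. 1 / (1 + \<bar>2 powi j * x - real_of_int k\<bar>) ^ 4"
    have one: "2 powr (- J * H (node j k)) * \<bar>e (j, k)\<bar> * (CP * min 1 (2 powi j * \<bar>s - t\<bar>)) * ?q x
      \<le> A * CP * L * ((1 + \<bar>x\<bar>) * rho (2 powi j * x - real_of_int k))" for x
    proof -
      let ?u = "\<bar>2 powi j * x - real_of_int k\<bar>"
      have "2 powr (- J * H (node j k)) * \<bar>e (j, k)\<bar> * (CP * min 1 (2 powi j * \<bar>s - t\<bar>)) * ?q x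
        \<le> 2 powr (- J * H (node j k)) * (A * ((1 + \<bar>J\<bar>) * (1 + \<bar>real_of_int k\<bar>) powr \<delta>)) * (CP * min 1 (2 powi j * \<bar>s - t\<bar>)) * ?q x"
        using e1[of j k] CP_pos unfolding J_def
        by (intro mult_right_mono mult_left_mono) auto
      also have "\<dots> = A * CP * (1 + \<bar>J\<bar>) * (2 powr (- J * H (node j k)) * (1 + \<bar>real_of_int k\<bar>) powr \<delta> * min 1 (2 powi j * \<bar>s - t\<bar>)) * ?q x"
        by (simp only: mult_ac)
      also have "\<dots> \<le> A * CP * (1 + \<bar>J\<bar>) * (r ^ nat \<bar>j\<bar> * (if j < 0 then \<bar>s - t\<bar> else 1) * ((1 + \<bar>x\<bar>) * (1 + ?u))) * ?q x"
        using main[of x] A CP_pos by (intro mult_right_mono mult_left_mono) auto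
      also have "\<dots> = A * CP * L * (1 + \<bar>x\<bar>) * ((1 + ?u) * ?q x)"
        by (simp only: L_def mult_ac)
      also have "\<dots> \<le> A * CP * L * (1 + \<bar>x\<bar>) * rho (2 powi j * x - real_of_int k)"
      proof (rule mult_left_mono)
        have "(1 + ?u) * ?q x \<le> (1 + ?u) ^ 2 * ?q x"
          by (intro mult_right_mono self_le_power) auto
        then show "(1 + ?u) * ?q x \<le> rho (2 powi j * x - real_of_int k)" by (simp only: decay_step)
        show "0 \<le> A * CP * L * (1 + \<bar>x\<bar>)"
          using A CP_pos r by (simp add: L_def)
      qed
      finally show ?thesis by (simp only: mult.assoc)
    qed
    have "\<bar>incr s t j k\<bar> \<le> A * CP * L * ((1 + \<bar>s\<bar>) * rho (2 powi j * s - real_of_int k))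
       + A * CP * L * ((1 + \<bar>t\<bar>) * rho (2 powi j * t - real_of_int k))"
      using incr_abs_le[of s t j k] one[of s] one[of t] unfolding J_def[symmetric] distrib_left by linarith
    then show "\<bar>incr s t j k\<bar> \<le> A * CP * ((1 + \<bar>real_of_int j\<bar>) * r ^ nat \<bar>j\<bar>) * (if j < 0 then \<bar>s - t\<bar> else 1) *
       ((1 + \<bar>s\<bar>) * rho (2 powi j * s - real_of_int k) + (1 + \<bar>t\<bar>) * rho (2 powi j * t - real_of_int k))"
      unfolding L_def J_def distrib_left by (simp only: mult_ac)
  qed (use A CP_pos r in auto)
qed

text \<open>
  Stated for separate factors \<open>p\<close> and \<open>q\<close> at the two points because it is applied both to the global majorant and to
  the local one.
\<close>
lemma incr_row_sum:
  fixes B p q s t :: real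
  assumes "\<And>k. \<bar>incr s t j k\<bar> \<le> B * (p * rho (2 powi j * s - real_of_int k) + q * rho (2 powi j * t - real_of_int k))"
    and "0 \<le> B" "0 \<le> p" "0 \<le> q"
  shows "incr s t j summable_on UNIV" "\<bar>infsum (incr s t j) UNIV\<bar> \<le> B * ((p + q) * rho_total)"
proof -
  let ?R = "\<lambda>x k. rho (2 powi j * x - real_of_int k)"
  have s: "(\<lambda>k. p * ?R s k) summable_on UNIV" "(\<lambda>k. q * ?R t k) summable_on UNIV"
    by (intro summable_on_cmult_right rho_shift_summable)+
  have S: "(\<lambda>k. B * (p * ?R s k + q * ?R t k)) summable_on UNIV"
    by (intro summable_on_cmult_right summable_on_add s)
  show "incr s t j summable_on UNIV"
    by (rule abs_infsum_le(1)[OF S assms(1)])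
  have "\<bar>infsum (incr s t j) UNIV\<bar> \<le> (\<Sum>\<^sub>\<infinity>k. B * (p * ?R s k + q * ?R t k))"
    by (rule abs_infsum_le(2)[OF S assms(1)])
  also have "\<dots> = B * (p * (\<Sum>\<^sub>\<infinity>k. ?R s k) + q * (\<Sum>\<^sub>\<infinity>k. ?R t k))"
    by (simp add: infsum_cmult_right' infsum_add[OF s])
  also have "\<dots> \<le> B * (p * rho_total + q * rho_total)"
    using assms rho_shift_infsum_le unfolding rho_total_def
    by (intro mult_left_mono add_mono) auto
  finally show "\<bar>infsum (incr s t j) UNIV\<bar> \<le> B * ((p + q) * rho_total)"
    by (simp add: distrib_right)
qed

lemma incr_row_majorant:
  "\<exists>K>0. \<exists>r>0. r < 1 \<and> (\<forall>s t j. incr s t j summable_on UNIV \<and> \<bar>infsum (incr s t j) UNIV\<bar> \<le>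
     K * ((1 + \<bar>real_of_int j\<bar>) * r ^ nat \<bar>j\<bar>) * (if j < 0 then \<bar>s - t\<bar> else 1) * (2 + \<bar>s\<bar> + \<bar>t\<bar>))"
proof -
  obtain K r where K: "K > 0" "r > 0" "r < 1" and le: "\<And>s t j k. \<bar>incr s t j k\<bar> \<le>
     K * ((1 + \<bar>real_of_int j\<bar>) * r ^ nat \<bar>j\<bar>) * (if j < 0 then \<bar>s - t\<bar> else 1) *
       ((1 + \<bar>s\<bar>) * rho (2 powi j * s - real_of_int k) + (1 + \<bar>t\<bar>) * rho (2 powi j * t - real_of_int k))"
    using incr_majorant by blast
  have r0: "incr s t j summable_on UNIV" "\<bar>infsum (incr s t j) UNIV\<bar> \<le>
     K * ((1 + \<bar>real_of_int j\<bar>) * r ^ nat \<bar>j\<bar>) * (if j < 0 then \<bar>s - t\<bar> else 1) * ((1 + \<bar>s\<bar> + (1 + \<bar>t\<bar>)) * rho_total)" for s t j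
    using incr_row_sum[OF le[of s t j]] K by auto
  have "K * ((1 + \<bar>real_of_int j\<bar>) * r ^ nat \<bar>j\<bar>) * (if j < 0 then \<bar>s - t\<bar> else 1) * ((1 + \<bar>s\<bar> + (1 + \<bar>t\<bar>)) * rho_total)
     \<le> K * ((1 + \<bar>real_of_int j\<bar>) * r ^ nat \<bar>j\<bar>) * (if j < 0 then \<bar>s - t\<bar> else 1) * ((2 + \<bar>s\<bar> + \<bar>t\<bar>) * (1 + rho_total))" for s t j
    using K by (intro mult_left_mono) (auto simp: algebra_simps)
  also have "\<dots> s t j = K * (1 + rho_total) * ((1 + \<bar>real_of_int j\<bar>) * r ^ nat \<bar>j\<bar>) * (if j < 0 then \<bar>s - t\<bar> else 1) * (2 + \<bar>s\<bar> + \<bar>t\<bar>)" for s t j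
    by (simp only: mult_ac)
  finally show ?thesis
    using r0 K rho_total_nonneg order_trans[OF r0(2)]
    by (intro exI[of _ "K * (1 + rho_total)"] conjI exI[of _ r] allI) (auto intro: add_pos_nonneg)
qed

lemma incr_sums_summable: "(\<lambda>j. infsum (incr s t j) UNIV) summable_on UNIV"
proof -
  obtain K r where K: "K > 0" "r > 0" "r < 1" and le: "\<And>s t j. \<bar>infsum (incr s t j) UNIV\<bar> \<le>
     K * ((1 + \<bar>real_of_int j\<bar>) * r ^ nat \<bar>j\<bar>) * (if j < 0 then \<bar>s - t\<bar> else 1) * (2 + \<bar>s\<bar> + \<bar>t\<bar>)"
    using incr_row_majorant by blast
  have "(\<lambda>j::int. (1 + \<bar>real_of_int j\<bar>) * r ^ nat \<bar>j\<bar>) summable_on UNIV"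
    using K by (intro summable_on_int_arith_geometric) auto
  then have S: "(\<lambda>j::int. (K * (1 + \<bar>s - t\<bar>) * (2 + \<bar>s\<bar> + \<bar>t\<bar>)) * ((1 + \<bar>real_of_int j\<bar>) * r ^ nat \<bar>j\<bar>)) summable_on UNIV"
    by (rule summable_on_cmult_right)
  show ?thesis
  proof (rule abs_infsum_le(1)[OF S])
    fix j :: int
    have "\<bar>infsum (incr s t j) UNIV\<bar> \<le>
     K * ((1 + \<bar>real_of_int j\<bar>) * r ^ nat \<bar>j\<bar>) * (if j < 0 then \<bar>s - t\<bar> else 1) * (2 + \<bar>s\<bar> + \<bar>t\<bar>)"
      by (rule le)
    also have "\<dots> \<le> K * ((1 + \<bar>real_of_int j\<bar>) * r ^ nat \<bar>j\<bar>) * (1 + \<bar>s - t\<bar>) * (2 + \<bar>s\<bar> + \<bar>t\<bar>)"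
      using K by (intro mult_right_mono mult_left_mono) auto
    also have "\<dots> = (K * (1 + \<bar>s - t\<bar>) * (2 + \<bar>s\<bar> + \<bar>t\<bar>)) * ((1 + \<bar>real_of_int j\<bar>) * r ^ nat \<bar>j\<bar>)"
      by (simp only: mult_ac)
    finally show "\<bar>infsum (incr s t j) UNIV\<bar> \<le> (K * (1 + \<bar>s - t\<bar>) * (2 + \<bar>s\<bar> + \<bar>t\<bar>)) * ((1 + \<bar>real_of_int j\<bar>) * r ^ nat \<bar>j\<bar>)" .
  qed
qed

text \<open>
  The reference point \<open>0\<close> in the definition of \<open>Z\<close> cancels; by absolute convergence the series may be
  subtracted termwise.
\<close>
lemma Z_diff: "Z s - Z t = (\<Sum>\<^sub>\<infinity>j. \<Sum>\<^sub>\<infinity>k. incr s t j k)"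
proof -
  have row: "incr s t j summable_on UNIV" for s t j
    using incr_row_majorant by blast
  have incr: "incr s 0 j k = incr s t j k + incr t 0 j k" for j k
    by (simp add: incr_def algebra_simps)
  have "Z s = (\<Sum>\<^sub>\<infinity>j. infsum (incr s t j) UNIV + infsum (incr t 0 j) UNIV)"
    unfolding Z_def incr by (intro infsum_cong infsum_add row)
  also have "\<dots> = (\<Sum>\<^sub>\<infinity>j. infsum (incr s t j) UNIV) + Z t"
    unfolding Z_def by (intro infsum_add incr_sums_summable)
  finally show ?thesis by simp
qed

end

section \<open>Local modulus of continuity\<close>

text \<open>
  The two regimes \<open>2\<^sup>j h \<le> 1\<close> and \<open>2\<^sup>j h > 1\<close> are balanced at \<open>j = N\<close>. Below, the terms are of order
  \<open>2 powr (-j \<eta>) 2\<^sup>j h\<close> and increase with \<open>j\<close>, as \<open>\<eta> < 1\<close>; above, they are of order \<open>2 powr (-j (\<eta> - \<kappa>)) h powr \<kappa>\<close>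
  and decrease, as \<open>\<kappa> < \<eta>\<close>. In both cases the decay is geometric in \<open>|j - N|\<close>.
\<close>
lemma scale_profile_bound:
  fixes h \<eta> \<kappa> :: real and j N :: int
  assumes "0 \<le> \<kappa>" "\<kappa> < \<eta>" "\<eta> < 1" "\<kappa> \<le> 1"
    and h: "2 powr (- (real_of_int N + 1)) < h" "h \<le> 2 powr (- real_of_int N)"
  shows "2 powr (- real_of_int j * \<eta>) * (1 + 2 powi j * h) powr \<kappa> * min 1 (2 powi j * h)
     \<le> 4 * h powr \<eta> * max (2 powr (- (1 - \<eta>))) (2 powr (- (\<eta> - \<kappa>))) ^ nat \<bar>j - N\<bar>"
proof -
  define J where "J = real_of_int j"
  define M where "M = real_of_int N"
  let ?r = "max (2 powr (- (1 - \<eta>))) (2 powr (- (\<eta> - \<kappa>)))"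
  have h0: "0 < h" by (rule le_less_trans[OF _ h(1)]) simp
  have p2: "2 powi j = (2::real) powr J" by (simp add: J_def powr_real_of_int')
  have two: "2 powr \<kappa> \<le> 2" using assms powr_mono[of \<kappa> 1 2] by simp
  have x: "2 powr J * h \<le> 2 powr (J - M)"
  proof -
    have "2 powr J * h \<le> 2 powr J * 2 powr (- M)" using h(2) by (intro mult_left_mono) (auto simp: M_def)
    then show ?thesis by (simp flip: powr_add)
  qed
  have rpow: "2 powr (- (c * n)) \<le> ?r ^ n" if "2 powr (- c) \<le> ?r" for c and n :: nat
  proof -
    have "2 powr (- (c * n)) = (2 powr (- c)) ^ n"
      by (simp add: powr_realpow[symmetric] powr_powr)
    also have "\<dots> \<le> ?r ^ n" using that by (intro power_mono) auto
    finally show ?thesis .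
  qed
  have "2 powr (- M) = 2 powr 1 * 2 powr (- (M + 1))"
    using powr_add[of 2 1 "- (M + 1)"] by simp
  also have "\<dots> \<le> 2 * h" using h(1) by (simp add: M_def)
  finally have "(2 powr (- M)) powr \<eta> \<le> (2 * h) powr \<eta>" using assms by (intro powr_mono2) auto
  also have "\<dots> = 2 powr \<eta> * h powr \<eta>" using h0 by (simp add: powr_mult)
  also have "\<dots> \<le> 2 * h powr \<eta>"
    using assms powr_mono[of \<eta> 1 2] by (intro mult_right_mono) auto
  finally have hM: "2 powr (- M * \<eta>) \<le> 2 * h powr \<eta>" by (simp add: powr_powr)
  have "2 powr (- J * \<eta>) * (1 + 2 powr J * h) powr \<kappa> * min 1 (2 powr J * h) \<le> 2 * (2 powr (- M * \<eta>) * ?r ^ nat \<bar>j - N\<bar>)"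
  proof (cases "j \<le> N")
    case True
    then have n: "real (nat \<bar>j - N\<bar>) = M - J" by (simp add: M_def J_def)
    have "2 powr (J - M) \<le> 2 powr 0" using True by (intro powr_mono) (auto simp: J_def M_def)
    then have x1: "2 powr J * h \<le> 1" using x by simp
    have "(1 + 2 powr J * h) powr \<kappa> \<le> 2 powr \<kappa>"
      using x1 h0 assms by (intro powr_mono2) auto
    then have "2 powr (- J * \<eta>) * (1 + 2 powr J * h) powr \<kappa> * min 1 (2 powr J * h) \<le> 2 powr (- J * \<eta>) * 2 * 2 powr (J - M)"
      using two x h0 by (intro mult_mono) auto
    also have "\<dots> = 2 * (2 powr (- M * \<eta>) * 2 powr (- ((1 - \<eta>) * real (nat \<bar>j - N\<bar>))))"
    proof -
      have "2 powr (- J * \<eta>) * 2 powr (J - M) = 2 powr (- M * \<eta>) * 2 powr (- ((1 - \<eta>) * real (nat \<bar>j - N\<bar>)))"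
        unfolding n by (simp flip: powr_add add: algebra_simps)
      then show ?thesis by simp
    qed
    also have "\<dots> \<le> 2 * (2 powr (- M * \<eta>) * ?r ^ nat \<bar>j - N\<bar>)"
      by (intro mult_left_mono rpow) auto
    finally show ?thesis .
  next
    case False
    then have n: "real (nat \<bar>j - N\<bar>) = J - M" by (simp add: M_def J_def)
    have "2 powr 0 \<le> 2 powr (J - M)" using False by (intro powr_mono) (auto simp: J_def M_def)
    then have "1 + 2 powr J * h \<le> 2 * 2 powr (J - M)" using x by simp
    then have "(1 + 2 powr J * h) powr \<kappa> \<le> (2 * 2 powr (J - M)) powr \<kappa>"
      using h0 assms by (intro powr_mono2) auto
    also have "\<dots> = 2 powr \<kappa> * 2 powr ((J - M) * \<kappa>)" by (simp add: powr_mult powr_powr)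
    also have "\<dots> \<le> 2 * 2 powr ((J - M) * \<kappa>)" using two by (intro mult_right_mono) auto
    finally have "2 powr (- J * \<eta>) * (1 + 2 powr J * h) powr \<kappa> * min 1 (2 powr J * h) \<le> 2 powr (- J * \<eta>) * (2 * 2 powr ((J - M) * \<kappa>)) * 1"
      using h0 by (intro mult_mono) auto
    also have "\<dots> = 2 * (2 powr (- M * \<eta>) * 2 powr (- ((\<eta> - \<kappa>) * real (nat \<bar>j - N\<bar>))))"
    proof -
      have "2 powr (- J * \<eta>) * 2 powr ((J - M) * \<kappa>) = 2 powr (- M * \<eta>) * 2 powr (- ((\<eta> - \<kappa>) * real (nat \<bar>j - N\<bar>)))"
        unfolding n by (simp flip: powr_add add: algebra_simps)
      then show ?thesis by simp
    qed
    also have "\<dots> \<le> 2 * (2 powr (- M * \<eta>) * ?r ^ nat \<bar>j - N\<bar>)"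
      by (intro mult_left_mono rpow) auto
    finally show ?thesis .
  qed
  also have "\<dots> \<le> 2 * (2 * h powr \<eta> * ?r ^ nat \<bar>j - N\<bar>)"
    using hM by (intro mult_left_mono mult_right_mono) (auto simp: le_max_iff_disj)
  finally show ?thesis unfolding p2 J_def by (simp add: mult.assoc)
qed

context wavelet_series begin

text \<open>
  With \<open>\<delta> = a/6\<close> the factors \<open>(1 + u) powr (2\<delta>)\<close> from the exponent and \<open>(1 + u) powr \<delta>\<close> from the coefficients multiply to
  \<open>(1 + u) powr (a/2)\<close>. Seen from \<open>s\<close>, the distance \<open>u\<close> can be as large as \<open>2\<^sup>j |s - t|\<close>; this costs the factor
  \<open>(1 + 2\<^sup>j |s - t|) powr (a/2)\<close>, which is affordable since \<open>a/2 < H t\<close>.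
\<close>
lemma incr_local_bound:
  fixes g :: "int \<Rightarrow> real"
  assumes R: "0 < R" "R < 1" "0 < c"
      "\<And>s. 0 < \<bar>s - t\<bar> \<Longrightarrow> \<bar>s - t\<bar> \<le> R \<Longrightarrow> \<bar>H s - H t\<bar> \<le> c / ln (inverse \<bar>s - t\<bar>)"
    and g: "\<And>j. 0 \<le> j \<Longrightarrow> 1 \<le> g j"
    and ej: "\<And>j k. 0 \<le> j \<Longrightarrow> exp ((e (j, k))\<^sup>2 / 8) \<le> C0 * exp (2 * (g j)\<^sup>2) * (1 + \<bar>2 powi j * t - real_of_int k\<bar>) ^ 4"
  shows "\<exists>K>0. \<exists>d>0. \<forall>s. \<bar>s - t\<bar> < d \<longrightarrow> (\<forall>j k. 0 \<le> j \<longrightarrow> \<bar>incr s t j k\<bar> \<le>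
     K * (g j * (2 powr (- real_of_int j * H t) * (1 + 2 powi j * \<bar>s - t\<bar>) powr (a / 2) * min 1 (2 powi j * \<bar>s - t\<bar>))) *
       (1 * rho (2 powi j * s - real_of_int k) + 1 * rho (2 powi j * t - real_of_int k)))"
proof -
  define \<delta> where "\<delta> = a / 6"
  have \<delta>: "0 < \<delta>" using ab by (simp add: \<delta>_def)
  have H01: "0 \<le> H x \<and> H x \<le> 1" for x using H_range[of x] ab by auto
  obtain C d where C: "C > 0" and d: "d > 0" and Hb: "\<And>s j k. \<bar>s - t\<bar> < d \<Longrightarrow> 0 \<le> j \<Longrightarrow>
     2 powr (- real_of_int j * H (node j k)) \<le>
       C * 2 powr (- real_of_int j * H t) * (1 + \<bar>2 powi j * t - real_of_int k\<bar>) powr (2 * \<delta>)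
         * (1 + \<bar>2 powi j * s - real_of_int k\<bar>)"
    using dyadic_exponent_local_bound[of H, OF H01 R \<delta>] unfolding node_def by blast
  define C1 where "C1 = max 1 C0"
  define A where "A = sqrt (8 * ln C1 + 16 + 16 / \<delta>)"
  have A: "0 < A" using \<delta> by (simp add: A_def C1_def add_nonneg_pos)
  have e1: "\<bar>e (j, k)\<bar> \<le> A * g j * (1 + \<bar>2 powi j * t - real_of_int k\<bar>) powr \<delta>" if "0 \<le> j" for j k
    unfolding A_def
  proof (rule abs_le_of_exp_square_le)
    have "exp ((e (j, k))\<^sup>2 / 8) \<le> C0 * (exp (2 * (g j)\<^sup>2) * (1 + \<bar>2 powi j * t - real_of_int k\<bar>) ^ 4)"
      using ej[OF that, of k] by (simp only: mult.assoc)
    also have "\<dots> \<le> C1 * (exp (2 * (g j)\<^sup>2) * (1 + \<bar>2 powi j * t - real_of_int k\<bar>) ^ 4)"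
      by (intro mult_right_mono) (auto simp: C1_def)
    finally show "exp ((e (j, k))\<^sup>2 / 8) \<le> C1 * exp (2 * (g j)\<^sup>2) * (1 + \<bar>2 powi j * t - real_of_int k\<bar>) ^ 4"
      by (simp only: mult.assoc)
  qed (use g[OF that] \<delta> in \<open>auto simp: C1_def\<close>)
  show ?thesis
  proof (rule exI[of _ "C * A * CP"], intro conjI exI[of _ d] allI impI)
    fix s j k assume s: "\<bar>s - t\<bar> < d" and j: "(0::int) \<le> j"
    define h where "h = \<bar>s - t\<bar>"
    define w where "w = 2 powi j * h"
    define m where "m = min 1 w"
    define E where "E = 2 powr (- real_of_int j * H t)"
    define u where "u = \<bar>2 powi j * t - real_of_int k\<bar>"
    define W where "W = (1 + w) powr (a / 2)"
    have w0: "0 \<le> w" and m0: "0 \<le> m" by (auto simp: w_def m_def h_def)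
    have u0: "0 \<le> u" by (simp add: u_def)
    have g1: "1 \<le> g j" by (rule g[OF j])
    let ?q = "\<lambda>x. 1 / (1 + \<bar>2 powi j * x - real_of_int k\<bar>) ^ 4"
    have one: "2 powr (- real_of_int j * H (node j k)) * \<bar>e (j, k)\<bar> * (CP * m) * ?q x
      \<le> C * A * CP * (g j * (E * W * m)) * rho (2 powi j * x - real_of_int k)"
      if x: "\<bar>x - t\<bar> < d" "\<bar>2 powi j * t - 2 powi j * x\<bar> \<le> w" for x
    proof -
      define v where "v = \<bar>2 powi j * x - real_of_int k\<bar>"
      have v0: "0 \<le> v" by (simp add: v_def)
      have "1 + u \<le> (1 + \<bar>2 powi j * t - 2 powi j * x\<bar>) * (1 + \<bar>(2 powi j * t - 2 powi j * x) - (2 powi j * t - real_of_int k)\<bar>)"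
        unfolding u_def by (rule one_plus_abs_le_mult)
      also have "\<dots> = (1 + \<bar>2 powi j * t - 2 powi j * x\<bar>) * (1 + v)"
        by (simp add: v_def abs_minus_commute)
      also have "\<dots> \<le> (1 + w) * (1 + v)" using x v0 by (intro mult_right_mono) auto
      finally have "(1 + u) powr (a / 2) \<le> ((1 + w) * (1 + v)) powr (a / 2)"
        using u0 ab by (intro powr_mono2) auto
      also have "\<dots> = W * (1 + v) powr (a / 2)" using w0 v0 by (simp add: W_def powr_mult)
      also have "\<dots> \<le> W * (1 + v) powr 1"
        using v0 ab by (intro mult_left_mono powr_mono) (auto simp: W_def)
      finally have uW: "(1 + u) powr (a / 2) \<le> W * (1 + v)" using v0 by simp
      have "2 powr (- real_of_int j * H (node j k)) * \<bar>e (j, k)\<bar> \<le> (C * E * (1 + u) powr (2 * \<delta>) * (1 + v)) * (A * g j * (1 + u) powr \<delta>)"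
        using Hb[OF x(1) j, of k] e1[OF j, of k] C unfolding u_def v_def E_def
        by (intro mult_mono) auto
      also have "\<dots> = C * A * g j * E * ((1 + u) powr (2 * \<delta>) * (1 + u) powr \<delta>) * (1 + v)"
        by (simp only: mult_ac)
      also have "(1 + u) powr (2 * \<delta>) * (1 + u) powr \<delta> = (1 + u) powr (a / 2)"
        by (simp add: \<delta>_def flip: powr_add)
      also have "C * A * g j * E * (1 + u) powr (a / 2) * (1 + v) \<le> C * A * g j * E * (W * (1 + v)) * (1 + v)"
        using uW C A g1 v0 by (intro mult_right_mono mult_left_mono) (auto simp: E_def)
      finally have "2 powr (- real_of_int j * H (node j k)) * \<bar>e (j, k)\<bar> * (CP * m) * ?q x
         \<le> C * A * g j * E * (W * (1 + v)) * (1 + v) * (CP * m) * ?q x"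
        using CP_pos m0 by (intro mult_right_mono) auto
      also have "\<dots> = C * A * CP * (g j * (E * W * m)) * ((1 + v)^2 * ?q x)"
        by (simp only: mult_ac power2_eq_square)
      also have "(1 + v)^2 * ?q x = rho (2 powi j * x - real_of_int k)"
        unfolding v_def by (rule decay_step)
      finally show ?thesis .
    qed
    have ws: "\<bar>2 powi j * t - 2 powi j * s\<bar> \<le> w"
      unfolding w_def h_def by (simp flip: right_diff_distrib add: abs_mult abs_minus_commute)
    have "\<bar>incr s t j k\<bar> \<le> C * A * CP * (g j * (E * W * m)) * rho (2 powi j * s - real_of_int k)
       + C * A * CP * (g j * (E * W * m)) * rho (2 powi j * t - real_of_int k)"
      using incr_abs_le[of s t j k] one[OF s ws] one[of t] d w0
      unfolding h_def[symmetric] w_def[symmetric] m_def[symmetric] distrib_left by simp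
    then show "\<bar>incr s t j k\<bar> \<le>
     C * A * CP * (g j * (2 powr (- real_of_int j * H t) * (1 + 2 powi j * \<bar>s - t\<bar>) powr (a / 2) * min 1 (2 powi j * \<bar>s - t\<bar>))) *
       (1 * rho (2 powi j * s - real_of_int k) + 1 * rho (2 powi j * t - real_of_int k))"
      unfolding E_def W_def m_def w_def h_def distrib_left mult_1_left .
  qed (use C A CP_pos d in auto)
qed

text \<open>
  The levels \<open>j < 0\<close> contribute a Lipschitz term, which is at most of order \<open>|s - t| powr H t\<close>. For \<open>j \<ge> 0\<close> the terms
  decay geometrically away from \<open>j = N\<close>, so \<open>g j\<close>, which is at most \<open>g N * (1 + |j - N|)\<close>, may be replaced by \<open>g N\<close>.
\<close>
proposition Z_local_modulus:
  fixes g :: "int \<Rightarrow> real"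
  assumes R: "0 < R" "R < 1" "0 < c"
      "\<And>s. 0 < \<bar>s - t\<bar> \<Longrightarrow> \<bar>s - t\<bar> \<le> R \<Longrightarrow> \<bar>H s - H t\<bar> \<le> c / ln (inverse \<bar>s - t\<bar>)"
    and g: "\<And>j. 0 \<le> j \<Longrightarrow> 1 \<le> g j"
    and g_slow: "\<And>j N. 0 \<le> j \<Longrightarrow> 0 \<le> N \<Longrightarrow> g j \<le> g N * (1 + \<bar>real_of_int (j - N)\<bar>)"
    and ej: "\<And>j k. 0 \<le> j \<Longrightarrow> exp ((e (j, k))\<^sup>2 / 8) \<le> C0 * exp (2 * (g j)\<^sup>2) * (1 + \<bar>2 powi j * t - real_of_int k\<bar>) ^ 4"
  shows "\<exists>K. \<exists>d>0. \<forall>s N. 0 \<le> N \<longrightarrow> 0 < \<bar>s - t\<bar> \<longrightarrow> \<bar>s - t\<bar> < d \<longrightarrow>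
     2 powr (- (real_of_int N + 1)) < \<bar>s - t\<bar> \<longrightarrow> \<bar>s - t\<bar> \<le> 2 powr (- real_of_int N) \<longrightarrow>
     \<bar>Z s - Z t\<bar> \<le> K * g N * \<bar>s - t\<bar> powr H t"
proof -
  obtain K2 d where K2: "K2 > 0" and d: "d > 0" and loc: "\<And>s j k. \<bar>s - t\<bar> < d \<Longrightarrow> 0 \<le> j \<Longrightarrow> \<bar>incr s t j k\<bar> \<le>
     K2 * (g j * (2 powr (- real_of_int j * H t) * (1 + 2 powi j * \<bar>s - t\<bar>) powr (a / 2) * min 1 (2 powi j * \<bar>s - t\<bar>))) *
       (1 * rho (2 powi j * s - real_of_int k) + 1 * rho (2 powi j * t - real_of_int k))"
    using incr_local_bound[OF R g ej] by blast
  obtain K1 r where K1: "K1 > 0" "r > 0" "r < 1" and row: "\<And>s t j. \<bar>infsum (incr s t j) UNIV\<bar> \<le>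
     K1 * ((1 + \<bar>real_of_int j\<bar>) * r ^ nat \<bar>j\<bar>) * (if j < 0 then \<bar>s - t\<bar> else 1) * (2 + \<bar>s\<bar> + \<bar>t\<bar>)"
    using incr_row_majorant by blast
  have eta: "a \<le> H t" "H t < 1" "0 < H t" using H_range[of t] ab by auto
  define r1 where "r1 = max (2 powr (- (1 - H t))) (2 powr (- (H t - a / 2)))"
  have r1: "0 < r1" "r1 < 1"
    using eta ab by (auto simp: r1_def powr_less_one less_max_iff_disj)
  define wt where "wt q m = (1 + \<bar>real_of_int m\<bar>) * q ^ nat \<bar>m\<bar>" for q :: real and m :: int
  have wt_sum: "wt q summable_on UNIV" if "0 < q" "q < 1" for q
    unfolding wt_def using that by (intro summable_on_int_arith_geometric) auto
  have wt0: "0 \<le> wt q m" if "0 < q" for q m using that by (simp add: wt_def)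
  let ?K1 = "K1 * (3 + 2 * \<bar>t\<bar>)" and ?K2 = "K2 * 8 * rho_total"
  have K20: "0 \<le> ?K2" using K2 rho_total_nonneg by simp
  show ?thesis
  proof (rule exI[of _ "?K1 * infsum (wt r) UNIV + ?K2 * infsum (wt r1) UNIV"], rule exI[of _ "min d 1"], intro conjI allI impI)
    fix s N assume N: "(0::int) \<le> N" and h0: "0 < \<bar>s - t\<bar>" and hd: "\<bar>s - t\<bar> < min d 1"
      and hN: "2 powr (- (real_of_int N + 1)) < \<bar>s - t\<bar>" "\<bar>s - t\<bar> \<le> 2 powr (- real_of_int N)"
    define h where "h = \<bar>s - t\<bar>"
    define B where "B = g N * h powr H t"
    have g1: "1 \<le> g N" by (rule g[OF N])
    have h: "0 < h" "h < 1" using h0 hd by (auto simp: h_def)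
    have "h powr 1 \<le> h powr H t" using h eta by (intro powr_mono') auto
    also have "\<dots> \<le> B" unfolding B_def using g1 mult_right_mono[OF g1, of "h powr H t"] by simp
    finally have hB: "h \<le> B" using h by simp
    have b: "bij_betw (\<lambda>j. j - N) UNIV (UNIV :: int set)"
      by (rule bij_betw_byWitness[where f'="\<lambda>j. j + N"]) auto
    have S2: "(\<lambda>j. wt r1 (j - N)) summable_on UNIV"
      using summable_on_reindex_bij_betw[OF b, of "wt r1"] wt_sum[OF r1] by simp
    have I2: "(\<Sum>\<^sub>\<infinity>j. wt r1 (j - N)) = infsum (wt r1) UNIV"
      using infsum_reindex_bij_betw[OF b, of "wt r1"] by simp
    have S1: "wt r summable_on UNIV" using wt_sum K1 by blast
    have S: "(\<lambda>j. B * (?K1 * wt r j + ?K2 * wt r1 (j - N))) summable_on UNIV"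
      by (intro summable_on_cmult_right summable_on_add S1 S2)
    have le: "\<bar>infsum (incr s t j) UNIV\<bar> \<le> B * (?K1 * wt r j + ?K2 * wt r1 (j - N))" for j
    proof (cases "j < 0")
      case True
      have s: "2 + \<bar>s\<bar> + \<bar>t\<bar> \<le> 3 + 2 * \<bar>t\<bar>" using h(2) unfolding h_def by linarith
      have "\<bar>infsum (incr s t j) UNIV\<bar> \<le> K1 * wt r j * h * (2 + \<bar>s\<bar> + \<bar>t\<bar>)"
        using row[of s t j] True by (simp add: wt_def h_def)
      also have "\<dots> \<le> K1 * wt r j * B * (3 + 2 * \<bar>t\<bar>)"
        using s hB K1 h wt0[OF K1(2), of j] by (intro mult_mono) auto
      also have "\<dots> = B * (?K1 * wt r j)" by (simp only: mult_ac)
      also have "\<dots> \<le> B * (?K1 * wt r j + ?K2 * wt r1 (j - N))"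
        using mult_nonneg_nonneg[OF K20 wt0[OF r1(1), of "j - N"]] h hB by (intro mult_left_mono) linarith+
      finally show ?thesis .
    next
      case False
      then have j: "0 \<le> j" by simp
      have "\<bar>s - t\<bar> < d" using hd by simp
      note L = loc[OF this j]
      let ?X = "2 powr (- real_of_int j * H t) * (1 + 2 powi j * \<bar>s - t\<bar>) powr (a / 2) * min 1 (2 powi j * \<bar>s - t\<bar>)"
      have X0: "0 \<le> ?X" by simp
      have X: "?X \<le> 4 * h powr H t * r1 ^ nat \<bar>j - N\<bar>"
        unfolding r1_def h_def using scale_profile_bound[of "a / 2" "H t" N "\<bar>s - t\<bar>" j] eta ab hN by simp
      have "\<bar>infsum (incr s t j) UNIV\<bar> \<le> K2 * (g j * ?X) * ((1 + 1) * rho_total)"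
        using L g[OF j] K2 X0 by (intro incr_row_sum(2)) auto
      also have "\<dots> \<le> K2 * ((g N * (1 + \<bar>real_of_int (j - N)\<bar>)) * (4 * h powr H t * r1 ^ nat \<bar>j - N\<bar>)) * ((1 + 1) * rho_total)"
      proof -
        have "0 \<le> g N * (1 + \<bar>real_of_int (j - N)\<bar>)" using g1 by (intro mult_nonneg_nonneg) linarith+
        then have "g j * ?X \<le> (g N * (1 + \<bar>real_of_int (j - N)\<bar>)) * (4 * h powr H t * r1 ^ nat \<bar>j - N\<bar>)"
          by (rule mult_mono[OF g_slow[OF j N] X _ X0])
        then have "K2 * (g j * ?X) \<le> K2 * ((g N * (1 + \<bar>real_of_int (j - N)\<bar>)) * (4 * h powr H t * r1 ^ nat \<bar>j - N\<bar>))"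
          using K2 by (intro mult_left_mono) linarith+
        then show ?thesis
          by (rule mult_right_mono) (use rho_total_nonneg in simp)
      qed
      also have "\<dots> = B * (?K2 * wt r1 (j - N))"
        by (simp add: B_def wt_def mult_ac)
      also have "\<dots> \<le> B * (?K1 * wt r j + ?K2 * wt r1 (j - N))"
        using wt0[OF K1(2), of j] K1 h hB by (intro mult_left_mono) auto
      finally show ?thesis .
    qed
    have "\<bar>Z s - Z t\<bar> \<le> (\<Sum>\<^sub>\<infinity>j. B * (?K1 * wt r j + ?K2 * wt r1 (j - N)))"
      unfolding Z_diff by (rule abs_infsum_le(2)[OF S le])
    also have "\<dots> = B * (?K1 * infsum (wt r) UNIV + ?K2 * infsum (wt r1) UNIV)"
      by (simp add: infsum_cmult_right' infsum_add[OF summable_on_cmult_right[OF S1] summable_on_cmult_right[OF S2]] I2)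
    finally show "\<bar>Z s - Z t\<bar> \<le> (?K1 * infsum (wt r) UNIV + ?K2 * infsum (wt r1) UNIV) * g N * \<bar>s - t\<bar> powr H t"
      unfolding B_def h_def by (simp only: mult_ac)
  qed (use d in auto)
qed

end

section \<open>Growth of Gaussian coefficients\<close>

text \<open>
  The constant \<open>1/8\<close> is small enough for the square of \<open>phi\<close> to be integrable against the standard Gaussian density
  (any constant below \<open>1/4\<close> would be); the second moment is needed for Chebyshev's inequality.
\<close>
definition phi :: "real \<Rightarrow> real" where
  "phi x = exp (x\<^sup>2 / 8)"

lemma phi_nonneg [simp]: "0 \<le> phi x"
  by (simp add: phi_def)

lemma phi_measurable [measurable]: "phi \<in> borel_measurable borel"
  unfolding phi_def by measurable

text \<open>
  The sum of all \<open>w i * X i\<close> has a finite mean, hence is almost surely finite, and it dominates each of its terms.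
\<close>
lemma (in prob_space) AE_weighted_bounded:
  fixes X :: "'i::countable \<Rightarrow> 'a \<Rightarrow> real" and w :: "'i \<Rightarrow> real"
  assumes X: "\<And>i. integrable M (X i)" and X0: "\<And>i \<omega>. 0 \<le> X i \<omega>"
    and m: "\<And>i. expectation (X i) \<le> m"
    and w0: "\<And>i. 0 \<le> w i" and w: "w summable_on UNIV"
  shows "AE \<omega> in M. \<exists>C. \<forall>i. w i * X i \<omega> \<le> C"
proof -
  have [measurable]: "X i \<in> borel_measurable M" for i
    using X by (rule borel_measurable_integrable)
  interpret cs: sigma_finite_measure "count_space (UNIV :: 'i set)"
    by (rule sigma_finite_measure_count_space_countable) simp
  have "(\<lambda>x. (\<lambda>i x. ennreal (w i * X i (fst x))) (snd x) x) \<in> borel_measurable (M \<Otimes>\<^sub>M count_space (UNIV :: 'i set))"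
    by (rule measurable_compose_countable'[where I=UNIV]) auto
  then have [measurable]: "(\<lambda>\<omega>. \<integral>\<^sup>+i. ennreal (w i * X i \<omega>) \<partial>count_space UNIV) \<in> borel_measurable M"
    by (intro cs.borel_measurable_nn_integral) (simp add: split_beta')
  have "(\<integral>\<^sup>+\<omega>. \<integral>\<^sup>+i. ennreal (w i * X i \<omega>) \<partial>count_space UNIV \<partial>M) = (\<integral>\<^sup>+i. \<integral>\<^sup>+\<omega>. ennreal (w i * X i \<omega>) \<partial>M \<partial>count_space UNIV)"
    by (rule nn_integral_count_space_nn_integral) auto
  also have "\<dots> = (\<integral>\<^sup>+i. ennreal (w i * expectation (X i)) \<partial>count_space UNIV)"
  proof (rule nn_integral_cong)
    fix i
    have "(\<integral>\<^sup>+\<omega>. ennreal (w i * X i \<omega>) \<partial>M) = ennreal (\<integral>\<omega>. w i * X i \<omega> \<partial>M)"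
      by (rule nn_integral_eq_integral) (use X X0 w0 in auto)
    then show "(\<integral>\<^sup>+\<omega>. ennreal (w i * X i \<omega>) \<partial>M) = ennreal (w i * expectation (X i))" by simp
  qed
  also have "\<dots> \<le> (\<integral>\<^sup>+i. ennreal (norm (w i * m)) \<partial>count_space UNIV)"
  proof (intro nn_integral_mono ennreal_leI)
    fix i
    have "w i * expectation (X i) \<le> w i * m" by (intro mult_left_mono m w0)
    then show "w i * expectation (X i) \<le> norm (w i * m)" by simp
  qed
  also have "\<dots> < \<infinity>"
  proof -
    have "(\<lambda>i. w i * m) summable_on UNIV" using w by (rule summable_on_cmult_left)
    from iffD1[OF abs_summable_equivalent iffD1[OF summable_on_iff_abs_summable_on_real this]]
    have "integrable (count_space UNIV) (\<lambda>i. w i * m)"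
      unfolding abs_summable_on_def .
    then show ?thesis unfolding integrable_iff_bounded by simp
  qed
  finally have "AE \<omega> in M. (\<integral>\<^sup>+i. ennreal (w i * X i \<omega>) \<partial>count_space UNIV) \<noteq> \<infinity>"
    by (intro nn_integral_PInf_AE) auto
  then show ?thesis
  proof eventually_elim
    fix \<omega> assume fin: "(\<integral>\<^sup>+i. ennreal (w i * X i \<omega>) \<partial>count_space UNIV) \<noteq> \<infinity>"
    show "\<exists>C. \<forall>i. w i * X i \<omega> \<le> C"
    proof (intro exI allI)
      fix i
      have "ennreal (w i * X i \<omega>) \<le> (\<integral>\<^sup>+i. ennreal (w i * X i \<omega>) \<partial>count_space UNIV)"
        by (rule nn_integral_ge_point) simp
      then have "enn2real (ennreal (w i * X i \<omega>)) \<le> enn2real (\<integral>\<^sup>+i. ennreal (w i * X i \<omega>) \<partial>count_space UNIV)"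
        by (rule enn2real_mono) (use fin in \<open>simp add: less_top\<close>)
      then show "w i * X i \<omega> \<le> enn2real (\<integral>\<^sup>+i. ennreal (w i * X i \<omega>) \<partial>count_space UNIV)"
        using w0 X0 by simp
    qed
  qed
qed

text \<open>
  The mixed terms have mean zero by independence.
\<close>
lemma (in prob_space) second_moment_indep_sum:
  fixes X :: "'i \<Rightarrow> 'a \<Rightarrow> real"
  assumes "finite I" "indep_vars (\<lambda>_. borel) X I"
    and "\<And>i. i \<in> I \<Longrightarrow> integrable M (\<lambda>\<omega>. (X i \<omega>)\<^sup>2)" "\<And>i. i \<in> I \<Longrightarrow> expectation (X i) = 0"
  shows "integrable M (\<lambda>\<omega>. (\<Sum>i\<in>I. X i \<omega>)\<^sup>2) \<and> expectation (\<lambda>\<omega>. (\<Sum>i\<in>I. X i \<omega>)\<^sup>2) = (\<Sum>i\<in>I. expectation (\<lambda>\<omega>. (X i \<omega>)\<^sup>2))"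
  using assms
proof (induction I rule: finite_induct)
  case (insert i I)
  have rv: "random_variable borel (X k)" if "k \<in> insert i I" for k
    using insert.prems(1) that by (auto simp: indep_vars_def)
  have int: "integrable M (X k)" if "k \<in> insert i I" for k
    using square_integrable_imp_integrable[OF rv[OF that] insert.prems(2)[OF that]] .
  have ind: "indep_var borel (X i) borel (\<lambda>\<omega>. \<Sum>i\<in>I. X i \<omega>)"
    by (rule indep_vars_sum[OF insert.hyps(1,2) insert.prems(1)])
  have IH: "integrable M (\<lambda>\<omega>. (\<Sum>i\<in>I. X i \<omega>)\<^sup>2)" "expectation (\<lambda>\<omega>. (\<Sum>i\<in>I. X i \<omega>)\<^sup>2) = (\<Sum>i\<in>I. expectation (\<lambda>\<omega>. (X i \<omega>)\<^sup>2))"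
    using insert.IH indep_vars_subset[OF insert.prems(1), of I] insert.prems(2,3) by auto
  have iS: "integrable M (\<lambda>\<omega>. \<Sum>i\<in>I. X i \<omega>)" using int by auto
  have ip: "integrable M (\<lambda>\<omega>. X i \<omega> * (\<Sum>i\<in>I. X i \<omega>))"
    by (rule indep_var_integrable[OF ind int iS]) simp
  have ep: "expectation (\<lambda>\<omega>. X i \<omega> * (\<Sum>i\<in>I. X i \<omega>)) = 0"
    using indep_var_lebesgue_integral[OF ind int iS] insert.prems(3)[of i] by simp
  have sq: "(\<Sum>i\<in>insert i I. X i \<omega>)\<^sup>2 = (X i \<omega>)\<^sup>2 + (\<Sum>i\<in>I. X i \<omega>)\<^sup>2 + 2 * (X i \<omega> * (\<Sum>i\<in>I. X i \<omega>))" for \<omega>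
    using insert.hyps by (simp add: power2_sum)
  have i1: "integrable M (\<lambda>\<omega>. (X i \<omega>)\<^sup>2)" using insert.prems(2) by simp
  show ?case
    unfolding sq using i1 ip IH ep insert.hyps by simp
qed simp

locale gaussian_field = prob_space M for M :: "'w measure" +
  fixes \<epsilon> :: "int \<times> int \<Rightarrow> 'w \<Rightarrow> real"
  assumes indep: "indep_vars (\<lambda>_. borel) \<epsilon> UNIV"
    and distr: "\<And>p. distributed M lborel (\<epsilon> p) std_normal_density"
begin

lemma rv [measurable]: "\<epsilon> p \<in> borel_measurable M"
  using distributed_measurable[OF distr[of p]] by simp

definition "phi_mean = (LINT x|lborel. std_normal_density x * phi x)"
definition "phi_sq_mean = (LINT x|lborel. std_normal_density x * (phi x)\<^sup>2)"

lemma phi_square_integrable: "integrable M (\<lambda>\<omega>. (phi (\<epsilon> p \<omega>))\<^sup>2)"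
proof -
  have "std_normal_density x * (phi x)\<^sup>2 = sqrt 2 * normal_density 0 (sqrt 2) x" for x
  proof -
    have "(phi x)\<^sup>2 = exp (x\<^sup>2 / 4)" by (simp add: phi_def flip: exp_double)
    then have "exp (- x\<^sup>2 / 2) * (phi x)\<^sup>2 = exp (- x\<^sup>2 / 4)"
      by (simp flip: exp_add)
    then show ?thesis
      by (simp add: normal_density_def real_sqrt_mult field_simps)
  qed
  then have "integrable lborel (\<lambda>x. std_normal_density x * (phi x)\<^sup>2)"
    by simp
  then show ?thesis
    by (subst (asm) distributed_integrable[OF distr]) auto
qed

lemma phi_integrable: "integrable M (\<lambda>\<omega>. phi (\<epsilon> p \<omega>))"
  by (rule square_integrable_imp_integrable[OF _ phi_square_integrable]) simp

lemma phi_expectation: "expectation (\<lambda>\<omega>. phi (\<epsilon> p \<omega>)) = phi_mean"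
  unfolding phi_mean_def by (rule distributed_integral[OF distr, symmetric]) auto

lemma phi_square_expectation: "expectation (\<lambda>\<omega>. (phi (\<epsilon> p \<omega>))\<^sup>2) = phi_sq_mean"
  unfolding phi_sq_mean_def by (rule distributed_integral[OF distr, symmetric]) auto

lemma phi_mean_nonneg: "0 \<le> phi_mean" and phi_sq_mean_nonneg: "0 \<le> phi_sq_mean"
  unfolding phi_mean_def phi_sq_mean_def by (auto intro!: integral_nonneg_AE)

lemma AE_global_growth:
  "AE \<omega> in M. \<exists>C. \<forall>j k. phi (\<epsilon> (j, k) \<omega>) \<le> C * ((1 + \<bar>real_of_int j\<bar>) * (1 + \<bar>real_of_int k\<bar>))\<^sup>2"
proof -
  let ?w = "\<lambda>(j, k). rho (real_of_int j) * rho (real_of_int k)"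
  have "?w summable_on (UNIV \<times> UNIV)"
  proof (rule summable_on_SigmaI)
    show "((\<lambda>k. ?w (j, k)) has_sum (rho (real_of_int j) * (\<Sum>\<^sub>\<infinity>k::int. rho (real_of_int k)))) UNIV" for j
      using has_sum_cmult_right[OF has_sum_infsum[OF rho_summable]] by simp
    show "(\<lambda>j::int. rho (real_of_int j) * (\<Sum>\<^sub>\<infinity>k::int. rho (real_of_int k))) summable_on UNIV"
      by (rule summable_on_cmult_left[OF rho_summable])
  qed auto
  then have w: "?w summable_on UNIV" by simp
  have "AE \<omega> in M. \<exists>C. \<forall>p. ?w p * phi (\<epsilon> p \<omega>) \<le> C"
    by (rule AE_weighted_bounded[where m=phi_mean])
       (auto simp: phi_integrable phi_expectation w split: prod.split)
  then show ?thesis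
  proof eventually_elim
    fix \<omega> assume "\<exists>C. \<forall>p. ?w p * phi (\<epsilon> p \<omega>) \<le> C"
    then obtain C where "\<And>p. ?w p * phi (\<epsilon> p \<omega>) \<le> C" by blast
    from this[of "(_, _)"] have C: "rho (real_of_int j) * rho (real_of_int k) * phi (\<epsilon> (j, k) \<omega>) \<le> C" for j k by simp
    have "phi (\<epsilon> (j, k) \<omega>) \<le> C * ((1 + \<bar>real_of_int j\<bar>) * (1 + \<bar>real_of_int k\<bar>))\<^sup>2" for j k
    proof -
      have "(1 + \<bar>real_of_int j\<bar>)\<^sup>2 > 0" "(1 + \<bar>real_of_int k\<bar>)\<^sup>2 > 0" by (auto intro!: zero_less_power)
      then show ?thesis using C[of j k]
        by (simp add: rho_def power_mult_distrib divide_simps mult.assoc split: if_splits)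
    qed
    then show "\<exists>C. \<forall>j k. phi (\<epsilon> (j, k) \<omega>) \<le> C * ((1 + \<bar>real_of_int j\<bar>) * (1 + \<bar>real_of_int k\<bar>))\<^sup>2" by blast
  qed
qed

text \<open>
  The bound is a natural number so that measurability in \<open>(t, \<omega>)\<close> jointly is a matter of countable
  unions and intersections.
\<close>
definition ordinary :: "real \<Rightarrow> 'w \<Rightarrow> bool" where
  "ordinary t \<omega> \<longleftrightarrow> (\<exists>n::nat. \<forall>p. rho (real_of_int (fst p)) * rho (2 powi fst p * t - real_of_int (snd p)) * phi (\<epsilon> p \<omega>) \<le> real n)"

lemma AE_ordinary_at: "AE \<omega> in M. ordinary t \<omega>"
proof -
  let ?w = "\<lambda>(j, k). rho (real_of_int j) * rho (2 powi j * t - real_of_int k)"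
  have "?w summable_on (UNIV \<times> UNIV)"
  proof (rule summable_on_SigmaI)
    show "((\<lambda>k. ?w (j, k)) has_sum (rho (real_of_int j) * (\<Sum>\<^sub>\<infinity>k::int. rho (2 powi j * t - real_of_int k)))) UNIV" for j
      using has_sum_cmult_right[OF has_sum_infsum[OF rho_shift_summable]] by simp
    show "(\<lambda>j::int. rho (real_of_int j) * (\<Sum>\<^sub>\<infinity>k::int. rho (2 powi j * t - real_of_int k))) summable_on UNIV"
    proof (rule summable_on_comparison_test[OF summable_on_cmult_left[OF rho_summable, of rho_total]])
      show "rho (real_of_int j) * (\<Sum>\<^sub>\<infinity>k::int. rho (2 powi j * t - real_of_int k)) \<le> rho (real_of_int j) * rho_total" for j
        using rho_shift_infsum_le unfolding rho_total_def by (intro mult_left_mono) auto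
    qed (auto intro!: mult_nonneg_nonneg infsum_nonneg)
  qed auto
  then have w: "?w summable_on UNIV" by simp
  have "AE \<omega> in M. \<exists>C. \<forall>p. ?w p * phi (\<epsilon> p \<omega>) \<le> C"
    by (rule AE_weighted_bounded[where m=phi_mean])
       (auto simp: phi_integrable phi_expectation w split: prod.split)
  then show ?thesis
  proof eventually_elim
    fix \<omega> assume "\<exists>C. \<forall>p. ?w p * phi (\<epsilon> p \<omega>) \<le> C"
    then obtain C where C: "\<And>p. ?w p * phi (\<epsilon> p \<omega>) \<le> C" by blast
    obtain n :: nat where "C \<le> real n" using real_arch_simple by blast
    then show "ordinary t \<omega>"
      unfolding ordinary_def using order_trans[OF C] by (auto simp: split_beta intro!: exI[of _ n])
  qed
qed

text \<open>
  Fubini's theorem exchanges "for every \<open>t\<close>, almost surely" with "almost surely, for almost every \<open>t\<close>".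
\<close>
lemma AE_ordinary: "AE \<omega> in M. AE t in lborel. ordinary t \<omega>"
proof -
  interpret pair_sigma_finite M lborel ..
  have "Measurable.pred (M \<Otimes>\<^sub>M lborel) (\<lambda>x. ordinary (snd x) (fst x))"
    unfolding ordinary_def by (intro pred_intros_countable) measurable
  then have "{x \<in> space (M \<Otimes>\<^sub>M lborel). ordinary (snd x) (fst x)} \<in> sets (M \<Otimes>\<^sub>M lborel)"
    by (rule predE)
  from AE_commute[of "\<lambda>\<omega> t. ordinary t \<omega>", OF this] show ?thesis
    using AE_ordinary_at by simp
qed

lemma ordinary_growth:
  assumes "ordinary t \<omega>"
  shows "\<exists>C. \<forall>j k. 0 \<le> j \<longrightarrow> phi (\<epsilon> (j, k) \<omega>) \<le> C * (3 + real_of_int j)\<^sup>2 * (1 + \<bar>2 powi j * t - real_of_int k\<bar>) ^ 4"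
proof -
  obtain n :: nat where n: "\<And>p. rho (real_of_int (fst p)) * rho (2 powi fst p * t - real_of_int (snd p)) * phi (\<epsilon> p \<omega>) \<le> real n"
    using assms unfolding ordinary_def by blast
  show ?thesis
  proof (intro exI[of _ "real n"] allI impI)
    fix j k :: int assume j: "0 \<le> j"
    let ?u = "1 + \<bar>2 powi j * t - real_of_int k\<bar>"
    have p: "(1 + \<bar>real_of_int j\<bar>)\<^sup>2 > 0" "?u\<^sup>2 > 0" by (auto intro!: zero_less_power)
    have "phi (\<epsilon> (j, k) \<omega>) \<le> real n * ((1 + \<bar>real_of_int j\<bar>)\<^sup>2 * ?u\<^sup>2)"
      using n[of "(j, k)"] p by (simp add: rho_def divide_simps split: if_splits)
    also have "\<dots> \<le> real n * ((3 + real_of_int j)\<^sup>2 * ?u ^ 4)"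
      using j by (intro mult_left_mono mult_mono power_mono power_increasing) auto
    finally show "phi (\<epsilon> (j, k) \<omega>) \<le> real n * (3 + real_of_int j)\<^sup>2 * ?u ^ 4"
      by (simp only: mult.assoc)
  qed
qed

end

section \<open>The tree of good dyadic intervals\<close>

text \<open>
  At each level the integer \<open>i\<close> stands for the dyadic interval \<open>[i 2\<^sup>-\<^sup>j, (i+1) 2\<^sup>-\<^sup>j)\<close>.
\<close>
definition children :: "int set \<Rightarrow> int set" where
  "children S = (\<lambda>i. 2 * i) ` S \<union> (\<lambda>i. 2 * i + 1) ` S"

lemma children_div: "i \<in> children S \<Longrightarrow> i div 2 \<in> S"
  by (auto simp: children_def)

lemma finite_children [simp]: "finite S \<Longrightarrow> finite (children S)"
  by (simp add: children_def)

lemma card_children: "finite S \<Longrightarrow> card (children S) = 2 * card S"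
proof -
  assume "finite S"
  then have "card (children S) = card ((\<lambda>i::int. 2 * i) ` S) + card ((\<lambda>i. 2 * i + 1) ` S)"
    unfolding children_def by (intro card_Un_disjoint) (auto, presburger)
  also have "\<dots> = card S + card S"
    by (intro arg_cong2[where f="(+)"] card_image) (auto simp: inj_on_def)
  finally show ?thesis by simp
qed

text \<open>
  A bound \<open>A\<close> for the energy of \<open>i\<close> bounds all coefficients of its level at once: \<open>phi (e (j, k)) \<le> A (1 + |k - i|)\<^sup>2\<close>.
  Being linear in the values of \<open>phi\<close>, the energy is accessible to moment estimates.
\<close>
definition cell_energy :: "(int \<times> int \<Rightarrow> real) \<Rightarrow> int \<Rightarrow> int set \<Rightarrow> int \<Rightarrow> real" where
  "cell_energy e j K i = (\<Sum>k\<in>K. rho (real_of_int (k - i)) * phi (e (j, k)))"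

lemma cell_energy_nonneg: "0 \<le> cell_energy e j K i"
  unfolding cell_energy_def by (intro sum_nonneg) simp

text \<open>
  \<open>Ks n\<close> is the set of coefficients inspected in generation \<open>n\<close>. It is kept finite so that only finite sums of
  independent variables occur; the other coefficients are controlled by the almost sure growth bound.
\<close>
primrec slow_tree :: "(nat \<Rightarrow> int set) \<Rightarrow> real \<Rightarrow> nat \<Rightarrow> int \<Rightarrow> (int \<times> int \<Rightarrow> real) \<Rightarrow> nat \<Rightarrow> int set" where
  "slow_tree Ks A j0 k0 e 0 = {k0}"
| "slow_tree Ks A j0 k0 e (Suc n) =
     {i \<in> children (slow_tree Ks A j0 k0 e n). cell_energy e (int (j0 + Suc n)) (Ks (Suc n)) i \<le> A}"

lemma slow_tree_subset: "slow_tree Ks A j0 k0 e n \<subseteq> {k0 * 2 ^ n ..< (k0 + 1) * 2 ^ n}"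
proof (induction n)
  case (Suc n)
  show ?case
  proof
    fix i assume "i \<in> slow_tree Ks A j0 k0 e (Suc n)"
    then have "i div 2 \<in> slow_tree Ks A j0 k0 e n" using children_div by auto
    then have "k0 * 2 ^ n \<le> i div 2" "i div 2 < (k0 + 1) * 2 ^ n" using Suc.IH by auto
    then have "2 * (k0 * 2 ^ n) \<le> i" "i < 2 * ((k0 + 1) * 2 ^ n)" by linarith+
    then show "i \<in> {k0 * 2 ^ Suc n ..< (k0 + 1) * 2 ^ Suc n}" by (simp add: algebra_simps)
  qed
qed simp

lemma slow_tree_ancestor:
  "i \<in> slow_tree Ks A j0 k0 e (m + d) \<Longrightarrow> i div 2 ^ d \<in> slow_tree Ks A j0 k0 e m"
proof (induction d arbitrary: i)
  case (Suc d)
  then have "i div 2 \<in> slow_tree Ks A j0 k0 e (m + d)" using children_div by auto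
  from Suc.IH[OF this] show ?case by (simp add: zdiv_zmult2_eq)
qed simp

text \<open>
  Generation \<open>n\<close> depends only on the levels up to \<open>j0 + n\<close>, which is the source of independence from the next
  level.
\<close>
lemma slow_tree_cong:
  assumes "\<And>p. fst p \<le> int (j0 + n) \<Longrightarrow> e p = e' p"
  shows "slow_tree Ks A j0 k0 e n = slow_tree Ks A j0 k0 e' n"
  using assms
proof (induction n)
  case (Suc n)
  have "slow_tree Ks A j0 k0 e n = slow_tree Ks A j0 k0 e' n"
    by (rule Suc.IH) (simp add: Suc.prems)
  moreover have "cell_energy e (int (j0 + Suc n)) (Ks (Suc n)) i = cell_energy e' (int (j0 + Suc n)) (Ks (Suc n)) i" for i
    unfolding cell_energy_def by (intro sum.cong) (simp_all add: Suc.prems)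
  ultimately show ?case by simp
qed simp

lemma cell_energy_measurable:
  assumes "{j} \<times> K \<subseteq> J"
  shows "(\<lambda>e. cell_energy e j K i) \<in> borel_measurable (PiM J (\<lambda>_. borel))"
  unfolding cell_energy_def
proof (intro borel_measurable_sum borel_measurable_times borel_measurable_const)
  fix k assume "k \<in> K"
  then have "(j, k) \<in> J" using assms by auto
  then have [measurable]: "(\<lambda>e. e (j, k)) \<in> borel_measurable (PiM J (\<lambda>_. borel))"
    by (rule measurable_component_singleton)
  show "(\<lambda>e. phi (e (j, k))) \<in> borel_measurable (PiM J (\<lambda>_. borel))" by measurable
qed

text \<open>
  The tree takes only finitely many values in each generation, so its law is described by the events that it
  equals a given set \<open>S\<close>.
\<close>
lemma slow_tree_measurable:
  assumes "{p. fst p \<le> int (j0 + n)} \<subseteq> J"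
  shows "{e \<in> space (PiM J (\<lambda>_. borel)). slow_tree Ks A j0 k0 e n = S} \<in> sets (PiM J (\<lambda>_. borel :: real measure))"
  using assms
proof (induction n arbitrary: S)
  case (Suc n)
  let ?P = "PiM J (\<lambda>_. borel :: real measure)"
  let ?T = "slow_tree Ks A j0 k0"
  let ?F = "\<lambda>e i. cell_energy e (int (j0 + Suc n)) (Ks (Suc n)) i"
  have IH: "{e \<in> space ?P. ?T e n = S'} \<in> sets ?P" for S'
    by (rule Suc.IH) (use Suc.prems in auto)
  have [measurable]: "(\<lambda>e. ?F e i) \<in> borel_measurable ?P" for i
    by (rule cell_energy_measurable) (use Suc.prems in auto)
  have ev: "{e \<in> space ?P. {i \<in> children S'. ?F e i \<le> A} = S} \<in> sets ?P" if "finite S'" for S'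
  proof -
    have "{i \<in> children S'. ?F e i \<le> A} = S \<longleftrightarrow> S \<subseteq> children S' \<and> (\<forall>i\<in>children S'. i \<in> S \<longleftrightarrow> ?F e i \<le> A)" for e
      by auto
    moreover have "{e \<in> space ?P. S \<subseteq> children S' \<and> (\<forall>i\<in>children S'. i \<in> S \<longleftrightarrow> ?F e i \<le> A)} \<in> sets ?P"
      using finite_children[OF that] by measurable
    ultimately show ?thesis by simp
  qed
  have "{e \<in> space ?P. ?T e (Suc n) = S} =
    (\<Union>S'\<in>Pow {k0 * 2 ^ n ..< (k0 + 1) * 2 ^ n}. {e \<in> space ?P. ?T e n = S'} \<inter> {e \<in> space ?P. {i \<in> children S'. ?F e i \<le> A} = S})"
    using slow_tree_subset[of Ks A j0 k0 _ n] by fastforce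
  also have "\<dots> \<in> sets ?P"
    by (intro sets.finite_UN sets.Int IH ev) (auto intro: finite_subset)
  finally show ?case .
qed simp

lemma rho_minus: "rho (- y) = rho y"
  by (simp add: rho_def)

lemma sum_rho_le:
  assumes "finite S"
  shows "(\<Sum>i\<in>S. rho (x - real_of_int i)) \<le> rho_total"
proof -
  have "(\<Sum>i\<in>S. rho (x - real_of_int i)) \<le> (\<Sum>\<^sub>\<infinity>i::int. rho (x - real_of_int i))"
    using finite_sum_le_infsum[of "\<lambda>i::int. rho (x - real_of_int i)" UNIV S]
    by (simp add: assms rho_shift_summable)
  also have "\<dots> \<le> rho_total"
    unfolding rho_total_def by (rule rho_shift_infsum_le)
  finally show ?thesis .
qed

context gaussian_field begin

text \<open>
  The total energy of \<open>S\<close> is \<open>\<Sum>k. v k * phi (\<epsilon> (j, k))\<close>, where \<open>v k\<close> sums the weights of \<open>k\<close> over \<open>S\<close>; here \<open>v k\<close> is at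
  most \<open>rho_total\<close> and the \<open>v k\<close> add up to at most \<open>card S * rho_total\<close>. Hence mean and variance are both
  \<open>O(card S)\<close>. If \<open>A\<close> is large the mean is at most half of the threshold \<open>A * card S / 4\<close>, and Chebyshev's inequality
  gives a bound of order \<open>1 / card S\<close>.
\<close>
lemma energy_large_prob:
  fixes A :: real
  assumes K: "finite K" and S: "finite S" "S \<noteq> {}" and A: "0 < A" "8 * rho_total * phi_mean \<le> A"
  shows "prob {\<omega>\<in>space M. A * card S / 4 \<le> (\<Sum>i\<in>S. cell_energy (\<lambda>p. \<epsilon> p \<omega>) j K i)}
     \<le> 64 * phi_sq_mean * rho_total\<^sup>2 / (A\<^sup>2 * card S)"
proof -
  define v where "v k = (\<Sum>i\<in>S. rho (real_of_int k - real_of_int i))" for k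
  have v: "0 \<le> v k" "v k \<le> rho_total" for k
    using sum_rho_le[OF S(1)] by (auto simp: v_def intro: sum_nonneg)
  have c: "0 < real (card S)" using S by (simp add: card_gt_0_iff)
  have vsum: "(\<Sum>k\<in>K. v k) \<le> real (card S) * rho_total"
  proof -
    have "(\<Sum>k\<in>K. v k) = (\<Sum>i\<in>S. \<Sum>k\<in>K. rho (real_of_int i - real_of_int k))"
    proof -
      have "rho (real_of_int k - real_of_int i) = rho (real_of_int i - real_of_int k)" for k i
        using rho_minus[of "real_of_int i - real_of_int k"] by simp
      then show ?thesis unfolding v_def by (simp only: sum.swap[of _ S K])
    qed
    also have "\<dots> \<le> (\<Sum>i\<in>S. rho_total)" by (intro sum_mono sum_rho_le K)
    finally show ?thesis by simp
  qed
  define X where "X p \<omega> = v (snd p) * (phi (\<epsilon> p \<omega>) - phi_mean)" for p \<omega>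
  let ?I = "{j} \<times> K"
  let ?f = "\<lambda>\<omega>. \<Sum>p\<in>?I. X p \<omega>"
  have row: "sum h ?I = (\<Sum>k\<in>K. h (j, k))" for h :: "int \<times> int \<Rightarrow> real"
  proof -
    have "?I = Pair j ` K" by auto
    then show ?thesis by (simp add: sum.reindex inj_on_def)
  qed
  have Y: "(\<Sum>i\<in>S. cell_energy (\<lambda>p. \<epsilon> p \<omega>) j K i) = ?f \<omega> + phi_mean * (\<Sum>k\<in>K. v k)" for \<omega>
  proof -
    have "(\<Sum>i\<in>S. cell_energy (\<lambda>p. \<epsilon> p \<omega>) j K i) = (\<Sum>k\<in>K. v k * phi (\<epsilon> (j, k) \<omega>))"
      unfolding cell_energy_def v_def by (subst sum.swap) (simp add: sum_distrib_right)
    also have "\<dots> = (\<Sum>k\<in>K. X (j, k) \<omega>) + phi_mean * (\<Sum>k\<in>K. v k)"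
      by (simp add: X_def sum_distrib_left algebra_simps flip: sum.distrib)
    also have "(\<Sum>k\<in>K. X (j, k) \<omega>) = ?f \<omega>"
      by (simp only: row)
    finally show ?thesis .
  qed
  have ind: "indep_vars (\<lambda>_. borel) X ?I"
    unfolding X_def by (rule indep_vars_compose2[OF indep_vars_subset[OF indep]]) auto
  have [measurable]: "X p \<in> borel_measurable M" for p unfolding X_def by measurable
  have sq: "(X p \<omega>)\<^sup>2 = (v (snd p))\<^sup>2 * ((phi (\<epsilon> p \<omega>))\<^sup>2 - 2 * phi_mean * phi (\<epsilon> p \<omega>) + phi_mean\<^sup>2)" for p \<omega>
    by (simp add: X_def power2_eq_square algebra_simps)
  have iX: "integrable M (\<lambda>\<omega>. (X p \<omega>)\<^sup>2)" for p
    unfolding sq using phi_integrable[of p] phi_square_integrable[of p] by simp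
  have eX: "expectation (X p) = 0" for p
    unfolding X_def using phi_integrable[of p] by (simp add: phi_expectation prob_space)
  have eX2: "expectation (\<lambda>\<omega>. (X p \<omega>)\<^sup>2) \<le> rho_total * phi_sq_mean * v (snd p)" for p
  proof -
    have "expectation (\<lambda>\<omega>. (X p \<omega>)\<^sup>2) = (v (snd p))\<^sup>2 * (phi_sq_mean - phi_mean\<^sup>2)"
      unfolding sq using phi_integrable[of p] phi_square_integrable[of p]
      by (simp add: phi_expectation phi_square_expectation prob_space) (simp add: power2_eq_square)
    also have "\<dots> \<le> (v (snd p))\<^sup>2 * phi_sq_mean" by (intro mult_left_mono) auto
    also have "\<dots> = v (snd p) * (v (snd p) * phi_sq_mean)" by (simp add: power2_eq_square)
    also have "\<dots> \<le> rho_total * (v (snd p) * phi_sq_mean)"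
      using v phi_sq_mean_nonneg by (intro mult_right_mono) auto
    finally show ?thesis by (simp only: mult_ac)
  qed
  have var: "integrable M (\<lambda>\<omega>. (?f \<omega>)\<^sup>2)"
    "expectation (\<lambda>\<omega>. (?f \<omega>)\<^sup>2) = (\<Sum>p\<in>?I. expectation (\<lambda>\<omega>. (X p \<omega>)\<^sup>2))"
    using second_moment_indep_sum[OF _ ind iX eX] K by blast+
  let ?a = "A * card S / 8"
  have a: "0 < ?a" using A c by simp
  have "prob {\<omega>\<in>space M. A * card S / 4 \<le> (\<Sum>i\<in>S. cell_energy (\<lambda>p. \<epsilon> p \<omega>) j K i)} \<le> prob {\<omega>\<in>space M. \<bar>?f \<omega>\<bar> \<ge> ?a}"
  proof (rule finite_measure_mono)
    show "{\<omega>\<in>space M. A * card S / 4 \<le> (\<Sum>i\<in>S. cell_energy (\<lambda>p. \<epsilon> p \<omega>) j K i)} \<subseteq> {\<omega>\<in>space M. \<bar>?f \<omega>\<bar> \<ge> ?a}"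
    proof safe
      fix \<omega> assume "A * card S / 4 \<le> (\<Sum>i\<in>S. cell_energy (\<lambda>p. \<epsilon> p \<omega>) j K i)"
      then have l: "A * card S / 4 \<le> ?f \<omega> + phi_mean * (\<Sum>k\<in>K. v k)" unfolding Y .
      have "phi_mean * (\<Sum>k\<in>K. v k) \<le> phi_mean * (real (card S) * rho_total)" by (intro mult_left_mono vsum phi_mean_nonneg)
      also have "\<dots> = (8 * rho_total * phi_mean) * card S / 8" by simp
      also have "\<dots> \<le> A * card S / 8" using A c by (intro divide_right_mono mult_right_mono) auto
      finally show "A * card S / 8 \<le> \<bar>?f \<omega>\<bar>" using l by simp
    qed
  qed measurable
  also have "\<dots> \<le> expectation (\<lambda>\<omega>. (?f \<omega>)\<^sup>2) / ?a\<^sup>2"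
    by (rule second_moment_method[OF _ var(1) a]) measurable
  also have "expectation (\<lambda>\<omega>. (?f \<omega>)\<^sup>2) = (\<Sum>p\<in>?I. expectation (\<lambda>\<omega>. (X p \<omega>)\<^sup>2))"
    by (rule var(2))
  also have "\<dots> \<le> (\<Sum>p\<in>?I. rho_total * phi_sq_mean * v (snd p))"
    by (intro sum_mono eX2)
  also have "\<dots> = rho_total * phi_sq_mean * (\<Sum>k\<in>K. v k)"
    by (simp only: row snd_conv sum_distrib_left)
  also have "\<dots> \<le> rho_total * phi_sq_mean * (real (card S) * rho_total)"
    using rho_total_nonneg phi_sq_mean_nonneg by (intro mult_left_mono vsum) auto
  finally have "prob {\<omega>\<in>space M. A * card S / 4 \<le> (\<Sum>i\<in>S. cell_energy (\<lambda>p. \<epsilon> p \<omega>) j K i)}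
     \<le> rho_total * phi_sq_mean * (real (card S) * rho_total) / ?a\<^sup>2" by (simp add: divide_right_mono)
  also have "\<dots> = 64 * phi_sq_mean * rho_total\<^sup>2 / (A\<^sup>2 * card S)"
  proof -
    have "rho_total * phi_sq_mean * (n * rho_total) / (A * n / 8)\<^sup>2 = 64 * phi_sq_mean * rho_total\<^sup>2 / (A\<^sup>2 * n)"
      if "n \<noteq> 0" for n
      using that A(1) by (simp add: power_mult_distrib power_divide) (simp add: power2_eq_square mult_ac)
    then show ?thesis using c by simp
  qed
  finally show ?thesis .
qed

end

text \<open>
  Fewer than a quarter of the \<open>2 * card S\<close> children can exceed \<open>A\<close> if the energies sum to less than \<open>A\<close> times a quarter
  of their number.
\<close>
lemma many_good_children:
  fixes F :: "int \<Rightarrow> real" and A :: real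
  assumes "finite S" "0 < A" "\<And>i. 0 \<le> F i" "(\<Sum>i\<in>children S. F i) < A * card (children S) / 4"
  shows "3 / 2 * card S \<le> card {i \<in> children S. F i \<le> A}"
proof -
  let ?C = "children S" and ?B = "{i \<in> children S. A < F i}"
  have fin: "finite ?C" using assms by simp
  have "A * card ?B = (\<Sum>i\<in>?B. A)" by simp
  also have "\<dots> \<le> (\<Sum>i\<in>?B. F i)" by (intro sum_mono) auto
  also have "\<dots> \<le> (\<Sum>i\<in>?C. F i)" using fin assms(3) by (intro sum_mono2) auto
  also have "\<dots> < A * (card ?C / 4)" using assms(4) by simp
  finally have "real (card ?B) < card ?C / 4" using assms(2) by (simp only: mult_less_cancel_left_pos)
  moreover have "card ?C = card {i \<in> ?C. F i \<le> A} + card ?B"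
  proof -
    have "card ({i \<in> ?C. F i \<le> A} \<union> ?B) = card {i \<in> ?C. F i \<le> A} + card ?B"
      using fin by (intro card_Un_disjoint) auto
    moreover have "{i \<in> ?C. F i \<le> A} \<union> ?B = ?C" by auto
    ultimately show ?thesis by simp
  qed
  moreover have "real (card ?C) = 2 * card S" using card_children[OF assms(1)] by simp
  ultimately show ?thesis by linarith
qed

section \<open>Survival of the tree\<close>

context gaussian_field begin

abbreviation "tree Ks A j0 k0 \<omega> n \<equiv> slow_tree Ks A j0 k0 (\<lambda>p. \<epsilon> p \<omega>) n"

lemma tree_event: "{\<omega>\<in>space M. tree Ks A j0 k0 \<omega> n = S} \<in> events"
proof -
  let ?P = "PiM UNIV (\<lambda>_. borel :: real measure)"
  have m: "(\<lambda>\<omega> p. \<epsilon> p \<omega>) \<in> measurable M ?P"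
    by (rule measurable_PiM_single') auto
  have "(\<lambda>\<omega> p. \<epsilon> p \<omega>) -` {e \<in> space ?P. slow_tree Ks A j0 k0 e n = S} \<inter> space M \<in> events"
    by (rule measurable_sets[OF m slow_tree_measurable]) simp
  also have "(\<lambda>\<omega> p. \<epsilon> p \<omega>) -` {e \<in> space ?P. slow_tree Ks A j0 k0 e n = S} \<inter> space M = {\<omega>\<in>space M. tree Ks A j0 k0 \<omega> n = S}"
    by (auto simp: space_PiM)
  finally show ?thesis .
qed

lemma tree_card_event: "{\<omega>\<in>space M. Q (tree Ks A j0 k0 \<omega> n) (tree Ks A j0 k0 \<omega> m)} \<in> events"
proof -
  let ?D = "\<lambda>n. Pow {k0 * 2 ^ n ..< (k0 + 1) * 2 ^ n}"
  have "{\<omega>\<in>space M. Q (tree Ks A j0 k0 \<omega> n) (tree Ks A j0 k0 \<omega> m)} =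
     (\<Union>S\<in>?D n. \<Union>S'\<in>{S'\<in>?D m. Q S S'}. {\<omega>\<in>space M. tree Ks A j0 k0 \<omega> n = S} \<inter> {\<omega>\<in>space M. tree Ks A j0 k0 \<omega> m = S'})"
    using slow_tree_subset[of Ks A j0 k0 _ n] slow_tree_subset[of Ks A j0 k0 _ m] by auto
  also have "\<dots> \<in> events"
    by (intro sets.finite_UN sets.Int tree_event) auto
  finally show ?thesis .
qed

text \<open>
  Conditioning on the tree without conditional expectations: the event that generation \<open>n\<close> equals \<open>S\<close> and the
  event that the children of \<open>S\<close> have a large energy depend on disjoint sets of coefficients, so their
  probabilities multiply.
\<close>
lemma tree_step_prob:
  fixes A :: real
  assumes K: "\<And>n. finite (Ks n)" and A: "0 < A" "8 * rho_total * phi_mean \<le> A" and S: "finite S" "S \<noteq> {}"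
  shows "prob {\<omega>\<in>space M. tree Ks A j0 k0 \<omega> n = S \<and> real (card (tree Ks A j0 k0 \<omega> (Suc n))) < 3 / 2 * card S}
     \<le> prob {\<omega>\<in>space M. tree Ks A j0 k0 \<omega> n = S} * (32 * phi_sq_mean * rho_total\<^sup>2 / (A\<^sup>2 * card S))"
proof -
  let ?j = "int (j0 + Suc n)"
  let ?I = "{p :: int \<times> int. fst p \<le> int (j0 + n)}" and ?J = "{?j} \<times> Ks (Suc n)"
  let ?X = "\<lambda>\<omega>. restrict (\<lambda>p. \<epsilon> p \<omega>) ?I" and ?Y = "\<lambda>\<omega>. restrict (\<lambda>p. \<epsilon> p \<omega>) ?J"
  let ?PI = "PiM ?I (\<lambda>_. borel :: real measure)" and ?PJ = "PiM ?J (\<lambda>_. borel :: real measure)"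
  let ?C = "children S"
  let ?E = "\<lambda>e. \<Sum>i\<in>?C. cell_energy e ?j (Ks (Suc n)) i"
  have ind: "indep_var ?PI ?X ?PJ ?Y"
    by (rule indep_var_restrict[OF indep]) auto
  let ?U = "{e \<in> space ?PI. slow_tree Ks A j0 k0 e n = S}"
  let ?V = "{e \<in> space ?PJ. A * card ?C / 4 \<le> ?E e}"
  have U: "?U \<in> sets ?PI" by (rule slow_tree_measurable) simp
  have [measurable]: "(\<lambda>e. cell_energy e ?j (Ks (Suc n)) i) \<in> borel_measurable ?PJ" for i
    by (rule cell_energy_measurable) simp
  have V: "?V \<in> sets ?PJ" by measurable
  have treeX: "slow_tree Ks A j0 k0 (?X \<omega>) n = tree Ks A j0 k0 \<omega> n" for \<omega>
    by (rule slow_tree_cong) simp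
  have eY: "?E (?Y \<omega>) = ?E (\<lambda>p. \<epsilon> p \<omega>)" for \<omega>
    unfolding cell_energy_def by (intro sum.cong) auto
  have XU: "?X -` ?U \<inter> space M = {\<omega>\<in>space M. tree Ks A j0 k0 \<omega> n = S}"
    using treeX by (auto simp: space_PiM)
  have YV: "?Y -` ?V \<inter> space M = {\<omega>\<in>space M. A * card ?C / 4 \<le> ?E (\<lambda>p. \<epsilon> p \<omega>)}"
    using eY by (auto simp: space_PiM)
  have XYV: "(\<lambda>\<omega>. (?X \<omega>, ?Y \<omega>)) -` (?U \<times> ?V) \<inter> space M = (?X -` ?U \<inter> space M) \<inter> (?Y -` ?V \<inter> space M)"
    by auto
  have sub: "{\<omega>\<in>space M. tree Ks A j0 k0 \<omega> n = S \<and> real (card (tree Ks A j0 k0 \<omega> (Suc n))) < 3 / 2 * card S}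
     \<subseteq> (\<lambda>\<omega>. (?X \<omega>, ?Y \<omega>)) -` (?U \<times> ?V) \<inter> space M"
  proof (rule subsetI)
    fix \<omega> assume w: "\<omega> \<in> {\<omega>\<in>space M. tree Ks A j0 k0 \<omega> n = S \<and> real (card (tree Ks A j0 k0 \<omega> (Suc n))) < 3 / 2 * card S}"
    then have "\<not> 3 / 2 * card S \<le> card {i \<in> ?C. cell_energy (\<lambda>p. \<epsilon> p \<omega>) ?j (Ks (Suc n)) i \<le> A}"
      by auto
    then have "\<not> ?E (\<lambda>p. \<epsilon> p \<omega>) < A * card ?C / 4"
      using many_good_children[OF S(1) A(1), of "cell_energy (\<lambda>p. \<epsilon> p \<omega>) ?j (Ks (Suc n))"] cell_energy_nonneg by blast
    then show "\<omega> \<in> (\<lambda>\<omega>. (?X \<omega>, ?Y \<omega>)) -` (?U \<times> ?V) \<inter> space M"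
      unfolding XYV XU YV using w by auto
  qed
  have rvX: "?X \<in> measurable M ?PI" and rvY: "?Y \<in> measurable M ?PJ"
    by (intro measurable_restrict; simp)+
  have "prob {\<omega>\<in>space M. tree Ks A j0 k0 \<omega> n = S \<and> real (card (tree Ks A j0 k0 \<omega> (Suc n))) < 3 / 2 * card S}
     \<le> prob ((\<lambda>\<omega>. (?X \<omega>, ?Y \<omega>)) -` (?U \<times> ?V) \<inter> space M)"
    unfolding XYV
    by (rule finite_measure_mono[OF sub[unfolded XYV]]) (intro sets.Int measurable_sets[OF rvX U] measurable_sets[OF rvY V])
  also have "\<dots> = prob {\<omega>\<in>space M. tree Ks A j0 k0 \<omega> n = S} * prob {\<omega>\<in>space M. A * card ?C / 4 \<le> ?E (\<lambda>p. \<epsilon> p \<omega>)}"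
    using indep_varD[OF ind U V] unfolding XU YV .
  also have "\<dots> \<le> prob {\<omega>\<in>space M. tree Ks A j0 k0 \<omega> n = S} * (64 * phi_sq_mean * rho_total\<^sup>2 / (A\<^sup>2 * card ?C))"
  proof (intro mult_left_mono energy_large_prob K A)
    show "?C \<noteq> {}" using S by (auto simp: children_def)
  qed (use S in auto)
  also have "64 * phi_sq_mean * rho_total\<^sup>2 / (A\<^sup>2 * card ?C) = 32 * phi_sq_mean * rho_total\<^sup>2 / (A\<^sup>2 * card S)"
    using card_children[OF S(1)] by (simp add: mult_ac)
  finally show ?thesis .
qed

text \<open>
  The event that the population keeps pace with \<open>(3/2)\<^sup>n\<close> in generation \<open>n\<close> but falls behind in the next one. As it
  keeps pace in generation \<open>0\<close>, it never falls behind when no thinning occurs.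
\<close>
definition thinning :: "(nat \<Rightarrow> int set) \<Rightarrow> real \<Rightarrow> nat \<Rightarrow> int \<Rightarrow> nat \<Rightarrow> 'w set" where
  "thinning Ks A j0 k0 n = {\<omega>\<in>space M. (3 / 2) ^ n \<le> real (card (tree Ks A j0 k0 \<omega> n)) \<and>
     real (card (tree Ks A j0 k0 \<omega> (Suc n))) < (3 / 2) ^ Suc n}"

lemma thinning_event [measurable]: "thinning Ks A j0 k0 n \<in> events"
  unfolding thinning_def
  using tree_card_event[of "\<lambda>T T'. (3 / 2) ^ n \<le> real (card T) \<and> real (card T') < (3 / 2) ^ Suc n" Ks A j0 k0 n "Suc n"] .

lemma thinning_prob:
  assumes K: "\<And>n. finite (Ks n)" and A: "0 < A" "8 * rho_total * phi_mean \<le> A"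
  shows "prob (thinning Ks A j0 k0 n) \<le> 32 * phi_sq_mean * rho_total\<^sup>2 / A\<^sup>2 * (2 / 3) ^ n"
proof -
  let ?D = "{S \<in> Pow {k0 * 2 ^ n ..< (k0 + 1) * 2 ^ n}. (3 / 2) ^ n \<le> real (card S)}"
  let ?c = "32 * phi_sq_mean * rho_total\<^sup>2 / A\<^sup>2 * (2 / 3) ^ n"
  have c0: "0 \<le> ?c" using phi_sq_mean_nonneg by simp
  have fin: "finite ?D" by simp
  let ?T = "\<lambda>S. {\<omega>\<in>space M. tree Ks A j0 k0 \<omega> n = S}"
  let ?B = "\<lambda>S. {\<omega>\<in>space M. tree Ks A j0 k0 \<omega> n = S \<and> real (card (tree Ks A j0 k0 \<omega> (Suc n))) < 3 / 2 * card S}"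
  have B: "?B S \<in> events" for S
    using tree_card_event[of "\<lambda>T T'. T = S \<and> real (card T') < 3 / 2 * card S" Ks A j0 k0 n "Suc n"] .
  have "thinning Ks A j0 k0 n \<subseteq> (\<Union>S\<in>?D. ?B S)"
  proof
    fix \<omega> assume w: "\<omega> \<in> thinning Ks A j0 k0 n"
    then have "real (card (tree Ks A j0 k0 \<omega> (Suc n))) < 3 / 2 * real (card (tree Ks A j0 k0 \<omega> n))"
      unfolding thinning_def by auto
    then show "\<omega> \<in> (\<Union>S\<in>?D. ?B S)"
      using w slow_tree_subset[of Ks A j0 k0 "\<lambda>p. \<epsilon> p \<omega>" n] unfolding thinning_def by auto
  qed
  then have "prob (thinning Ks A j0 k0 n) \<le> prob (\<Union>S\<in>?D. ?B S)"
    by (intro finite_measure_mono sets.finite_UN fin B)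
  also have "\<dots> \<le> (\<Sum>S\<in>?D. prob (?B S))"
    by (intro measure_UNION_le fin B)
  also have "\<dots> \<le> (\<Sum>S\<in>?D. prob (?T S) * ?c)"
  proof (rule sum_mono)
    fix S assume S: "S \<in> ?D"
    then have fS: "finite S" by (auto intro: finite_subset)
    have p: "(0::real) < (3 / 2) ^ n" by simp
    have n: "(3 / 2) ^ n \<le> real (card S)" using S by simp
    have "real (card S) > 0" using p n by linarith
    then have ne: "S \<noteq> {}" by auto
    have "32 * phi_sq_mean * rho_total\<^sup>2 / (A\<^sup>2 * card S) \<le> 32 * phi_sq_mean * rho_total\<^sup>2 / (A\<^sup>2 * (3 / 2) ^ n)"
      using n p \<open>real (card S) > 0\<close> A(1) phi_sq_mean_nonneg
      by (intro divide_left_mono mult_left_mono mult_pos_pos zero_less_power) simp_all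
    also have "\<dots> = ?c" by (simp add: power_divide)
    finally have "prob (?T S) * (32 * phi_sq_mean * rho_total\<^sup>2 / (A\<^sup>2 * card S)) \<le> prob (?T S) * ?c"
      by (intro mult_left_mono) auto
    then show "prob (?B S) \<le> prob (?T S) * ?c"
      using tree_step_prob[of Ks, OF K A fS ne, of j0 k0 n] by linarith
  qed
  also have "\<dots> = (\<Sum>S\<in>?D. prob (?T S)) * ?c" by (simp only: sum_distrib_right)
  also have "(\<Sum>S\<in>?D. prob (?T S)) = prob (\<Union>S\<in>?D. ?T S)"
    by (rule finite_measure_finite_Union[symmetric, OF fin]) (auto simp: tree_event disjoint_family_on_def)
  also have "\<dots> * ?c \<le> 1 * ?c" by (intro mult_right_mono c0) simp
  finally show ?thesis by simp
qed

text \<open>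
  For each \<open>A\<close> the probability that some thinning occurs is \<open>O(A\<^sup>-\<^sup>2)\<close>, as the geometric factors \<open>(2/3)\<^sup>n\<close> are summable.
  Hence it is a null event that thinning occurs for every natural number \<open>A\<close>.
\<close>
proposition AE_slow_tree_infinite:
  assumes K: "\<And>n. finite (Ks n)"
  shows "AE \<omega> in M. \<exists>A. \<forall>n. tree Ks A j0 k0 \<omega> n \<noteq> {}"
proof -
  let ?th = "\<lambda>N n. thinning Ks (real N) j0 k0 n"
  let ?N = "\<Inter>N\<in>UNIV. \<Union>n. ?th N n"
  have ev: "?N \<in> events" by (intro sets.countable_INT sets.countable_UN) auto
  let ?c = "32 * phi_sq_mean * rho_total\<^sup>2"
  have bound: "prob ?N \<le> 3 * ?c / (real N)\<^sup>2" if N: "0 < N" "8 * rho_total * phi_mean \<le> real N" for N :: nat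
  proof -
    have le: "prob (?th N n) \<le> ?c / (real N)\<^sup>2 * (2 / 3) ^ n" for n
      using thinning_prob[OF K, of "real N"] N by simp
    have g: "(\<lambda>n. ?c / (real N)\<^sup>2 * (2 / 3) ^ n) sums (?c / (real N)\<^sup>2 * 3)"
    proof (rule sums_mult)
      show "(\<lambda>n. (2 / 3) ^ n) sums (3::real)" using geometric_sums[of "2/3 :: real"] by simp
    qed
    have s: "summable (\<lambda>n. prob (?th N n))"
      by (rule summable_comparison_test'[OF sums_summable[OF g], of 0]) (use le in auto)
    have "prob ?N \<le> prob (\<Union>n. ?th N n)"
      by (intro finite_measure_mono INF_lower sets.countable_UN) auto
    also have "\<dots> \<le> (\<Sum>n. prob (?th N n))"
      by (rule finite_measure_subadditive_countably[OF _ s]) auto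
    also have "\<dots> \<le> (\<Sum>n. ?c / (real N)\<^sup>2 * (2 / 3) ^ n)"
      by (rule suminf_le[OF le s sums_summable[OF g]])
    also have "\<dots> = ?c / (real N)\<^sup>2 * 3" by (rule sums_unique[OF g, symmetric])
    finally show ?thesis by simp
  qed
  have "(\<lambda>N. 3 * ?c / (real N)\<^sup>2) \<longlonglongrightarrow> 0"
    by (intro tendsto_divide_0[OF tendsto_const] filterlim_at_top_imp_at_infinity
        filterlim_pow_at_top filterlim_real_sequentially) simp
  moreover have "eventually (\<lambda>N. prob ?N \<le> 3 * ?c / (real N)\<^sup>2) sequentially"
  proof -
    have "eventually (\<lambda>N. 8 * rho_total * phi_mean \<le> real N) sequentially"
      using filterlim_real_sequentially unfolding filterlim_at_top by blast
    then show ?thesis using eventually_gt_at_top[of 0]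
      by eventually_elim (use bound in auto)
  qed
  ultimately have "prob ?N \<le> 0"
    by (rule tendsto_lowerbound) simp
  then have "prob ?N = 0" by (simp add: measure_le_0_iff)
  then have "?N \<in> null_sets M" using ev by (simp add: null_sets_def emeasure_eq_measure)
  from AE_not_in[OF this] show ?thesis
  proof (rule AE_mp, intro AE_I2 impI)
    fix \<omega> assume w: "\<omega> \<in> space M" "\<omega> \<notin> ?N"
    then obtain N where N: "\<And>n. \<omega> \<notin> ?th N n" by auto
    have "(3 / 2) ^ n \<le> real (card (tree Ks (real N) j0 k0 \<omega> n))" for n
    proof (induction n)
      case (Suc n)
      then show ?case using N[of n] w(1) unfolding thinning_def by auto
    qed simp
    moreover have "(0::real) < (3 / 2) ^ n" for n :: nat by simp
    ultimately have "tree Ks (real N) j0 k0 \<omega> n \<noteq> {}" for n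
      by (metis card.empty leD of_nat_0)
    then show "\<exists>A. \<forall>n. tree Ks A j0 k0 \<omega> n \<noteq> {}" by blast
  qed
qed

end

section \<open>Slow points from surviving trees\<close>

text \<open>
  All indices \<open>k\<close> whose node at level \<open>j0 + n\<close> lies in \<open>[-|k0| - 2, |k0| + 2]\<close>. Points of the initial interval have
  absolute value at most \<open>|k0| + 1\<close>, so an index outside the window is at distance \<open>u \<ge> 2\<^sup>j\<close> from each of them.
\<close>
definition window :: "nat \<Rightarrow> int \<Rightarrow> nat \<Rightarrow> int set" where
  "window j0 k0 n = {k. \<bar>k\<bar> \<le> (\<bar>k0\<bar> + 2) * 2 ^ (j0 + n)}"

lemma finite_window [simp]: "finite (window j0 k0 n)"
proof (rule finite_subset)
  show "window j0 k0 n \<subseteq> {- ((\<bar>k0\<bar> + 2) * 2 ^ (j0 + n)) .. (\<bar>k0\<bar> + 2) * 2 ^ (j0 + n)}"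
    by (auto simp: window_def)
qed simp

text \<open>
  Take an accumulation point \<open>t\<close> of the surviving intervals. An index in the window obeys the energy bound of
  an ancestor of each late interval, and the bound passes to the limit because it is continuous in the
  position. For an index outside the window, and for the finitely many levels up to \<open>j0\<close>, the global growth bound
  is already of the desired form: outside the window \<open>u \<ge> 2\<^sup>j\<close>, so
  \<open>1 + u\<close> dominates both \<open>1 + j\<close> and, up to a constant, \<open>1 + |k|\<close>.
\<close>
proposition slow_point_of_tree:
  assumes G: "\<And>j k. phi (e (j, k)) \<le> C0 * ((1 + \<bar>real_of_int j\<bar>) * (1 + \<bar>real_of_int k\<bar>))\<^sup>2"
    and tree: "\<And>n. slow_tree (window j0 k0) A j0 k0 e n \<noteq> {}"
  shows "\<exists>t\<in>{real_of_int k0 / 2 ^ j0 .. (real_of_int k0 + 1) / 2 ^ j0}. \<exists>C. \<forall>j k. 0 \<le> j \<longrightarrow>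
     phi (e (j, k)) \<le> C * (1 + \<bar>2 powi j * t - real_of_int k\<bar>) ^ 4"
proof -
  let ?I = "{real_of_int k0 / 2 ^ j0 .. (real_of_int k0 + 1) / 2 ^ j0}"
  define i where "i n = (SOME a. a \<in> slow_tree (window j0 k0) A j0 k0 e n)" for n
  have i: "i n \<in> slow_tree (window j0 k0) A j0 k0 e n" for n
    using tree[of n] unfolding i_def by (simp only: some_in_eq) simp
  define x where "x n = real_of_int (i n) / 2 ^ (j0 + n)" for n
  have xI: "x n \<in> ?I" for n
  proof -
    have "k0 * 2 ^ n \<le> i n" "i n \<le> (k0 + 1) * 2 ^ n"
      using i[of n] slow_tree_subset[of "window j0 k0" A j0 k0 e n] by fastforce+
    then have "real_of_int (k0 * 2 ^ n) \<le> real_of_int (i n)" "real_of_int (i n) \<le> real_of_int ((k0 + 1) * 2 ^ n)"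
      by (simp_all only: of_int_le_iff)
    then show ?thesis by (simp add: x_def power_add field_simps)
  qed
  have "seq_compact ?I" by (simp add: compact_imp_seq_compact)
  then obtain t r where t: "t \<in> ?I" and r: "strict_mono r" and lim: "(x \<circ> r) \<longlonglongrightarrow> t"
    using seq_compactE[of ?I x] xI by blast
  have near: "0 \<le> A \<and> phi (e (int (j0 + m), k)) \<le> A * (2 + \<bar>2 ^ (j0 + m) * t - real_of_int k\<bar>)\<^sup>2"
    if m: "1 \<le> m" and k: "k \<in> window j0 k0 m" for m k
  proof -
    have at: "0 \<le> A \<and> phi (e (int (j0 + m), k)) \<le> A * (2 + \<bar>2 ^ (j0 + m) * x n - real_of_int k\<bar>)\<^sup>2"
      if n: "m \<le> n" for n
    proof -
      obtain d where d: "n = m + d" using n le_Suc_ex by blast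
      define a where "a = i n div 2 ^ d"
      obtain m' where m': "m = Suc m'" using m by (cases m) auto
      have "a \<in> slow_tree (window j0 k0) A j0 k0 e m"
        using slow_tree_ancestor[of "i n" "window j0 k0" A j0 k0 e m d] i[of n] unfolding d a_def by simp
      then have E: "cell_energy e (int (j0 + m)) (window j0 k0 m) a \<le> A" unfolding m' by simp
      have "rho (real_of_int (k - a)) * phi (e (int (j0 + m), k)) \<le> cell_energy e (int (j0 + m)) (window j0 k0 m) a"
        unfolding cell_energy_def by (rule member_le_sum[OF k]) auto
      then have le: "rho (real_of_int (k - a)) * phi (e (int (j0 + m), k)) \<le> A" using E by linarith
      have "0 \<le> rho (real_of_int (k - a)) * phi (e (int (j0 + m), k))" by simp
      then have A0: "0 \<le> A" using le by linarith
      have pos: "(1 + \<bar>real_of_int (k - a)\<bar>)\<^sup>2 > 0" by (intro zero_less_power) linarith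
      have p: "phi (e (int (j0 + m), k)) \<le> A * (1 + \<bar>real_of_int (k - a)\<bar>)\<^sup>2"
        using le pos unfolding rho_def by (simp add: pos_divide_le_eq)
      have "2 ^ (j0 + m) * x n = real_of_int (i n) / 2 ^ d"
        unfolding x_def d by (simp add: power_add)
      moreover have "a = \<lfloor>real_of_int (i n) / 2 ^ d\<rfloor>"
        using floor_divide_of_int_eq[of "i n" "2 ^ d", where ?'a=real] unfolding a_def by simp
      ultimately have "\<bar>2 ^ (j0 + m) * x n - real_of_int a\<bar> \<le> 1"
        using of_int_floor_le[of "real_of_int (i n) / 2 ^ d"] real_of_int_floor_add_one_gt[of "real_of_int (i n) / 2 ^ d"]
        by linarith
      then have "1 + \<bar>real_of_int (k - a)\<bar> \<le> 2 + \<bar>2 ^ (j0 + m) * x n - real_of_int k\<bar>"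
        unfolding of_int_diff by linarith
      then have "(1 + \<bar>real_of_int (k - a)\<bar>)\<^sup>2 \<le> (2 + \<bar>2 ^ (j0 + m) * x n - real_of_int k\<bar>)\<^sup>2"
        by (intro power_mono) auto
      from mult_left_mono[OF this A0] show ?thesis using p A0 by linarith
    qed
    have "(\<lambda>n. A * (2 + \<bar>2 ^ (j0 + m) * x (r n) - real_of_int k\<bar>)\<^sup>2) \<longlonglongrightarrow> A * (2 + \<bar>2 ^ (j0 + m) * t - real_of_int k\<bar>)\<^sup>2"
      by (intro tendsto_mult tendsto_const tendsto_power tendsto_add tendsto_rabs tendsto_diff lim[unfolded o_def])
    moreover have "eventually (\<lambda>n. phi (e (int (j0 + m), k)) \<le> A * (2 + \<bar>2 ^ (j0 + m) * x (r n) - real_of_int k\<bar>)\<^sup>2) sequentially"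
      using eventually_ge_at_top[of m]
    proof eventually_elim
      case (elim n)
      then have "m \<le> r n" using seq_suble[OF r, of n] by linarith
      then show ?case using at by blast
    qed
    ultimately have "phi (e (int (j0 + m), k)) \<le> A * (2 + \<bar>2 ^ (j0 + m) * t - real_of_int k\<bar>)\<^sup>2"
      by (rule tendsto_lowerbound) simp
    then show ?thesis using at[of m] by simp
  qed
  define q where "q = \<bar>real_of_int k0\<bar> + 1"
  have tq: "\<bar>t\<bar> \<le> q"
  proof -
    have p: "(1::real) \<le> 2 ^ j0" by simp
    have "\<bar>real_of_int k0 / 2 ^ j0\<bar> \<le> \<bar>real_of_int k0\<bar>"
      using divide_left_mono[OF p, of "\<bar>real_of_int k0\<bar>"] by (simp add: abs_divide)
    moreover have "\<bar>(real_of_int k0 + 1) / 2 ^ j0\<bar> \<le> \<bar>real_of_int k0 + 1\<bar>"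
      using divide_left_mono[OF p, of "\<bar>real_of_int k0 + 1\<bar>"] by (simp add: abs_divide)
    ultimately show ?thesis using t unfolding q_def atLeastAtMost_iff abs_le_iff by linarith
  qed
  have q1: "1 \<le> q" by (simp add: q_def)
  define B where "B = max C0 0"
  have B: "0 \<le> B" by (simp add: B_def)
  have G': "phi (e (j, k)) \<le> B * ((1 + \<bar>real_of_int j\<bar>) * (1 + \<bar>real_of_int k\<bar>))\<^sup>2" for j k
    using G[of j k] mult_right_mono[of C0 B "((1 + \<bar>real_of_int j\<bar>) * (1 + \<bar>real_of_int k\<bar>))\<^sup>2"]
    by (simp add: B_def)
  define C where "C = B * ((1 + real j0) * (1 + 2 ^ j0 * q))\<^sup>2 + 4 * \<bar>A\<bar> + B * (1 + q)\<^sup>2"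
  have part: "0 \<le> B * ((1 + real j0) * (1 + 2 ^ j0 * q))\<^sup>2" "0 \<le> 4 * \<bar>A\<bar>" "0 \<le> B * (1 + q)\<^sup>2"
    using B by auto
  have "phi (e (j, k)) \<le> C * (1 + \<bar>2 powi j * t - real_of_int k\<bar>) ^ 4" if "0 \<le> j" for j k
  proof -
    define J where "J = nat j"
    have j: "j = int J" using that by (simp add: J_def)
    have pj: "2 powi j = (2::real) ^ J" unfolding j by (rule power_int_of_nat)
    define u where "u = 1 + \<bar>2 ^ J * t - real_of_int k\<bar>"
    have u1: "1 \<le> u" by (simp add: u_def)
    have u24: "u\<^sup>2 \<le> u ^ 4" using u1 by (intro power_increasing) auto
    have Jt: "\<bar>2 ^ J * t\<bar> \<le> 2 ^ J * q" using tq by (simp add: abs_mult)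
    consider "J \<le> j0" | "j0 < J" "k \<in> window j0 k0 (J - j0)" | "j0 < J" "k \<notin> window j0 k0 (J - j0)" by linarith
    then have "\<exists>c. c \<le> C \<and> phi (e (j, k)) \<le> c * u ^ 4"
    proof cases
      case 1
      have "1 + \<bar>real_of_int k\<bar> \<le> (1 + \<bar>2 ^ J * t\<bar>) * u"
        using one_plus_abs_le_mult[of "real_of_int k" "2 ^ J * t"] by (simp add: u_def)
      also have "\<dots> \<le> (1 + 2 ^ j0 * q) * u"
      proof (rule mult_right_mono)
        have "2 ^ J * q \<le> 2 ^ j0 * q" using 1 q1 by (intro mult_right_mono power_increasing) auto
        then show "1 + \<bar>2 ^ J * t\<bar> \<le> 1 + 2 ^ j0 * q" using Jt by linarith
      qed (use u1 in auto)
      finally have k: "1 + \<bar>real_of_int k\<bar> \<le> (1 + 2 ^ j0 * q) * u" .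
      have "(1 + \<bar>real_of_int j\<bar>) * (1 + \<bar>real_of_int k\<bar>) \<le> (1 + real j0) * ((1 + 2 ^ j0 * q) * u)"
        using 1 k by (intro mult_mono) (auto simp: j)
      then have "((1 + \<bar>real_of_int j\<bar>) * (1 + \<bar>real_of_int k\<bar>))\<^sup>2 \<le> ((1 + real j0) * ((1 + 2 ^ j0 * q) * u))\<^sup>2"
        by (intro power_mono) auto
      also have "\<dots> = ((1 + real j0) * (1 + 2 ^ j0 * q))\<^sup>2 * u\<^sup>2"
        by (simp only: power_mult_distrib mult.assoc)
      also have "\<dots> \<le> ((1 + real j0) * (1 + 2 ^ j0 * q))\<^sup>2 * u ^ 4"
        by (intro mult_left_mono u24) auto
      finally have "B * ((1 + \<bar>real_of_int j\<bar>) * (1 + \<bar>real_of_int k\<bar>))\<^sup>2 \<le> B * (((1 + real j0) * (1 + 2 ^ j0 * q))\<^sup>2 * u ^ 4)"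
        by (intro mult_left_mono B)
      then have "phi (e (j, k)) \<le> B * ((1 + real j0) * (1 + 2 ^ j0 * q))\<^sup>2 * u ^ 4"
        using G'[of j k] by (simp only: mult.assoc)
      then show ?thesis using part unfolding C_def
        by (intro exI[of _ "B * ((1 + real j0) * (1 + 2 ^ j0 * q))\<^sup>2"]) linarith
    next
      case 2
      define m where "m = J - j0"
      have m: "1 \<le> m" "J = j0 + m" using 2 by (auto simp: m_def)
      have "phi (e (j, k)) \<le> A * (2 + \<bar>2 ^ J * t - real_of_int k\<bar>)\<^sup>2" and A: "0 \<le> A"
        using near[OF m(1), of k] 2(2) unfolding m_def[symmetric] j m(2) by auto
      moreover have "(2 + \<bar>2 ^ J * t - real_of_int k\<bar>)\<^sup>2 \<le> (2 * u)\<^sup>2"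
        by (intro power_mono) (auto simp: u_def)
      moreover have "(2 * u)\<^sup>2 \<le> 4 * u ^ 4" using u24 by (simp add: power_mult_distrib)
      ultimately have "phi (e (j, k)) \<le> A * (4 * u ^ 4)"
        using mult_left_mono[OF _ A, of "(2 + \<bar>2 ^ J * t - real_of_int k\<bar>)\<^sup>2" "4 * u ^ 4"] by linarith
      then show ?thesis using part A unfolding C_def
        by (intro exI[of _ "4 * \<bar>A\<bar>"]) simp
    next
      case 3
      have "(\<bar>k0\<bar> + 2) * 2 ^ J < \<bar>k\<bar>" using 3 by (simp add: window_def not_le)
      then have "real_of_int ((\<bar>k0\<bar> + 2) * 2 ^ J) < real_of_int \<bar>k\<bar>" by (simp only: of_int_less_iff)
      then have "2 ^ J * q + 2 ^ J < \<bar>real_of_int k\<bar>" by (simp add: q_def algebra_simps)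
      then have uJ: "2 ^ J \<le> u" using Jt unfolding u_def by linarith
      have "1 + real J \<le> 2 ^ J" using less_exp[of J] by (metis Suc_leI of_nat_Suc of_nat_le_iff of_nat_numeral of_nat_power add.commute)
      then have ju: "1 + \<bar>real_of_int j\<bar> \<le> u" using uJ by (simp add: j)
      have "\<bar>real_of_int k\<bar> \<le> 2 ^ J * q + (u - 1)" using Jt unfolding u_def by linarith
      moreover have "2 ^ J * q \<le> u * q" using uJ q1 by (intro mult_right_mono) auto
      ultimately have ku: "1 + \<bar>real_of_int k\<bar> \<le> (1 + q) * u" by (simp add: algebra_simps)
      have "(1 + \<bar>real_of_int j\<bar>) * (1 + \<bar>real_of_int k\<bar>) \<le> u * ((1 + q) * u)"
        using ju ku u1 by (intro mult_mono) auto
      then have "((1 + \<bar>real_of_int j\<bar>) * (1 + \<bar>real_of_int k\<bar>))\<^sup>2 \<le> (u * ((1 + q) * u))\<^sup>2"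
        by (intro power_mono) auto
      also have "\<dots> = (1 + q)\<^sup>2 * u ^ 4" by (simp add: power_mult_distrib mult_ac flip: power_add)
      finally have "B * ((1 + \<bar>real_of_int j\<bar>) * (1 + \<bar>real_of_int k\<bar>))\<^sup>2 \<le> B * ((1 + q)\<^sup>2 * u ^ 4)"
        by (intro mult_left_mono B)
      then have "phi (e (j, k)) \<le> B * (1 + q)\<^sup>2 * u ^ 4"
        using G'[of j k] by (simp only: mult.assoc)
      then show ?thesis using part unfolding C_def
        by (intro exI[of _ "B * (1 + q)\<^sup>2"]) linarith
    qed
    then obtain c where c: "c \<le> C" "phi (e (j, k)) \<le> c * u ^ 4" by blast
    have "c * u ^ 4 \<le> C * u ^ 4" using c(1) u1 by (intro mult_right_mono) auto
    then show ?thesis using c(2) unfolding pj u_def by linarith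
  qed
  then show ?thesis using t by blast
qed

section \<open>Points of given regularity\<close>

lemma ln_2_ge_half: "1 / 2 \<le> ln (2::real)"
  using ln_2_less_1 ln2_ge_two_thirds by linarith

lemma dyadic_scale_exists:
  assumes "0 < h" "h \<le> 1"
  obtains N :: int where "0 \<le> N" "2 powr (- (real_of_int N + 1)) < h" "h \<le> 2 powr (- real_of_int N)"
    "real_of_int N \<le> 2 * ln (inverse h)"
proof
  define N where "N = \<lfloor>- log 2 h\<rfloor>"
  have l: "log 2 h \<le> 0" using assms by simp
  show "0 \<le> N" using l by (simp add: N_def)
  have h: "h = 2 powr (log 2 h)" using assms by simp
  have "- (real_of_int N + 1) < log 2 h" unfolding N_def by linarith
  then have "2 powr (- (real_of_int N + 1)) < 2 powr (log 2 h)" by (intro powr_less_mono) auto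
  then show "2 powr (- (real_of_int N + 1)) < h" using h by simp
  have N: "real_of_int N \<le> - log 2 h" unfolding N_def by linarith
  then have "2 powr (log 2 h) \<le> 2 powr (- real_of_int N)" by (intro powr_mono) auto
  then show "h \<le> 2 powr (- real_of_int N)" using h by simp
  have "- log 2 h = ln (inverse h) / ln 2" using assms by (simp add: log_def ln_inverse)
  also have "\<dots> \<le> ln (inverse h) / (1 / 2)"
    using assms ln_2_ge_half by (intro divide_left_mono) (auto simp: ln_inverse)
  finally show "real_of_int N \<le> 2 * ln (inverse h)" using N by simp
qed

lemma sqrt_ln_slow:
  fixes j N :: int
  assumes "0 \<le> j" "0 \<le> N"
  shows "1 \<le> sqrt (ln (3 + real_of_int j))"
    and "sqrt (ln (3 + real_of_int j)) \<le> sqrt (ln (3 + real_of_int N)) * (1 + \<bar>real_of_int (j - N)\<bar>)"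
proof -
  have e: "exp 1 \<le> (3::real)" by (rule exp_le)
  have one: "1 \<le> ln (3 + real_of_int i)" if "0 \<le> i" for i
    using e that by (subst ln_ge_iff) auto
  show "1 \<le> sqrt (ln (3 + real_of_int j))" using one[OF assms(1)] by simp
  define m where "m = \<bar>real_of_int (j - N)\<bar>"
  have m0: "0 \<le> m" by (simp add: m_def)
  let ?L = "ln (3 + real_of_int N)"
  have L: "1 \<le> ?L" by (rule one[OF assms(2)])
  have "real_of_int N * m \<ge> 0" using assms m0 by simp
  moreover have "real_of_int j \<le> real_of_int N + m" unfolding m_def by linarith
  ultimately have "3 + real_of_int j \<le> (3 + real_of_int N) * (1 + m)"
    using m0 by (simp add: algebra_simps)
  then have "ln (3 + real_of_int j) \<le> ln ((3 + real_of_int N) * (1 + m))"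
    using assms by (intro ln_mono) auto
  also have "\<dots> = ?L + ln (1 + m)" using assms m0 by (simp add: ln_mult)
  also have "\<dots> \<le> ?L * 1 + ?L * m"
    using ln_add_one_self_le_self[OF m0] mult_right_mono[OF L m0] by simp
  also have "\<dots> \<le> ?L * (1 + m)\<^sup>2"
  proof -
    have "1 + m \<le> (1 + m)\<^sup>2" using m0 by (intro self_le_power) auto
    then show ?thesis using L mult_left_mono[of "1 + m" "(1 + m)\<^sup>2" ?L] by (simp add: distrib_left)
  qed
  finally have "sqrt (ln (3 + real_of_int j)) \<le> sqrt (?L * (1 + m)\<^sup>2)" by (rule real_sqrt_le_mono)
  also have "\<dots> = sqrt ?L * (1 + m)" using m0 by (simp add: real_sqrt_mult)
  finally show "sqrt (ln (3 + real_of_int j)) \<le> sqrt ?L * (1 + \<bar>real_of_int (j - N)\<bar>)" by (simp add: m_def)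
qed

lemma Limsup_finite_of_eventually_le:
  assumes "\<forall>\<^sub>F s in F. f s \<le> K"
  shows "Limsup F (\<lambda>s. ereal (f s)) < \<infinity>"
proof -
  have "Limsup F (\<lambda>s. ereal (f s)) \<le> ereal K"
    by (rule Limsup_bounded) (use assms in simp)
  then show ?thesis by (rule order.strict_trans1) simp
qed

lemma eventually_at_dist_lt:
  fixes t :: real
  assumes "0 < d" "\<And>s. 0 < \<bar>s - t\<bar> \<Longrightarrow> \<bar>s - t\<bar> < d \<Longrightarrow> Q s"
  shows "\<forall>\<^sub>F s in at t. Q s"
  using assms unfolding eventually_at by (auto simp: dist_real_def)

context wavelet_series begin

text \<open>
  The case \<open>g = 1\<close> of the local modulus. The second limit is finite because its denominator is the larger one as soon
  as \<open>|s - t| \<le> exp (-1)\<close>.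
\<close>
lemma slow_point_Limsup:
  assumes H: "\<exists>R c. 0 < R \<and> R < 1 \<and> 0 < c \<and>
           (\<forall>s. 0 < \<bar>s - t\<bar> \<and> \<bar>s - t\<bar> \<le> R \<longrightarrow> \<bar>H s - H t\<bar> \<le> c / ln (inverse \<bar>s - t\<bar>))"
    and e: "\<And>j k. 0 \<le> j \<Longrightarrow> exp ((e (j, k))\<^sup>2 / 8) \<le> C * (1 + \<bar>2 powi j * t - real_of_int k\<bar>) ^ 4"
  shows "Limsup (at t) (\<lambda>s. ereal (\<bar>Z s - Z t\<bar> / \<bar>s - t\<bar> powr H t)) < \<infinity>"
    and "Limsup (at t) (\<lambda>s. ereal (\<bar>Z s - Z t\<bar> / (\<bar>s - t\<bar> powr H t * sqrt (ln (inverse \<bar>s - t\<bar>))))) < \<infinity>"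
proof -
  obtain R c where R: "0 < R" "R < 1" "0 < c"
     "\<And>s. 0 < \<bar>s - t\<bar> \<Longrightarrow> \<bar>s - t\<bar> \<le> R \<Longrightarrow> \<bar>H s - H t\<bar> \<le> c / ln (inverse \<bar>s - t\<bar>)"
    using H by blast
  have e': "exp ((e (j, k))\<^sup>2 / 8) \<le> C / exp 2 * exp (2 * 1\<^sup>2) * (1 + \<bar>2 powi j * t - real_of_int k\<bar>) ^ 4" if "0 \<le> j" for j k
    using e[OF that, of k] by simp
  obtain K d where d: "d > 0" and K: "\<And>s N. 0 \<le> N \<Longrightarrow> 0 < \<bar>s - t\<bar> \<Longrightarrow> \<bar>s - t\<bar> < d \<Longrightarrow>
     2 powr (- (real_of_int N + 1)) < \<bar>s - t\<bar> \<Longrightarrow> \<bar>s - t\<bar> \<le> 2 powr (- real_of_int N) \<Longrightarrow>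
     \<bar>Z s - Z t\<bar> \<le> K * 1 * \<bar>s - t\<bar> powr H t"
    using Z_local_modulus[of R c t "\<lambda>_. 1", OF R _ _ e'] by auto
  have bound: "\<bar>Z s - Z t\<bar> / \<bar>s - t\<bar> powr H t \<le> K" if s: "0 < \<bar>s - t\<bar>" "\<bar>s - t\<bar> < min d 1" for s
  proof -
    obtain N :: int where "0 \<le> N" "2 powr (- (real_of_int N + 1)) < \<bar>s - t\<bar>" "\<bar>s - t\<bar> \<le> 2 powr (- real_of_int N)"
      using dyadic_scale_exists[of "\<bar>s - t\<bar>"] s by auto
    then have "\<bar>Z s - Z t\<bar> \<le> K * \<bar>s - t\<bar> powr H t" using K s by auto
    then show ?thesis using s by (simp add: pos_divide_le_eq)
  qed
  show "Limsup (at t) (\<lambda>s. ereal (\<bar>Z s - Z t\<bar> / \<bar>s - t\<bar> powr H t)) < \<infinity>"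
    by (rule Limsup_finite_of_eventually_le[of _ K], rule eventually_at_dist_lt[of "min d 1"]) (use d bound in auto)
  show "Limsup (at t) (\<lambda>s. ereal (\<bar>Z s - Z t\<bar> / (\<bar>s - t\<bar> powr H t * sqrt (ln (inverse \<bar>s - t\<bar>))))) < \<infinity>"
  proof (rule Limsup_finite_of_eventually_le[of _ K], rule eventually_at_dist_lt[of "min (min d 1) (exp (- 1))"])
    fix s assume s: "0 < \<bar>s - t\<bar>" "\<bar>s - t\<bar> < min (min d 1) (exp (- 1))"
    have "ln \<bar>s - t\<bar> \<le> ln (exp (- 1))" using s by (intro ln_mono) auto
    then have l: "1 \<le> sqrt (ln (inverse \<bar>s - t\<bar>))" using s by (simp add: ln_inverse)
    have "\<bar>Z s - Z t\<bar> / (\<bar>s - t\<bar> powr H t * sqrt (ln (inverse \<bar>s - t\<bar>))) = (\<bar>Z s - Z t\<bar> / \<bar>s - t\<bar> powr H t) / sqrt (ln (inverse \<bar>s - t\<bar>))"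
      by simp
    also have "\<dots> \<le> (\<bar>Z s - Z t\<bar> / \<bar>s - t\<bar> powr H t) / 1"
      using l by (intro divide_left_mono) auto
    also have "\<dots> \<le> K" using bound[of s] s by simp
    finally show "\<bar>Z s - Z t\<bar> / (\<bar>s - t\<bar> powr H t * sqrt (ln (inverse \<bar>s - t\<bar>))) \<le> K" .
  qed (use d in auto)
qed

text \<open>
  The case \<open>g j = sqrt (ln (3 + j))\<close>: at scale \<open>2\<^sup>-\<^sup>N\<close> one has \<open>N \<le> 2 ln (1/|s - t|)\<close>, so that \<open>g N\<close> is at most
  \<open>sqrt 2 * sqrt (ln (ln (1/|s - t|)))\<close> once \<open>ln (1/|s - t|) \<ge> 3\<close>.
\<close>
lemma ordinary_point_Limsup:
  assumes H: "\<exists>R c. 0 < R \<and> R < 1 \<and> 0 < c \<and>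
           (\<forall>s. 0 < \<bar>s - t\<bar> \<and> \<bar>s - t\<bar> \<le> R \<longrightarrow> \<bar>H s - H t\<bar> \<le> c / ln (inverse \<bar>s - t\<bar>))"
    and e: "\<And>j k. 0 \<le> j \<Longrightarrow> exp ((e (j, k))\<^sup>2 / 8) \<le> C * (3 + real_of_int j)\<^sup>2 * (1 + \<bar>2 powi j * t - real_of_int k\<bar>) ^ 4"
  shows "Limsup (at t) (\<lambda>s. ereal (\<bar>Z s - Z t\<bar> / (\<bar>s - t\<bar> powr H t * sqrt (ln (ln (inverse \<bar>s - t\<bar>)))))) < \<infinity>"
proof -
  obtain R c where R: "0 < R" "R < 1" "0 < c"
     "\<And>s. 0 < \<bar>s - t\<bar> \<Longrightarrow> \<bar>s - t\<bar> \<le> R \<Longrightarrow> \<bar>H s - H t\<bar> \<le> c / ln (inverse \<bar>s - t\<bar>)"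
    using H by blast
  define g where "g j = sqrt (ln (3 + real_of_int j))" for j :: int
  have g1: "1 \<le> g j" if "0 \<le> j" for j unfolding g_def using sqrt_ln_slow(1)[OF that that] .
  have g2: "g j \<le> g N * (1 + \<bar>real_of_int (j - N)\<bar>)" if "0 \<le> j" "0 \<le> N" for j N
    unfolding g_def using sqrt_ln_slow(2)[OF that] .
  have e': "exp ((e (j, k))\<^sup>2 / 8) \<le> C * exp (2 * (g j)\<^sup>2) * (1 + \<bar>2 powi j * t - real_of_int k\<bar>) ^ 4" if "0 \<le> j" for j k
  proof -
    have "(g j)\<^sup>2 = ln (3 + real_of_int j)" using that by (simp add: g_def)
    then have "exp (2 * (g j)\<^sup>2) = (exp (ln (3 + real_of_int j)))\<^sup>2"
      by (simp only: exp_double)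
    also have "\<dots> = (3 + real_of_int j)\<^sup>2" using that by simp
    finally show ?thesis using e[OF that, of k] by simp
  qed
  obtain K d where d: "d > 0" and K: "\<And>s N. 0 \<le> N \<Longrightarrow> 0 < \<bar>s - t\<bar> \<Longrightarrow> \<bar>s - t\<bar> < d \<Longrightarrow>
     2 powr (- (real_of_int N + 1)) < \<bar>s - t\<bar> \<Longrightarrow> \<bar>s - t\<bar> \<le> 2 powr (- real_of_int N) \<Longrightarrow>
     \<bar>Z s - Z t\<bar> \<le> K * g N * \<bar>s - t\<bar> powr H t"
    using Z_local_modulus[of R c t g, OF R g1 g2 e'] by blast
  show ?thesis
  proof (rule Limsup_finite_of_eventually_le[of _ "\<bar>K\<bar> * sqrt 2"], rule eventually_at_dist_lt[of "min (min d 1) (exp (- 3))"])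
    fix s assume s: "0 < \<bar>s - t\<bar>" "\<bar>s - t\<bar> < min (min d 1) (exp (- 3))"
    let ?h = "\<bar>s - t\<bar>"
    define L where "L = ln (inverse ?h)"
    have "ln ?h \<le> ln (exp (- 3))" using s by (intro ln_mono) auto
    then have L: "3 \<le> L" using s by (simp add: L_def ln_inverse)
    obtain N :: int where N: "0 \<le> N" "2 powr (- (real_of_int N + 1)) < ?h" "?h \<le> 2 powr (- real_of_int N)" "real_of_int N \<le> 2 * L"
      using dyadic_scale_exists[of ?h] s unfolding L_def by auto
    have "3 + real_of_int N \<le> 3 * L" using N L by linarith
    also have "\<dots> \<le> L * L" using L by (intro mult_right_mono) auto
    finally have "ln (3 + real_of_int N) \<le> ln (L * L)" using N L by (intro ln_mono) auto
    also have "\<dots> = 2 * ln L" using L by (simp add: ln_mult)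
    finally have "g N \<le> sqrt (2 * ln L)" unfolding g_def by (rule real_sqrt_le_mono)
    then have gN: "g N \<le> sqrt 2 * sqrt (ln L)" by (simp add: real_sqrt_mult)
    have lL: "0 < ln L" using L by simp
    have "?h < d" using s by simp
    then have "\<bar>Z s - Z t\<bar> \<le> K * g N * ?h powr H t" using K[OF N(1) s(1) _ N(2,3)] by simp
    also have "\<dots> \<le> \<bar>K\<bar> * (sqrt 2 * sqrt (ln L)) * ?h powr H t"
      using gN g1[OF N(1)] by (intro mult_right_mono mult_mono) auto
    finally have "\<bar>Z s - Z t\<bar> \<le> \<bar>K\<bar> * sqrt 2 * (?h powr H t * sqrt (ln L))"
      by (simp only: mult_ac)
    then show "\<bar>Z s - Z t\<bar> / (?h powr H t * sqrt (ln (ln (inverse ?h)))) \<le> \<bar>K\<bar> * sqrt 2"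
      unfolding L_def[symmetric] using lL s by (simp add: pos_divide_le_eq)
  qed (use d in auto)
qed

end

lemma dyadic_interval_subset:
  fixes I :: "real set"
  assumes "open I" "I \<noteq> {}"
  obtains j0 :: nat and k0 :: int where "{real_of_int k0 / 2 ^ j0 .. (real_of_int k0 + 1) / 2 ^ j0} \<subseteq> I"
proof -
  obtain x r where x: "r > 0" "ball x r \<subseteq> I"
    using assms by (meson ex_in_conv openE)
  obtain j0 :: nat where j0: "(1/2::real) ^ j0 < r"
    using real_arch_pow_inv[OF x(1), of "1/2"] by auto
  define k0 where "k0 = \<lfloor>2 ^ j0 * x\<rfloor>"
  have k: "real_of_int k0 \<le> 2 ^ j0 * x" "2 ^ j0 * x < real_of_int k0 + 1"
    unfolding k0_def by linarith+
  have "{real_of_int k0 / 2 ^ j0 .. (real_of_int k0 + 1) / 2 ^ j0} \<subseteq> ball x r"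
  proof
    fix y assume "y \<in> {real_of_int k0 / 2 ^ j0 .. (real_of_int k0 + 1) / 2 ^ j0}"
    then have y: "real_of_int k0 \<le> 2 ^ j0 * y" "2 ^ j0 * y \<le> real_of_int k0 + 1"
      by (auto simp: field_simps)
    have "\<bar>2 ^ j0 * x - 2 ^ j0 * y\<bar> \<le> 1" using k y by linarith
    then have "2 ^ j0 * \<bar>x - y\<bar> \<le> 1" by (simp flip: right_diff_distrib add: abs_mult)
    then have "\<bar>x - y\<bar> \<le> (1/2) ^ j0" by (simp add: field_simps power_one_over)
    then show "y \<in> ball x r" using j0 by (simp add: dist_real_def)
  qed
  then show ?thesis using x that by blast
qed

theorem theorem3p8:
  fixes \<psi> H :: "real \<Rightarrow> real" and a b :: real
    and M :: "'w measure" and \<epsilon> :: "int \<times> int \<Rightarrow> 'w \<Rightarrow> real"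
  assumes "lemarie_meyer_wavelet \<psi>"
    and "0 < a" and "a < b" and "b < 1"
    and "\<And>t. H t \<in> {a..b}"
    and "\<And>t. \<exists>R c. 0 < R \<and> R < 1 \<and> 0 < c \<and>
           (\<forall>s. 0 < \<bar>s - t\<bar> \<and> \<bar>s - t\<bar> \<le> R \<longrightarrow> \<bar>H s - H t\<bar> \<le> c / ln (inverse \<bar>s - t\<bar>))"
    and "prob_space M"
    and "prob_space.indep_vars M (\<lambda>_. borel) \<epsilon> UNIV"
    and "\<And>p. distributed M lborel (\<epsilon> p) std_normal_density"
  defines "Z \<equiv> Zproc \<psi> H \<epsilon>"
  shows "AE \<omega> in M. \<forall>I::real set. open I \<and> is_interval I \<and> I \<noteq> {} \<longrightarrow>
     (\<exists>t\<in>I. Limsup (at t) (\<lambda>s. ereal (\<bar>Z s \<omega> - Z t \<omega>\<bar> /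
          (\<bar>s - t\<bar> powr H t * sqrt (ln (inverse \<bar>s - t\<bar>))))) < \<infinity>) \<and>
     (AE t in lebesgue. t \<in> I \<longrightarrow>
        Limsup (at t) (\<lambda>s. ereal (\<bar>Z s \<omega> - Z t \<omega>\<bar> /
          (\<bar>s - t\<bar> powr H t * sqrt (ln (ln (inverse \<bar>s - t\<bar>)))))) < \<infinity>) \<and>
     (\<exists>t\<in>I. Limsup (at t) (\<lambda>s. ereal (\<bar>Z s \<omega> - Z t \<omega>\<bar> / \<bar>s - t\<bar> powr H t)) < \<infinity>)"
proof -
  interpret gaussian_field M \<epsilon>
    using assms(7,8,9) by (simp add: gaussian_field_def gaussian_field_axioms_def)
  obtain CP where CP: "CP > 0" "\<And>x y \<theta>. \<theta> \<in> {a..b} \<Longrightarrow> \<bar>Psi \<psi> x \<theta> - Psi \<psi> y \<theta>\<bar> \<le>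
     CP * min 1 \<bar>x - y\<bar> * (1 / (1 + \<bar>x\<bar>) ^ 4 + 1 / (1 + \<bar>y\<bar>) ^ 4)"
    using Psi_increment_bound[OF assms(1)] by blast
  have "AE \<omega> in M. \<forall>j0 k0. \<exists>A. \<forall>n. tree (window j0 k0) A j0 k0 \<omega> n \<noteq> {}"
    unfolding AE_all_countable by (intro allI AE_slow_tree_infinite finite_window)
  with AE_global_growth AE_ordinary show ?thesis
  proof eventually_elim
    fix \<omega>
    assume G: "\<exists>C. \<forall>j k. phi (\<epsilon> (j, k) \<omega>) \<le> C * ((1 + \<bar>real_of_int j\<bar>) * (1 + \<bar>real_of_int k\<bar>))\<^sup>2"
      and ord: "AE t in lborel. ordinary t \<omega>"
      and tree: "\<forall>j0 k0. \<exists>A. \<forall>n. tree (window j0 k0) A j0 k0 \<omega> n \<noteq> {}"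
    define e where "e p = \<epsilon> p \<omega>" for p
    interpret W: wavelet_series "Psi \<psi>" H a b CP e
      by unfold_locales (use assms CP G in \<open>auto simp: e_def phi_def\<close>)
    have Z: "Z t \<omega> = W.Z t" for t
      by (simp add: Z_def Zproc_def W.Z_def W.incr_def W.node_def e_def)
    have ae: "AE t in lebesgue. Limsup (at t) (\<lambda>s. ereal (\<bar>W.Z s - W.Z t\<bar> /
          (\<bar>s - t\<bar> powr H t * sqrt (ln (ln (inverse \<bar>s - t\<bar>)))))) < \<infinity>"
      using AE_completion[OF ord]
    proof eventually_elim
      fix t assume "ordinary t \<omega>"
      from ordinary_growth[OF this] obtain C where
        "\<And>j k. 0 \<le> j \<Longrightarrow> phi (\<epsilon> (j, k) \<omega>) \<le> C * (3 + real_of_int j)\<^sup>2 * (1 + \<bar>2 powi j * t - real_of_int k\<bar>) ^ 4"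
        by blast
      then show "Limsup (at t) (\<lambda>s. ereal (\<bar>W.Z s - W.Z t\<bar> /
          (\<bar>s - t\<bar> powr H t * sqrt (ln (ln (inverse \<bar>s - t\<bar>)))))) < \<infinity>"
        by (intro W.ordinary_point_Limsup[OF assms(6)]) (simp add: e_def phi_def)
    qed
    have slow: "\<exists>t\<in>I. \<exists>C. \<forall>j k. 0 \<le> j \<longrightarrow> exp ((e (j, k))\<^sup>2 / 8) \<le> C * (1 + \<bar>2 powi j * t - real_of_int k\<bar>) ^ 4"
      if I: "open I" "I \<noteq> {}" for I
    proof -
      obtain j0 k0 where sub: "{real_of_int k0 / 2 ^ j0 .. (real_of_int k0 + 1) / 2 ^ j0} \<subseteq> I"
        using dyadic_interval_subset[OF I] by blast
      obtain A where "\<And>n. slow_tree (window j0 k0) A j0 k0 e n \<noteq> {}"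
        using tree unfolding e_def by blast
      moreover obtain C where "\<And>j k. phi (e (j, k)) \<le> C * ((1 + \<bar>real_of_int j\<bar>) * (1 + \<bar>real_of_int k\<bar>))\<^sup>2"
        using G unfolding e_def by blast
      ultimately show ?thesis
        using slow_point_of_tree[of e C j0 k0 A] sub unfolding phi_def by blast
    qed
    show "\<forall>I::real set. open I \<and> is_interval I \<and> I \<noteq> {} \<longrightarrow>
     (\<exists>t\<in>I. Limsup (at t) (\<lambda>s. ereal (\<bar>Z s \<omega> - Z t \<omega>\<bar> /
          (\<bar>s - t\<bar> powr H t * sqrt (ln (inverse \<bar>s - t\<bar>))))) < \<infinity>) \<and>
     (AE t in lebesgue. t \<in> I \<longrightarrow>
        Limsup (at t) (\<lambda>s. ereal (\<bar>Z s \<omega> - Z t \<omega>\<bar> /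
          (\<bar>s - t\<bar> powr H t * sqrt (ln (ln (inverse \<bar>s - t\<bar>)))))) < \<infinity>) \<and>
     (\<exists>t\<in>I. Limsup (at t) (\<lambda>s. ereal (\<bar>Z s \<omega> - Z t \<omega>\<bar> / \<bar>s - t\<bar> powr H t)) < \<infinity>)"
      unfolding Z
    proof (intro allI impI conjI)
      fix I :: "real set" assume I: "open I \<and> is_interval I \<and> I \<noteq> {}"
      then obtain t C where t: "t \<in> I"
        and C: "\<And>j k. 0 \<le> j \<Longrightarrow> exp ((e (j, k))\<^sup>2 / 8) \<le> C * (1 + \<bar>2 powi j * t - real_of_int k\<bar>) ^ 4"
        using slow[of I] by blast
      show "\<exists>t\<in>I. Limsup (at t) (\<lambda>s. ereal (\<bar>W.Z s - W.Z t\<bar> /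
          (\<bar>s - t\<bar> powr H t * sqrt (ln (inverse \<bar>s - t\<bar>))))) < \<infinity>"
        using t by (rule bexI[rotated]) (rule W.slow_point_Limsup(2)[OF assms(6) C])
      show "\<exists>t\<in>I. Limsup (at t) (\<lambda>s. ereal (\<bar>W.Z s - W.Z t\<bar> / \<bar>s - t\<bar> powr H t)) < \<infinity>"
        using t by (rule bexI[rotated]) (rule W.slow_point_Limsup(1)[OF assms(6) C])
      show "AE t in lebesgue. t \<in> I \<longrightarrow> Limsup (at t) (\<lambda>s. ereal (\<bar>W.Z s - W.Z t\<bar> /
          (\<bar>s - t\<bar> powr H t * sqrt (ln (ln (inverse \<bar>s - t\<bar>)))))) < \<infinity>"
        using ae by eventually_elim simp
    qed
  qed
qed

end
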